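(* Let $\Phi:\mathbb D\to\mathbb D$ be a continuous map. The following conditions are equivalent: (i) For every indexed sequence $\Lambda\subset\mathbb D$, $\Lambda\in\mathcal C$ if and only if $\Phi(\Lambda)\in\mathcal C$. (ii) $\Phi$ is a homeomorphism of $\mathbb D$ onto itself, both $\Phi$ and $\Phi^{-1}$ are uniformly continuous with respect to $\rho$, and $T_\Phi$ and $T_{\Phi^{-1}}$ act boundedly on the cone of positive Carleson measures (that is, there is a constant $C<\infty$ such that $\|T_\Phi\mu\|_{\mathrm{CM}}\le C\|\mu\|_{\mathrm{CM}}$ and $\|T_{\Phi^{-1}}\mu\|_{\mathrm{CM}}\le C\|\mu\|_{\mathrm{CM}}$ for every positive Carleson measure $\mu$).
   Context: $\mathbb D=\{z\in\mathbb C:|z|<1\}$, $\mathbb T=\partial\mathbb D$, and $\rho(z,w)=\left|\frac{z-w}{1-\overline z w}\right|$ is the pseudohyperbolic metric on $\mathbb D$. Sequences are indexed families $\Lambda=(\lambda_j)$ (finite or countably infinite) of points of $\mathbb D$; the image $\Phi(\Lambda)=(\Phi(\lambda_j))$ retains repeated terms. $\mathcal C$ denotes the class of Carleson (interpolating) sequences: $\Lambda=(\lambda_j)\in\mathcal C$ if every bounded scalar sequence $(a_j)$ is of the form $a_j=f(\lambda_j)$ for some $f\in H^\infty(\mathbb D)$. Finite sequences of distinct points belong to $\mathcal C$; a sequence with a repeated term does not. Carleson measures: for an arc $I\subset\mathbb T$ let $|I|$ be its normalized arclength. For $0<|I|<1$ set $S(I)=\{r\zeta:\zeta\in I,\ 0<r<1,\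 1-r\le|I|\}$, and $S(\mathbb T)=\mathbb D$. For a positive Borel measure $\mu$ on $\mathbb D$, $\|\mu\|_{\mathrm{CM}}=\sup_{0<|I|\le1}\mu(S(I))/|I|$ (with $I=\mathbb T$ when $|I|=1$); $\mu$ is a positive Carleson measure if $\|\mu\|_{\mathrm{CM}}<\infty$. Weighted pushforward of a continuous map $\Phi:\mathbb D\to\mathbb D$: $q_\Phi(z)=\frac{1-|\Phi(z)|^2}{1-|z|^2}$ and $T_\Phi\mu=\Phi_*(q_\Phi\mu)$, i.e. $(T_\Phi\mu)(E)=\int_{\Phi^{-1}(E)}q_\Phi\,d\mu$ for Borel $E\subset\mathbb D$. *)

theory Defs
  imports "HOL-Analysis.Analysis"
begin

abbreviation unit_disc :: "complex set" where
  "unit_disc \<equiv> ball 0 1"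

abbreviation unit_circle :: "complex set" where
  "unit_circle \<equiv> sphere 0 1"


definition pseudohyperbolic :: "complex \<Rightarrow> complex \<Rightarrow> real" where
  "pseudohyperbolic z w = norm ((z - w) / (1 - cnj z * w))"

definition pseudohyperbolic_uniformly_continuous :: "(complex \<Rightarrow> complex) \<Rightarrow> bool" where
  "pseudohyperbolic_uniformly_continuous f \<longleftrightarrow>
     (\<forall>e>0. \<exists>d>0. \<forall>z\<in>unit_disc. \<forall>w\<in>unit_disc.
        pseudohyperbolic z w < d \<longrightarrow> pseudohyperbolic (f z) (f w) < e)"


definition H_infinity :: "(complex \<Rightarrow> complex) set" where
  "H_infinity = {f. f holomorphic_on unit_disc \<and> bounded (f ` unit_disc)}"

text \<open>
  A finite or countably infinite indexed family is given by a set \<open>J\<close> of natural numbers and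
  a function \<open>l\<close>, of which only the values on \<open>J\<close> matter. Terms may repeat, so this is not
  a property of the set \<open>l ` J\<close>.
\<close>

definition carleson_sequence :: "nat set \<Rightarrow> (nat \<Rightarrow> complex) \<Rightarrow> bool" where
  "carleson_sequence J l \<longleftrightarrow>
     l ` J \<subseteq> unit_disc \<and>
     (\<forall>a :: nat \<Rightarrow> complex. bounded (a ` J) \<longrightarrow> (\<exists>f\<in>H_infinity. \<forall>j\<in>J. a j = f (l j)))"


text \<open>Arcs may be open, closed or half-open; an interval of angles of length at least one
  turn gives the full circle.\<close>

definition circle_arc :: "complex set \<Rightarrow> bool" where
  "circle_arc I \<longleftrightarrow> (\<exists>A::real set. is_interval A \<and> I = (\<lambda>t. cis (2 * pi * t)) ` A)"

definition arc_measure :: "complex set \<Rightarrow> real" where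
  "arc_measure I = measure lborel {t \<in> {0..<1}. cis (2 * pi * t) \<in> I}"

text \<open>The only arc of full measure that is admitted is the circle itself
  (not the circle with a point removed).\<close>

definition carleson_arcs :: "complex set set" where
  "carleson_arcs = {I. circle_arc I \<and> 0 < arc_measure I \<and> (arc_measure I = 1 \<longrightarrow> I = unit_circle)}"

definition carleson_box :: "complex set \<Rightarrow> complex set" where
  "carleson_box I =
     (if I = unit_circle then unit_disc
      else {of_real r * \<zeta> | r \<zeta>. \<zeta> \<in> I \<and> 0 < r \<and> r < 1 \<and> 1 - r \<le> arc_measure I})"

abbreviation disc_borel :: "complex measure" where
  "disc_borel \<equiv> restrict_space borel unit_disc"

definition carleson_norm :: "complex measure \<Rightarrow> ennreal" where
  "carleson_norm \<mu> =
     (SUP I\<in>carleson_arcs. emeasure \<mu> (carleson_box I) / ennreal (arc_measure I))"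

definition positive_carleson_measure :: "complex measure \<Rightarrow> bool" where
  "positive_carleson_measure \<mu> \<longleftrightarrow> sets \<mu> = sets disc_borel \<and> carleson_norm \<mu> < \<infinity>"


definition conformal_weight :: "(complex \<Rightarrow> complex) \<Rightarrow> complex \<Rightarrow> real" where
  "conformal_weight \<Phi> z = (1 - (norm (\<Phi> z))\<^sup>2) / (1 - (norm z)\<^sup>2)"

definition weighted_pushforward :: "(complex \<Rightarrow> complex) \<Rightarrow> complex measure \<Rightarrow> complex measure" where
  "weighted_pushforward \<Phi> \<mu> = distr (density \<mu> (\<lambda>z. ennreal (conformal_weight \<Phi> z))) disc_borel \<Phi>"

end

theory Submission
  imports Defs "HOL-Complex_Analysis.Complex_Analysis"
begin

text \<open>
  The bridge between the two conditions is Carleson's interpolation theorem: a sequence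
  \<lambda>_j in the disc is interpolating if and only if it is separated in the
  pseudohyperbolic metric and \<Sum>_j (1-|\<lambda>_j|^2) \<delta>(\<lambda>_j) is a
  Carleson measure. Write b = 1-\<rho>^2, that is b(z,w) = (1-|z|^2)(1-|w|^2)/|1-(cnj z)
  w|^2. The Carleson condition is used in the equivalent form that the sums \<Sum>_k
  b(\<lambda>_j,\<lambda>_k) are bounded uniformly in j, and both directions of the theorem
  are proved below. Sufficiency (\<open>carleson_sequence_sufficient\<close>) uses the
  explicit interpolating functions of P. Jones for finite sets, with a constant that depends
  only on the separation and on the kernel sums, followed by a normal family argument. For
  necessity (\<open>carleson_sequence_necessary\<close>) a gliding hump gives a uniform
  interpolation constant M; dividing by Blaschke factors bounds the product over k \<noteq>
  j of the distances \<rho>(\<lambda>_j,\<lambda>_k) from below by 1/M, which contains both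
  conditions.

  From (ii) to (i): uniform continuity of the inverse keeps the images separated, and
  T_\<Phi> maps \<Sum>_j (1-|\<lambda>_j|^2)\<delta>(\<lambda>_j) to \<Sum>_j
  (1-|\<Phi>(\<lambda>_j)|^2)\<delta>(\<Phi>(\<lambda>_j)) because the weight q_\<Phi>
  exchanges the two defects. Hence \<Phi> carries interpolating sequences to interpolating
  sequences (\<open>carleson_sequence_pushforward\<close>), and so does its inverse.

  From (i) to (ii): two-point sequences show that \<Phi> is injective. Sequences that tend
  to the boundary fast enough are interpolating, and an interpolating sequence does not
  accumulate inside the disc; so \<Phi> is proper. Invariance of domain then makes \<Phi> a
  homeomorphism onto the disc (\<open>carleson_preserving_homeomorphism\<close>). If uniform
  continuity failed, pairs of points with vanishing distance and separated images could be
  chosen so sparsely that the images form an interpolating sequence although the points do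
  not.

  The boundedness of T_\<Phi> is the main difficulty, since (i) only speaks of sums of point
  masses of the full size 1-|\<lambda>|^2, whereas a Carleson measure may put a small
  fraction of that mass on each cell of a Whitney decomposition. For a fixed arc I the mass
  (T_\<Phi>\<mu>)(S(I)) is the integral against \<mu> of q_\<Phi> restricted to the preimage
  of S(I). Cover the level set of this function at height |I| 4^k by the boxes of the
  maximal dyadic arcs whose cell it meets. Up to a part of size |I|, this bounds the
  integral by a constant times the Carleson norm of \<mu> times the sum of the 4^k|I| |Q|
  over all these arcs Q. An arc more than half of which is covered by the arcs of the next
  level contributes little, because the heights grow by the factor 4. The remaining arcs are
  sparse (\<open>laminar_sparse_subfamily\<close>), so one point in each of their cells
  gives, after a splitting into finitely many colours, separated families with uniformly
  bounded Carleson constant. It remains to bound \<Sum> (1-|\<Phi>(z)|^2), over the points z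
  of such a family with \<Phi>(z)\<in> S(I), by a constant times |I|
  (\<open>carleson_family_box_mass_bounded\<close>): otherwise one finds families of small
  total mass, ever closer to the boundary, with large sums, and their union is an
  interpolating sequence whose image is not.
\<close>

section \<open>The invariant kernel of the disc\<close>

abbreviation defect :: "complex \<Rightarrow> real" where
  "defect z \<equiv> 1 - (norm z)\<^sup>2"

text \<open>
  This is b = 1-\<rho>^2 (see \<open>pseudohyperbolic_sq\<close>). Summing it over a
  sequence is the conformally invariant way to test the Carleson condition.
\<close>

definition disc_kernel :: "complex \<Rightarrow> complex \<Rightarrow> real" where
  "disc_kernel z w = defect z * defect w / (norm (1 - cnj z * w))\<^sup>2"

lemma one_minus_cnj_mult_nonzero:
  assumes "norm z \<le> 1" "norm w < 1"
  shows "1 - cnj z * w \<noteq> 0"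
proof
  assume "1 - cnj z * w = 0"
  then have "norm (cnj z * w) = 1" by (metis eq_iff_diff_eq_0 norm_one)
  moreover have "norm (cnj z * w) \<le> norm w"
    using assms by (simp add: norm_mult mult_left_le_one_le)
  ultimately show False using assms by simp
qed

lemma norm_one_minus_cnj_mult_commute:
  "norm (1 - cnj z * w) = norm (1 - cnj w * z)"
  by (metis complex_cnj_cnj complex_cnj_diff complex_cnj_mult complex_cnj_one complex_mod_cnj mult.commute)

lemma disc_kernel_commute: "disc_kernel z w = disc_kernel w z"
  unfolding disc_kernel_def norm_one_minus_cnj_mult_commute[of z w] by (simp only: mult.commute)

lemma defect_pos: "norm (z::complex) < 1 \<Longrightarrow> 0 < defect z"
  by (simp add: power_less_one_iff abs_square_less_1)

lemma defect_nonneg: "norm (z::complex) < 1 \<Longrightarrow> 0 \<le> defect z"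
  using defect_pos[of z] by simp

lemma defect_bounds:
  assumes "norm (w::complex) < 1" shows "1 - norm w \<le> defect w" "defect w \<le> 2 * (1 - norm w)"
proof -
  have "0 \<le> (1 - norm w)\<^sup>2" by simp
  then show "defect w \<le> 2 * (1 - norm w)" by (simp add: power2_eq_square algebra_simps)
  show "1 - norm w \<le> defect w" using assms by (simp add: power2_eq_square mult_left_le)
qed

lemma disc_kernel_nonneg: "norm z < 1 \<Longrightarrow> norm w < 1 \<Longrightarrow> 0 \<le> disc_kernel z w"
  unfolding disc_kernel_def using defect_pos by (simp add: less_imp_le)

lemma disc_kernel_self: "norm z < 1 \<Longrightarrow> disc_kernel z z = 1"
proof -
  assume z: "norm z < 1"
  have "1 - cnj z * z = of_real (defect z)"
    by (metis complex_norm_square mult.commute of_real_1 of_real_diff of_real_power)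
  then have "norm (1 - cnj z * z) = defect z"
    using defect_pos[OF z] by (metis abs_of_pos norm_of_real)
  then show ?thesis unfolding disc_kernel_def
    using defect_pos[OF z] by (simp add: power2_eq_square)
qed

lemma pseudohyperbolic_commute: "pseudohyperbolic z w = pseudohyperbolic w z"
  by (simp add: pseudohyperbolic_def norm_divide norm_one_minus_cnj_mult_commute[of z w] norm_minus_commute)

lemma pseudohyperbolic_sq:
  assumes "norm z < 1" "norm w < 1"
  shows "(pseudohyperbolic z w)\<^sup>2 = 1 - disc_kernel z w"
proof -
  have "(norm (1 - cnj z * w))\<^sup>2 - (norm (z - w))\<^sup>2 = defect z * defect w"
    by (simp only: cmod_power2) (simp add: algebra_simps power2_eq_square)
  moreover have "(norm (1 - cnj z * w))\<^sup>2 > 0"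
    using one_minus_cnj_mult_nonzero[of z w] assms by simp
  ultimately show ?thesis
    unfolding pseudohyperbolic_def disc_kernel_def norm_divide power_divide
    by (simp add: field_simps)
qed

lemma pseudohyperbolic_nonneg: "0 \<le> pseudohyperbolic z w"
  by (simp add: pseudohyperbolic_def)

lemma disc_kernel_le_one: "norm z < 1 \<Longrightarrow> norm w < 1 \<Longrightarrow> disc_kernel z w \<le> 1"
  using pseudohyperbolic_sq[of z w] by (smt (verit) zero_le_power2)

lemma pseudohyperbolic_less_one:
  assumes "norm z < 1" "norm w < 1" shows "pseudohyperbolic z w < 1"
proof -
  have "disc_kernel z w > 0" unfolding disc_kernel_def
    using defect_pos assms one_minus_cnj_mult_nonzero[of z w] by simp
  then have "(pseudohyperbolic z w)\<^sup>2 < 1" using pseudohyperbolic_sq[OF assms] by simp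
  then show ?thesis by (simp add: power_less_one_iff abs_square_less_1 pseudohyperbolic_nonneg)
qed

lemma pseudohyperbolic_self [simp]: "pseudohyperbolic z z = 0"
  by (simp add: pseudohyperbolic_def)

lemma norm_Moebius: "norm (Moebius_function 0 a z) = pseudohyperbolic a z"
  by (simp add: Moebius_function_simple pseudohyperbolic_def norm_divide norm_minus_commute)

lemma norm_one_minus_cnj_mult_ge: "norm z \<le> 1 \<Longrightarrow> 1 - norm w \<le> norm (1 - cnj z * w)"
proof -
  assume "norm z \<le> 1"
  then have "norm (cnj z * w) \<le> norm w" by (simp add: norm_mult mult_left_le_one_le)
  moreover have "1 - norm (cnj z * w) \<le> norm (1 - cnj z * w)"
    by (metis norm_one norm_triangle_ineq2)
  ultimately show ?thesis by linarith
qed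

section \<open>Finite interpolation by explicit functions\<close>

text \<open>
  When the points are listed with decreasing v, the left side is at most a lower Riemann sum
  of the integral of exp(-x) over the interval from 0 to the total of the t_k. Removing a
  point with minimal v is the induction step, and ties only decrease the left side.
\<close>

lemma sum_mult_exp_tail_le_one:
  fixes t v :: "'a \<Rightarrow> real"
  assumes "finite G" "\<And>k. k \<in> G \<Longrightarrow> 0 \<le> t k"
  shows "(\<Sum>j\<in>G. t j * exp (- (\<Sum>k\<in>{k\<in>G. v j \<le> v k}. t k))) \<le> 1 - exp (- (\<Sum>k\<in>G. t k))"
  using assms
proof (induction "card G" arbitrary: G)
  case 0
  then show ?case by simp
next
  case (Suc n)
  then have "G \<noteq> {}" by auto
  then obtain j where j: "j \<in> G" "\<And>k. k \<in> G \<Longrightarrow> v j \<le> v k"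
    using ex_min_if_finite[of "v ` G"] Suc.prems(1)
    by (metis (mono_tags, lifting) arg_min_if_finite(1) arg_min_least)
  define H where "H = G - {j}"
  have H: "finite H" "G = insert j H" "j \<notin> H" "card H = n"
    using Suc j by (auto simp: H_def)
  have IH: "(\<Sum>i\<in>H. t i * exp (- (\<Sum>k\<in>{k\<in>H. v i \<le> v k}. t k))) \<le> 1 - exp (- (\<Sum>k\<in>H. t k))"
    using Suc.hyps(1)[of H] H Suc.prems(2) by auto
  have all: "{k\<in>G. v j \<le> v k} = G" using j by auto
  have "(\<Sum>i\<in>H. t i * exp (- (\<Sum>k\<in>{k\<in>G. v i \<le> v k}. t k)))
      \<le> (\<Sum>i\<in>H. t i * exp (- (\<Sum>k\<in>{k\<in>H. v i \<le> v k}. t k)))"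
  proof (intro sum_mono mult_left_mono)
    fix i assume "i \<in> H"
    have "(\<Sum>k\<in>{k\<in>H. v i \<le> v k}. t k) \<le> (\<Sum>k\<in>{k\<in>G. v i \<le> v k}. t k)"
      by (rule sum_mono2) (use H Suc.prems in auto)
    then show "exp (- (\<Sum>k\<in>{k\<in>G. v i \<le> v k}. t k)) \<le> exp (- (\<Sum>k\<in>{k\<in>H. v i \<le> v k}. t k))" by simp
    show "0 \<le> t i" using \<open>i \<in> H\<close> H Suc.prems by auto
  qed
  moreover have "t j * exp (- (\<Sum>k\<in>G. t k)) \<le> exp (- (\<Sum>k\<in>H. t k)) - exp (- (\<Sum>k\<in>G. t k))"
  proof -
    have "1 + t j \<le> exp (t j)" by (rule exp_ge_add_one_self)
    then have "t j * exp (- (\<Sum>k\<in>G. t k)) \<le> (exp (t j) - 1) * exp (- (\<Sum>k\<in>G. t k))"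
      by (intro mult_right_mono) (simp_all add: algebra_simps)
    also have "\<dots> = exp (- (\<Sum>k\<in>H. t k)) - exp (- (\<Sum>k\<in>G. t k))"
      using H by (simp add: algebra_simps exp_add [symmetric])
    finally show ?thesis .
  qed
  moreover have "(\<Sum>i\<in>G. t i * exp (- (\<Sum>k\<in>{k\<in>G. v i \<le> v k}. t k)))
      = t j * exp (- (\<Sum>k\<in>G. t k)) + (\<Sum>i\<in>H. t i * exp (- (\<Sum>k\<in>{k\<in>G. v i \<le> v k}. t k)))"
    using H all by simp
  ultimately show ?case using IH by linarith
qed

text \<open>
  The formula of P. Jones. The j-th function is a normalized Blaschke product, which
  vanishes at the other points, times a factor decaying away from the j-th point, times an
  exponential. The exponential makes the absolute values of these functions summable: with
  t_k = (1-|l_k|^2) Re Q(l_k,z) the decaying factor is at most t_j, and the exponential is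
  exp(-\<Sum> t_k), summed over the points at least as close to the circle as l_j, up to the
  factor exp(2K) that normalizes it at l_j. The preceding lemma then bounds the sum of all
  these functions, whence the constant exp(2K)/\<delta>, independent of the number of
  points.
\<close>

lemma finite_interpolation_Jones:
  fixes l :: "'a \<Rightarrow> complex" and a :: "'a \<Rightarrow> complex"
  assumes fin: "finite G" and disc: "\<And>j. j \<in> G \<Longrightarrow> norm (l j) < 1"
    and prod: "\<And>j. j \<in> G \<Longrightarrow> \<delta> \<le> (\<Prod>k\<in>G - {j}. pseudohyperbolic (l k) (l j))"
    and "0 < \<delta>"
    and sum: "\<And>j. j \<in> G \<Longrightarrow> (\<Sum>k\<in>G. disc_kernel (l k) (l j)) \<le> K"
    and a: "\<And>j. j \<in> G \<Longrightarrow> norm (a j) \<le> 1"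
  obtains f where "f holomorphic_on ball 0 1" "\<And>z. norm z < 1 \<Longrightarrow> norm (f z) \<le> exp (2 * K) / \<delta>"
    "\<And>j. j \<in> G \<Longrightarrow> f (l j) = a j"
proof -
  define B :: "'a \<Rightarrow> complex \<Rightarrow> complex" where "B j z = (\<Prod>k\<in>G - {j}. Moebius_function 0 (l k) z)" for j z
  define Q where "Q w z = (1 + cnj w * z) / (1 - cnj w * z)" for w z :: complex
  define U where "U j = {k\<in>G. norm (l j) \<le> norm (l k)}" for j
  define S where "S j z = (\<Sum>k\<in>U j. of_real (defect (l k)) * Q (l k) z)" for j z
  define P where "P j z = ((defect (l j)) / (1 - cnj (l j) * z))\<^sup>2" for j and z :: complex
  \<comment> \<open>Each of the three factors takes the value 1 at the point l j.\<close>
  define F where "F j z = B j z / B j (l j) * P j z * exp (S j (l j) - S j z)" for j z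
  define f where "f z = (\<Sum>j\<in>G. a j * F j z)" for z
  have nz: "1 - cnj (l k) * z \<noteq> 0" if "k \<in> G" "norm z < 1" for k z
    using one_minus_cnj_mult_nonzero[of "l k" z] disc[OF that(1)] that(2) by simp
  have UG: "U j \<subseteq> G" "finite (U j)" for j using fin by (auto simp: U_def)
  have normB: "norm (B j (l j)) = (\<Prod>k\<in>G - {j}. pseudohyperbolic (l k) (l j))" if "j \<in> G" for j
    unfolding B_def prod_norm[symmetric] by (simp add: norm_Moebius)
  have Bj: "norm (B j (l j)) \<ge> \<delta>" if "j \<in> G" for j using normB[OF that] prod[OF that] by simp
  then have Bj0: "B j (l j) \<noteq> 0" if "j \<in> G" for j using that \<open>0 < \<delta>\<close> by force
  have Bz: "norm (B j z) \<le> 1" if "norm z < 1" for j z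
    unfolding B_def prod_norm[symmetric]
    by (rule prod_le_1) (use that disc in \<open>auto simp: norm_Moebius pseudohyperbolic_nonneg intro!: less_imp_le pseudohyperbolic_less_one\<close>)
  have holB: "B j holomorphic_on ball 0 1" for j
    unfolding B_def by (intro holomorphic_intros Moebius_function_holomorphic) (use disc in auto)
  have holS: "S j holomorphic_on ball 0 1" for j
    unfolding S_def Q_def by (intro holomorphic_intros) (use nz UG in auto)
  have holP: "P j holomorphic_on ball 0 1" if "j \<in> G" for j
    unfolding P_def by (intro holomorphic_intros) (use nz that in auto)
  have "F j holomorphic_on ball 0 1" if "j \<in> G" for j
    unfolding F_def using holB holS holP[OF that] Bj0[OF that]
    by (intro holomorphic_intros) auto
  then have "f holomorphic_on ball 0 1"
    unfolding f_def by (intro holomorphic_intros) auto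
  moreover have "f (l j) = a j" if "j \<in> G" for j
  proof -
    have "F i (l j) = 0" if "i \<in> G - {j}" for i
    proof -
      have "B i (l j) = 0" unfolding B_def
        by (rule prod_zero) (use fin \<open>j \<in> G\<close> that in \<open>auto intro!: bexI[of _ j] simp: Moebius_function_eq_zero\<close>)
      then show ?thesis by (simp add: F_def)
    qed
    moreover have "F j (l j) = 1"
    proof -
      have "1 - cnj (l j) * l j = of_real (defect (l j))"
        by (metis complex_norm_square mult.commute of_real_1 of_real_diff of_real_power)
      then have "P j (l j) = 1" using nz[OF that disc[OF that]] by (simp add: P_def)
      then show ?thesis using Bj0[OF that] by (simp add: F_def)
    qed
    ultimately show ?thesis unfolding f_def using fin that by (simp add: sum.remove[OF fin that])
  qed
  moreover have "norm (f z) \<le> exp (2 * K) / \<delta>" if z: "norm z < 1" for z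
  proof -
    have ReQ: "Re (Q w u) = (1 - (norm w)\<^sup>2 * (norm u)\<^sup>2) / (norm (1 - cnj w * u))\<^sup>2" for w u
    proof -
      have "Re ((1 + v) / (1 - v)) = defect v / (norm (1 - v))\<^sup>2" for v :: complex
      proof -
        have "Re ((1 + v) * cnj (1 - v)) = defect v"
          by (simp only: cmod_power2) (simp add: algebra_simps power2_eq_square)
        then show ?thesis by (simp only: complex_div_cnj[of "1 + v"] Re_divide_of_real of_real_power[symmetric])
      qed
      from this[of "cnj w * u"] show ?thesis
        by (simp add: Q_def norm_mult power_mult_distrib)
    qed
    define t where "t k = defect (l k) * Re (Q (l k) z)" for k
    have ReS: "Re (S j u) = (\<Sum>k\<in>U j. (defect (l k)) * Re (Q (l k) u))" for j u
      by (simp add: S_def)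
    have pos: "0 \<le> defect (l k)" if "k \<in> G" for k
      using defect_pos[OF disc[OF that]] by simp
    have mono: "defect w \<le> 1 - (norm w)\<^sup>2 * (norm u)\<^sup>2" if "norm u < 1" for w u :: complex
      using that by (simp add: mult_left_le power_le_one)
    have tP: "(defect (l j))\<^sup>2 / (norm (1 - cnj (l j) * z))\<^sup>2 \<le> t j" if "j \<in> G" for j
    proof -
      have "(defect (l j)) * defect (l j) \<le> (defect (l j)) * (1 - (norm (l j))\<^sup>2 * (norm z)\<^sup>2)"
        by (intro mult_left_mono mono pos that z)
      then show ?thesis unfolding t_def ReQ power2_eq_square[of "1 - _"]
        by (simp add: divide_right_mono)
    qed
    have t0: "0 \<le> t j" if "j \<in> G" for j
      by (rule order_trans[OF _ tP[OF that]]) simp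
    have Sj: "Re (S j (l j)) \<le> 2 * K" if "j \<in> G" for j
    proof -
      have "Re (S j (l j)) \<le> (\<Sum>k\<in>U j. 2 * disc_kernel (l k) (l j))"
        unfolding ReS
      proof (rule sum_mono)
        fix k assume k: "k \<in> U j"
        then have kG: "k \<in> G" and le: "norm (l j) \<le> norm (l k)" by (auto simp: U_def)
        \<comment> \<open>The ordering by modulus bounds the real part at l j by twice the kernel.\<close>
        have "((norm (l j))\<^sup>2)\<^sup>2 \<le> (norm (l k))\<^sup>2 * (norm (l j))\<^sup>2"
          unfolding power2_eq_square[of "(norm (l j))\<^sup>2"] using le by (intro mult_right_mono power_mono) auto
        moreover have "0 \<le> (defect (l j))\<^sup>2" by simp
        ultimately have "1 - (norm (l k))\<^sup>2 * (norm (l j))\<^sup>2 \<le> 2 * defect (l j)"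
          by (simp add: power2_eq_square algebra_simps)
        then have "(defect (l k)) * (1 - (norm (l k))\<^sup>2 * (norm (l j))\<^sup>2)
            \<le> (defect (l k)) * (2 * defect (l j))"
          using pos[OF kG] by (intro mult_left_mono)
        then show "(defect (l k)) * Re (Q (l k) (l j)) \<le> 2 * disc_kernel (l k) (l j)"
          unfolding ReQ disc_kernel_def times_divide_eq_right mult.left_commute[of 2]
          by (rule divide_right_mono) simp
      qed
      also have "\<dots> \<le> (\<Sum>k\<in>G. 2 * disc_kernel (l k) (l j))"
        using UG[of j] fin that disc by (intro sum_mono2) (auto intro: disc_kernel_nonneg)
      also have "\<dots> \<le> 2 * K" using sum[OF that] by (simp add: sum_distrib_left[symmetric])
      finally show ?thesis .
    qed
    have nF: "norm (F j z) \<le> exp (2 * K) / \<delta> * (t j * exp (- (\<Sum>k\<in>U j. t k)))" if "j \<in> G" for j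
    proof -
      have "norm (F j z) = norm (B j z) / norm (B j (l j)) * norm (P j z) * exp (Re (S j (l j)) - Re (S j z))"
        unfolding F_def by (simp add: norm_mult norm_divide)
      also have "\<dots> \<le> (1 / \<delta>) * t j * exp (2 * K - (\<Sum>k\<in>U j. t k))"
      proof (intro mult_mono)
        show "norm (B j z) / norm (B j (l j)) \<le> 1 / \<delta>"
          using Bz[OF z] Bj[OF that] \<open>0 < \<delta>\<close> by (intro frac_le) auto
        show "norm (P j z) \<le> t j"
        proof -
          have "norm (P j z) = (defect (l j))\<^sup>2 / (norm (1 - cnj (l j) * z))\<^sup>2"
            unfolding P_def norm_power norm_divide power_divide using pos[OF that]
            by (metis (no_types, opaque_lifting) abs_of_nonneg norm_of_real of_real_1 of_real_diff of_real_power)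
          then show ?thesis using tP[OF that] by simp
        qed
        show "exp (Re (S j (l j)) - Re (S j z)) \<le> exp (2 * K - (\<Sum>k\<in>U j. t k))"
          using Sj[OF that] by (simp add: ReS[of j z] t_def)
      qed (use t0[OF that] \<open>0 < \<delta>\<close> in auto)
      also have "\<dots> = exp (2 * K) / \<delta> * (t j * exp (- (\<Sum>k\<in>U j. t k)))"
        by (simp add: exp_diff exp_minus field_simps)
      finally show ?thesis .
    qed
    have "norm (f z) \<le> (\<Sum>j\<in>G. norm (a j * F j z))" unfolding f_def by (rule norm_sum)
    also have "\<dots> \<le> (\<Sum>j\<in>G. exp (2 * K) / \<delta> * (t j * exp (- (\<Sum>k\<in>U j. t k))))"
    proof (rule sum_mono)
      fix j assume j: "j \<in> G"
      have "norm (a j * F j z) \<le> norm (F j z)"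
        using a[OF j] by (simp add: norm_mult mult_left_le_one_le)
      then show "norm (a j * F j z) \<le> exp (2 * K) / \<delta> * (t j * exp (- (\<Sum>k\<in>U j. t k)))"
        using nF[OF j] by simp
    qed
    also have "\<dots> = exp (2 * K) / \<delta> * (\<Sum>j\<in>G. t j * exp (- (\<Sum>k\<in>U j. t k)))"
      by (simp add: sum_distrib_left)
    also have "\<dots> \<le> exp (2 * K) / \<delta> * 1"
    proof (intro mult_left_mono)
      have "(\<Sum>j\<in>G. t j * exp (- (\<Sum>k\<in>U j. t k))) \<le> 1 - exp (- (\<Sum>k\<in>G. t k))"
        unfolding U_def by (rule sum_mult_exp_tail_le_one[OF fin t0])
      then show "(\<Sum>j\<in>G. t j * exp (- (\<Sum>k\<in>U j. t k))) \<le> 1" by (smt (verit) exp_gt_zero)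
    qed (use \<open>0 < \<delta>\<close> in auto)
    finally show ?thesis by simp
  qed
  ultimately show ?thesis using that by blast
qed

section \<open>Interpolating sequences: separation and bounded kernel sums\<close>

text \<open>
  Unlike \<open>carleson_sequence\<close>, this records a bound for the interpolating
  function.
\<close>

definition interpolable :: "real \<Rightarrow> nat set \<Rightarrow> (nat \<Rightarrow> complex) \<Rightarrow> (nat \<Rightarrow> complex) \<Rightarrow> bool" where
  "interpolable C J l a \<longleftrightarrow>
     (\<exists>f. f holomorphic_on unit_disc \<and> (\<forall>z. norm z < 1 \<longrightarrow> norm (f z) \<le> C) \<and> (\<forall>j\<in>J. f (l j) = a j))"

definition separated :: "nat set \<Rightarrow> (nat \<Rightarrow> complex) \<Rightarrow> bool" where
  "separated J l \<longleftrightarrow> (\<exists>s>0. \<forall>j\<in>J. \<forall>k\<in>J. j \<noteq> k \<longrightarrow> s \<le> pseudohyperbolic (l j) (l k))"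

definition kernel_bounded :: "nat set \<Rightarrow> (nat \<Rightarrow> complex) \<Rightarrow> bool" where
  "kernel_bounded J l \<longleftrightarrow>
     (\<exists>K. \<forall>j\<in>J. \<forall>F. finite F \<longrightarrow> F \<subseteq> J \<longrightarrow> (\<Sum>k\<in>F. disc_kernel (l j) (l k)) \<le> K)"

text \<open>
  The interpolating functions of the finite sections form a normal family, and a limit of a
  subsequence interpolates all values.
\<close>

lemma interpolable_finite_sections:
  assumes l: "l ` J \<subseteq> unit_disc" and fin: "\<And>n. interpolable C (J \<inter> {..<n}) l a"
  shows "interpolable C J l a"
proof -
  define H where "H = {f. f holomorphic_on unit_disc \<and> (\<forall>z. norm z < 1 \<longrightarrow> norm (f z) \<le> C)}"
  have "\<exists>f. \<forall>n. f n \<in> H \<and> (\<forall>j\<in>J \<inter> {..<n}. f n (l j) = a j)"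
    using fin unfolding interpolable_def H_def by (intro choice) blast
  then obtain f where f: "\<And>n. f n \<in> H" "\<And>n j. j \<in> J \<Longrightarrow> j < n \<Longrightarrow> f n (l j) = a j"
    by fastforce
  obtain g r where g: "g holomorphic_on unit_disc" "strict_mono (r :: nat \<Rightarrow> nat)"
    "\<And>x. x \<in> unit_disc \<Longrightarrow> ((\<lambda>n. f (r n) x) \<longlongrightarrow> g x) sequentially"
  proof (rule Montel[of unit_disc H f])
    show "\<exists>B. \<forall>h\<in>H. \<forall>z\<in>K. norm (h z) \<le> B" if "compact K" "K \<subseteq> unit_disc" for K
      using that by (intro exI[of _ C]) (auto simp: H_def)
  qed (use f in \<open>auto simp: H_def\<close>)
  have "norm (g z) \<le> C" if "norm z < 1" for z
    using that f(1) by (intro Lim_norm_ubound[OF _ g(3)[of z]]) (auto simp: H_def)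
  moreover have "g (l j) = a j" if "j \<in> J" for j
  proof -
    have "eventually (\<lambda>n. f (r n) (l j) = a j) sequentially"
      using f(2)[OF that] seq_suble[OF g(2)]
      by (intro eventually_sequentiallyI[of "Suc j"]) (meson Suc_le_eq order_less_le_trans)
    then have "(\<lambda>n. f (r n) (l j)) \<longlonglongrightarrow> a j" by (rule tendsto_eventually)
    then show ?thesis using g(3)[of "l j"] l that LIMSEQ_unique by blast
  qed
  ultimately show ?thesis unfolding interpolable_def using g(1) by blast
qed

lemma H_infinity_bound:
  assumes "f \<in> H_infinity"
  obtains B where "\<And>z. norm z < 1 \<Longrightarrow> norm (f z) \<le> B"
proof -
  obtain B where "\<forall>x\<in>f ` unit_disc. norm x \<le> B"
    using assms unfolding H_infinity_def bounded_iff by blast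
  then show ?thesis using that[of B] by simp
qed

text \<open>
  Separation turns the additive bound on kernel sums into the multiplicative one required by
  the finite interpolation: from \<rho>^2 = 1-b \<ge> s^2 follows \<rho> \<ge>
  exp(-b/(2s^2)), so the product of the distances from one point to the others is at least
  exp(-K/(2s^2)).
\<close>

lemma carleson_sequence_sufficient:
  assumes l: "l ` J \<subseteq> unit_disc" and "separated J l" "kernel_bounded J l"
  shows "carleson_sequence J l"
proof -
  obtain s where s: "s > 0" "\<And>j k. j \<in> J \<Longrightarrow> k \<in> J \<Longrightarrow> j \<noteq> k \<Longrightarrow> s \<le> pseudohyperbolic (l j) (l k)"
    using assms by (auto simp: separated_def)
  obtain K where K: "\<And>j F. j \<in> J \<Longrightarrow> finite F \<Longrightarrow> F \<subseteq> J \<Longrightarrow> (\<Sum>k\<in>F. disc_kernel (l j) (l k)) \<le> K"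
    using assms unfolding kernel_bounded_def by metis
  have disc: "norm (l j) < 1" if "j \<in> J" for j using l that by auto
  define \<delta> where "\<delta> = exp (- K / (2 * s\<^sup>2))"
  have unit: "interpolable (exp (2 * K) / \<delta>) J l a" if a: "\<And>j. j \<in> J \<Longrightarrow> norm (a j) \<le> 1" for a
  proof (rule interpolable_finite_sections[OF l])
    fix n
    let ?G = "J \<inter> {..<n}"
    have low: "\<delta> \<le> (\<Prod>k\<in>?G - {j}. pseudohyperbolic (l k) (l j))" if j: "j \<in> ?G" for j
    proof -
      have "exp (- disc_kernel (l j) (l k) / (2 * s\<^sup>2)) \<le> pseudohyperbolic (l k) (l j)" if k: "k \<in> ?G - {j}" for k
      proof -
        let ?b = "disc_kernel (l j) (l k)" and ?p = "pseudohyperbolic (l k) (l j)"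
        have sp: "s \<le> ?p" using s(2)[of k j] j k by auto
        have p2: "?p\<^sup>2 = 1 - ?b"
          using pseudohyperbolic_sq[of "l k" "l j"] disc j k by (simp add: disc_kernel_commute)
        have b0: "0 \<le> ?b" using disc_kernel_nonneg disc j k by auto
        have s2: "s\<^sup>2 \<le> ?p\<^sup>2" using sp s(1) by (intro power_mono) auto
        have pp: "0 < ?p\<^sup>2" using sp s(1) by (intro zero_less_power) linarith
        have "1 / ?p\<^sup>2 = 1 + ?b / ?p\<^sup>2" using p2 pp by (simp add: field_simps)
        also have "\<dots> \<le> 1 + ?b / s\<^sup>2" using s2 b0 s(1) by (intro add_left_mono divide_left_mono mult_pos_pos pp) auto
        also have "\<dots> \<le> exp (?b / s\<^sup>2)" by (rule exp_ge_add_one_self)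
        finally have "exp (- ?b / s\<^sup>2) \<le> ?p\<^sup>2" using pp by (simp add: exp_minus field_simps)
        moreover have "exp (- ?b / s\<^sup>2) = (exp (- ?b / (2 * s\<^sup>2)))\<^sup>2"
          by (simp add: power2_eq_square exp_add [symmetric] field_simps)
        ultimately show ?thesis
          by (metis pseudohyperbolic_nonneg power2_le_imp_le)
      qed
      then have "(\<Prod>k\<in>?G - {j}. exp (- disc_kernel (l j) (l k) / (2 * s\<^sup>2))) \<le> (\<Prod>k\<in>?G - {j}. pseudohyperbolic (l k) (l j))"
        by (intro prod_mono) auto
      moreover have "(\<Prod>k\<in>?G - {j}. exp (- disc_kernel (l j) (l k) / (2 * s\<^sup>2)))
          = exp (- (\<Sum>k\<in>?G - {j}. disc_kernel (l j) (l k)) / (2 * s\<^sup>2))"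
        by (subst exp_sum[symmetric]) (simp_all add: sum_divide_distrib sum_negf)
      moreover have "\<delta> \<le> exp (- (\<Sum>k\<in>?G - {j}. disc_kernel (l j) (l k)) / (2 * s\<^sup>2))"
      proof -
        have "(\<Sum>k\<in>?G - {j}. disc_kernel (l j) (l k)) \<le> K" by (rule K) (use j in auto)
        then show ?thesis by (simp add: \<delta>_def divide_right_mono)
      qed
      ultimately show ?thesis by linarith
    qed
    show "interpolable (exp (2 * K) / \<delta>) ?G l a"
    proof (rule finite_interpolation_Jones[of ?G l \<delta> K a])
      show "(\<Sum>k\<in>?G. disc_kernel (l k) (l j)) \<le> K" if "j \<in> ?G" for j
        using K[of j ?G] that by (simp add: disc_kernel_commute)
    qed (use low disc a in \<open>auto simp: \<delta>_def interpolable_def\<close>)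
  qed
  show ?thesis unfolding carleson_sequence_def
  proof (intro conjI allI impI l)
    fix a :: "nat \<Rightarrow> complex" assume "bounded (a ` J)"
    then obtain B where B: "B > 0" "\<And>j. j \<in> J \<Longrightarrow> norm (a j) \<le> B"
      by (auto simp: bounded_pos)
    have "interpolable (exp (2 * K) / \<delta>) J l (\<lambda>j. a j / B)"
      by (rule unit) (use B in \<open>simp add: norm_divide\<close>)
    then obtain f where f: "f holomorphic_on unit_disc" "\<And>z. norm z < 1 \<Longrightarrow> norm (f z) \<le> exp (2 * K) / \<delta>"
      "\<And>j. j \<in> J \<Longrightarrow> f (l j) = a j / B" by (auto simp: interpolable_def)
    have "(\<lambda>z. of_real B * f z) \<in> H_infinity"
      unfolding H_infinity_def bounded_iff using f(1) B(1)
      by (auto intro!: holomorphic_intros exI[of _ "B * (exp (2 * K) / \<delta>)"] mult_left_mono f(2) simp: norm_mult)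
    moreover have "\<forall>j\<in>J. a j = of_real B * f (l j)" using f(3) B by simp
    ultimately show "\<exists>f\<in>H_infinity. \<forall>j\<in>J. a j = f (l j)" by (intro bexI[of _ "\<lambda>z. of_real B * f z"])
  qed
qed

lemma interpolable_mono:
  assumes "interpolable C J l a" "C \<le> D" "I \<subseteq> J" "\<And>j. j \<in> I \<Longrightarrow> a j = b j"
  shows "interpolable D I l b"
proof -
  obtain f where "f holomorphic_on unit_disc" "\<forall>z. norm z < 1 \<longrightarrow> norm (f z) \<le> C" "\<forall>j\<in>J. f (l j) = a j"
    using assms(1) by (auto simp: interpolable_def)
  then show ?thesis unfolding interpolable_def using assms(2-) by (intro exI[of _ f]) fastforce
qed

lemma carleson_sequence_interpolable:
  assumes "carleson_sequence J l" "bounded (a ` J)"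
  obtains C where "interpolable C J l a"
proof -
  obtain f where f: "f \<in> H_infinity" "\<forall>j\<in>J. a j = f (l j)"
    using assms by (auto simp: carleson_sequence_def)
  obtain B where "\<And>z. norm z < 1 \<Longrightarrow> norm (f z) \<le> B" using H_infinity_bound[OF f(1)] by blast
  then have "interpolable B J l a" using f by (auto simp: interpolable_def H_infinity_def)
  then show ?thesis using that by blast
qed

text \<open>
  A gliding hump. If no cylinder of data bounded by 1 admits a uniform constant, finite
  pieces of data that are not interpolable with ever larger constants can be chosen, each
  extending the previous one; the data which they build up are not interpolable at all.
\<close>

lemma carleson_sequence_uniform_on_cylinder:
  assumes cs: "carleson_sequence J l"
  obtains N :: nat and b :: "nat \<Rightarrow> complex" and M :: real where "\<And>j. norm (b j) \<le> 1"
    "\<And>a. (\<And>j. norm (a j) \<le> 1) \<Longrightarrow> (\<And>j. j < N \<Longrightarrow> a j = b j) \<Longrightarrow> interpolable M J l a"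
proof (rule ccontr)
  assume "\<not> thesis"
  with that have neg: "\<exists>a. (\<forall>j. norm (a j) \<le> 1) \<and> (\<forall>j<N. a j = b j) \<and> \<not> interpolable M J l a"
    if "\<forall>j. norm (b j) \<le> 1" for N b M using that by metis
  have l: "l ` J \<subseteq> unit_disc" using cs by (simp add: carleson_sequence_def)
  \<comment> \<open>A state consists of a length and of data of which only the terms below that length are
    kept later on.\<close>
  define Q where "Q n p q \<longleftrightarrow> fst p < fst q \<and> (\<forall>j<fst p. snd q j = snd p j)
      \<and> \<not> interpolable (real n) (J \<inter> {..<fst q}) l (snd q)"
    for n and p q :: "nat \<times> (nat \<Rightarrow> complex)"
  have step: "\<exists>q. (\<forall>j. norm (snd q j) \<le> 1) \<and> Q n p q" if p: "\<forall>j. norm (snd p j) \<le> 1" for n p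
  proof -
    obtain a where a: "\<forall>j. norm (a j) \<le> 1" "\<forall>j<fst p. a j = snd p j" "\<not> interpolable (real n) J l a"
      using neg[OF p, of "fst p" "real n"] by blast
    then obtain m where m: "\<not> interpolable (real n) (J \<inter> {..<m}) l a"
      using interpolable_finite_sections[OF l] by blast
    have "J \<inter> {..<m} \<subseteq> J \<inter> {..<max m (Suc (fst p))}" by auto
    then have "\<not> interpolable (real n) (J \<inter> {..<max m (Suc (fst p))}) l a"
      using interpolable_mono[OF _ order_refl, of "real n" _ l a _ a] m by blast
    then show ?thesis using a unfolding Q_def by (intro exI[of _ "(max m (Suc (fst p)), a)"]) auto
  qed
  have "\<exists>p. \<forall>n. (\<forall>j. norm (snd (p n) j) \<le> 1) \<and> Q n (p n) (p (Suc n))"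
  proof (rule dependent_nat_choice)
    show "\<exists>x. \<forall>j. norm (snd (x :: nat \<times> (nat \<Rightarrow> complex)) j) \<le> 1" by (rule exI[of _ "(0, \<lambda>_. 0)"]) simp
  qed (use step in blast)
  then obtain p where p: "\<And>n j. norm (snd (p n) j) \<le> 1" "\<And>n. Q n (p n) (p (Suc n))" by auto
  have mono: "fst (p n) < fst (p (Suc n))" for n using p(2)[of n] by (simp add: Q_def)
  then have "strict_mono (\<lambda>n. fst (p n))" by (simp add: strict_mono_Suc_iff)
  then have ge: "n \<le> fst (p n)" for n by (rule strict_mono_imp_increasing)
  have agree: "snd (p m) j = snd (p n) j" if "n \<le> m" "j < fst (p n)" for n m j
    using that
  proof (induction m rule: dec_induct)
    case (step m)
    have "fst (p n) \<le> fst (p m)"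
      using \<open>strict_mono (\<lambda>n. fst (p n))\<close> step.hyps(1) strict_mono_less_eq[of "\<lambda>n. fst (p n)" n m] by simp
    then have "snd (p (Suc m)) j = snd (p m) j" using p(2)[of m] step.prems by (simp add: Q_def)
    then show ?case using step by simp
  qed simp
  define a where "a j = snd (p (Suc j)) j" for j
  have a: "a j = snd (p n) j" if "j < fst (p n)" for n j
  proof (cases "n \<le> Suc j")
    case True then show ?thesis using agree[OF True that] by (simp add: a_def)
  next
    case False then show ?thesis
      using agree[of "Suc j" n j] ge[of "Suc j"] by (simp add: a_def)
  qed
  have "bounded (a ` J)" unfolding bounded_iff using p(1) by (auto simp: a_def)
  then obtain C where C: "interpolable C J l a" using carleson_sequence_interpolable[OF cs] by blast
  obtain n where n: "C \<le> real n" using real_arch_simple by blast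
  have "interpolable (real n) (J \<inter> {..<fst (p (Suc n))}) l (snd (p (Suc n)))"
    by (rule interpolable_mono[OF C n]) (use a in auto)
  then show False using p(2)[of n] by (simp add: Q_def)
qed

text \<open>
  Data prescribed on the cylinder are subtracted, which leaves data that vanish below N; the
  finitely many remaining values are corrected by functions that interpolate unit vectors.
\<close>

lemma carleson_sequence_uniform_constant:
  assumes cs: "carleson_sequence J l"
  obtains M where "\<And>a. (\<And>j. norm (a j) \<le> 1) \<Longrightarrow> interpolable M J l a"
proof -
  obtain N :: nat and b :: "nat \<Rightarrow> complex" and M :: real where b: "\<And>j. norm (b j) \<le> 1"
    and M: "\<And>a. (\<And>j. norm (a j) \<le> 1) \<Longrightarrow> (\<And>j. j < N \<Longrightarrow> a j = b j) \<Longrightarrow> interpolable M J l a"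
    by (rule carleson_sequence_uniform_on_cylinder[OF cs]) blast
  have "bounded ((\<lambda>k. if k = i then 1 else 0 :: complex) ` J)" for i
    by (auto simp: bounded_iff intro!: exI[of _ 1])
  then have "\<exists>C. interpolable C J l (\<lambda>k. if k = i then 1 else 0)" for i
    using carleson_sequence_interpolable[OF cs] by metis
  then obtain C where "\<And>i. interpolable (C i) J l (\<lambda>k. if k = i then 1 else 0)" by metis
  then have "\<exists>e. \<forall>i. e i holomorphic_on unit_disc \<and> (\<forall>z. norm z < 1 \<longrightarrow> norm (e i z) \<le> C i)
      \<and> (\<forall>j\<in>J. e i (l j) = (if j = i then 1 else 0))"
    unfolding interpolable_def by (intro choice) auto
  then obtain e where e: "\<And>i. e i holomorphic_on unit_disc" "\<And>i z. norm z < 1 \<Longrightarrow> norm (e i z) \<le> C i"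
    "\<And>i j. j \<in> J \<Longrightarrow> e i (l j) = (if j = i then 1 else 0)" by auto
  show ?thesis
  proof (rule that)
    fix a :: "nat \<Rightarrow> complex" assume a: "\<And>j. norm (a j) \<le> 1"
    have "interpolable M J l (\<lambda>j. if j < N then b j else a j)" by (rule M) (use a b in auto)
    then obtain f where f: "f holomorphic_on unit_disc" "\<And>z. norm z < 1 \<Longrightarrow> norm (f z) \<le> M"
      "\<And>j. j \<in> J \<Longrightarrow> f (l j) = (if j < N then b j else a j)" by (auto simp: interpolable_def)
    have "interpolable M J l (\<lambda>j. if j < N then b j else 0)" by (rule M) (use b in auto)
    then obtain g where g: "g holomorphic_on unit_disc" "\<And>z. norm z < 1 \<Longrightarrow> norm (g z) \<le> M"
      "\<And>j. j \<in> J \<Longrightarrow> g (l j) = (if j < N then b j else 0)" by (auto simp: interpolable_def)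
    define h where "h z = f z - g z + (\<Sum>i<N. a i * e i z)" for z
    have "h holomorphic_on unit_disc" unfolding h_def
      by (intro holomorphic_intros f g e)
    moreover have "norm (h z) \<le> 2 * M + (\<Sum>i<N. C i)" if z: "norm z < 1" for z
    proof -
      have "norm (\<Sum>i<N. a i * e i z) \<le> (\<Sum>i<N. C i)"
      proof (rule sum_norm_le)
        fix i
        have "norm (a i * e i z) \<le> norm (e i z)" using a[of i] by (simp add: norm_mult mult_left_le_one_le)
        then show "norm (a i * e i z) \<le> C i" using e(2)[OF z, of i] by linarith
      qed
      moreover have "norm (h z) \<le> norm (f z) + norm (g z) + norm (\<Sum>i<N. a i * e i z)"
        unfolding h_def by (meson norm_triangle_mono norm_triangle_ineq4 order_refl)
      ultimately show ?thesis using f(2)[OF z] g(2)[OF z] by linarith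
    qed
    moreover have "h (l j) = a j" if j: "j \<in> J" for j
    proof -
      have "(\<Sum>i<N. a i * e i (l j)) = (\<Sum>i<N. if i = j then a j else 0)"
        by (rule sum.cong) (use e(3)[OF j] in auto)
      also have "\<dots> = (if j < N then a j else 0)" by simp
      finally show ?thesis unfolding h_def using f(3)[OF j] g(3)[OF j] by auto
    qed
    ultimately show "interpolable (2 * M + (\<Sum>i<N. C i)) J l a" unfolding interpolable_def by blast
  qed
qed

text \<open>
  Transport the zero to the origin by a Moebius map; there the Schwarz lemma bounds the
  quotient by z. The lemma needs a strict bound, hence the \<epsilon> of room.
\<close>

lemma Blaschke_factor:
  assumes f: "f holomorphic_on unit_disc" "\<And>z. norm z < 1 \<Longrightarrow> norm (f z) \<le> M"
    and a: "norm a < 1" "f a = 0"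
  obtains g where "g holomorphic_on unit_disc" "\<And>z. norm z < 1 \<Longrightarrow> norm (g z) \<le> M"
    "\<And>z. norm z < 1 \<Longrightarrow> f z = Moebius_function 0 a z * g z"
proof -
  let ?m = "Moebius_function 0 a" and ?i = "Moebius_function 0 (- a)"
  have hm: "?m holomorphic_on unit_disc" "?i holomorphic_on unit_disc"
    using a by (auto intro: Moebius_function_holomorphic)
  have mm: "norm (?m z) < 1" "norm (?i z) < 1" if "norm z < 1" for z
    using a that by (auto intro: Moebius_function_norm_lt_1)
  have im: "?i (?m z) = z" if "norm z < 1" for z
    using a that by (intro Moebius_function_compose) auto
  define F where "F = f \<circ> ?i"
  have F: "F holomorphic_on unit_disc" unfolding F_def
    by (rule holomorphic_on_compose_gen[OF hm(2) f(1)]) (use mm in auto)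
  have F0: "F 0 = 0" using a by (simp add: F_def Moebius_function_of_zero)
  have M0: "0 \<le> M" using f(2)[OF a(1)] a(2) by simp
  obtain h where h: "h holomorphic_on unit_disc" "\<And>z. norm z < 1 \<Longrightarrow> F z = z * h z" "deriv F 0 = h 0"
    by (rule Schwarz3[OF F F0]) blast
  have hb: "norm (h z) \<le> M" if z: "norm z < 1" for z
  proof (rule field_le_epsilon)
    fix e :: real assume "e > 0"
    define G where "G w = F w / of_real (M + e)" for w
    have "M + e > 0" using M0 \<open>e > 0\<close> by simp
    then have ne: "complex_of_real (M + e) \<noteq> 0" by (metis of_real_eq_0_iff less_irrefl)
    have nMe: "norm (complex_of_real (M + e)) = M + e" using \<open>M + e > 0\<close> by (metis abs_of_pos norm_of_real)
    have G: "G holomorphic_on ball 0 1" unfolding G_def using F ne by (intro holomorphic_intros) auto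
    have "norm (G w) < 1" if "norm w < 1" for w
    proof -
      have "norm (F w) \<le> M" using f(2)[OF mm(2)[OF that]] by (simp add: F_def)
      then show ?thesis unfolding G_def norm_divide nMe using \<open>M + e > 0\<close> \<open>e > 0\<close> by (simp add: divide_less_eq)
    qed
    note S = Schwarz_Lemma[OF G _ this z]
    have G0: "G 0 = 0" by (simp add: G_def F0)
    show "norm (h z) \<le> M + e"
    proof (cases "z = 0")
      case False
      have "norm (G z) \<le> norm z" using S(1) G0 by blast
      then have "norm z * norm (h z) / (M + e) \<le> norm z"
        unfolding G_def norm_divide nMe h(2)[OF z] norm_mult .
      then have "norm z * norm (h z) \<le> norm z * (M + e)" using \<open>M + e > 0\<close> by (simp add: divide_le_eq)
      then show ?thesis using False by (simp del: distrib_left)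
    next
      case True
      have "norm (deriv G 0) \<le> 1" using S(2) G0 by blast
      moreover have "deriv G 0 = deriv F 0 / of_real (M + e)"
      proof (rule DERIV_imp_deriv)
        have "(F has_field_derivative deriv F 0) (at 0)"
          using holomorphic_on_imp_differentiable_at[OF F, of 0] by (simp add: DERIV_deriv_iff_field_differentiable)
        then show "(G has_field_derivative deriv F 0 / of_real (M + e)) (at 0)"
          unfolding G_def by (rule DERIV_cdivide)
      qed
      ultimately show ?thesis using True h(3) \<open>M + e > 0\<close> by (simp add: norm_divide nMe divide_le_eq del: of_real_add)
    qed
  qed
  show ?thesis
  proof (rule that[of "h \<circ> ?m"])
    show "h \<circ> ?m holomorphic_on unit_disc"
      by (rule holomorphic_on_compose_gen[OF hm(1) h(1)]) (use mm in auto)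
    show "norm ((h \<circ> ?m) z) \<le> M" if "norm z < 1" for z using hb[OF mm(1)[OF that]] by simp
    show "f z = ?m z * (h \<circ> ?m) z" if "norm z < 1" for z
      using h(2)[OF mm(1)[OF that]] im[OF that] by (simp add: F_def)
  qed
qed

lemma norm_le_Blaschke_product:
  assumes "finite G" "inj_on l G" "\<And>k. k \<in> G \<Longrightarrow> norm (l k) < 1"
    and "f holomorphic_on unit_disc" "\<And>z. norm z < 1 \<Longrightarrow> norm (f z) \<le> M"
    and "\<And>k. k \<in> G \<Longrightarrow> f (l k) = 0" and "norm z < 1"
  shows "norm (f z) \<le> M * (\<Prod>k\<in>G. pseudohyperbolic (l k) z)"
  using assms
proof (induction G arbitrary: f rule: finite_induct)
  case (insert i G)
  have li: "norm (l i) < 1" using insert by simp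
  obtain g where g: "g holomorphic_on unit_disc" "\<And>z. norm z < 1 \<Longrightarrow> norm (g z) \<le> M"
    "\<And>z. norm z < 1 \<Longrightarrow> f z = Moebius_function 0 (l i) z * g z"
    using Blaschke_factor[OF insert.prems(3,4) li] insert.prems(5) by blast
  have "g (l k) = 0" if "k \<in> G" for k
  proof -
    have "Moebius_function 0 (l i) (l k) \<noteq> 0"
      using one_minus_cnj_mult_nonzero[of "l i" "l k"] li insert that
      by (auto simp: Moebius_function_simple inj_on_def)
    then show ?thesis using g(3)[of "l k"] insert that by auto
  qed
  then have "norm (g z) \<le> M * (\<Prod>k\<in>G. pseudohyperbolic (l k) z)"
    using insert.prems by (intro insert.IH) (auto simp: g inj_on_def)
  then have "pseudohyperbolic (l i) z * norm (g z) \<le> pseudohyperbolic (l i) z * (M * (\<Prod>k\<in>G. pseudohyperbolic (l k) z))"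
    by (intro mult_left_mono pseudohyperbolic_nonneg)
  then show ?case using insert g(3)[of z] by (simp add: norm_mult norm_Moebius mult.left_commute)
qed simp

lemma carleson_sequence_inj_on:
  assumes "carleson_sequence J l" shows "inj_on l J"
proof (rule inj_onI, rule ccontr)
  fix i j assume ij: "i \<in> J" "j \<in> J" "l i = l j" "i \<noteq> j"
  have "bounded ((\<lambda>k. if k = i then 1 else 0 :: complex) ` J)"
    by (auto simp: bounded_iff intro!: exI[of _ 1])
  then obtain f :: "complex \<Rightarrow> complex" where "\<forall>k\<in>J. (if k = i then 1 else 0) = f (l k)"
    using assms unfolding carleson_sequence_def by blast
  with ij show False by (metis one_neq_zero)
qed

text \<open>
  A function of norm at most M that is 1 at one point and 0 at finitely many others is
  dominated by M times the Blaschke product of those others. So the product of the distances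
  is at least 1/M; one factor gives separation, and 1-b \<le> exp(-b) turns the product into
  a sum of kernels.
\<close>

lemma carleson_sequence_necessary:
  assumes cs: "carleson_sequence J l"
  shows "separated J l" "kernel_bounded J l"
proof -
  obtain M where M: "\<And>a. (\<And>j. norm (a j) \<le> 1) \<Longrightarrow> interpolable M J l a"
    by (rule carleson_sequence_uniform_constant[OF cs]) blast
  have disc: "norm (l j) < 1" if "j \<in> J" for j using cs that by (auto simp: carleson_sequence_def)
  note inj = carleson_sequence_inj_on[OF cs]
  have prod: "1 \<le> M * (\<Prod>k\<in>F - {j}. pseudohyperbolic (l k) (l j))" if "j \<in> J" "finite F" "F \<subseteq> J" for j F
  proof -
    have "interpolable M J l (\<lambda>k. if k = j then 1 else 0)" by (rule M) auto
    then obtain f where f: "f holomorphic_on unit_disc" "\<And>z. norm z < 1 \<Longrightarrow> norm (f z) \<le> M"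
      "\<And>k. k \<in> J \<Longrightarrow> f (l k) = (if k = j then 1 else 0)"
      by (auto simp: interpolable_def)
    have "norm (f (l j)) \<le> M * (\<Prod>k\<in>F - {j}. pseudohyperbolic (l k) (l j))"
      by (rule norm_le_Blaschke_product) (use that disc f inj in \<open>auto intro: inj_on_subset\<close>)
    then show ?thesis using f(3)[OF that(1)] by simp
  qed
  show "separated J l"
  proof (cases "J = {}")
    case False
    then obtain j where "j \<in> J" by auto
    then have "M \<ge> 1" using prod[of j "{}"] by simp
    have "1 / M \<le> pseudohyperbolic (l j) (l k)" if "j \<in> J" "k \<in> J" "j \<noteq> k" for j k
      using prod[of k "{j}"] that \<open>M \<ge> 1\<close> by (simp add: field_simps)
    then show ?thesis unfolding separated_def using \<open>M \<ge> 1\<close> by (intro exI[of _ "1 / M"]) auto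
  qed (auto simp: separated_def intro: exI[of _ 1])
  show "kernel_bounded J l" unfolding kernel_bounded_def
  proof (intro exI[of _ "M\<^sup>2 + 1"] ballI allI impI)
    fix j F assume j: "j \<in> J" and F: "finite F" "F \<subseteq> J"
    let ?P = "\<Prod>k\<in>F - {j}. pseudohyperbolic (l k) (l j)" and ?S = "\<Sum>k\<in>F - {j}. disc_kernel (l j) (l k)"
    have "1 \<le> (M * ?P)\<^sup>2" using prod[OF j F] by (simp add: one_le_power)
    also have "\<dots> = M\<^sup>2 * (\<Prod>k\<in>F - {j}. (pseudohyperbolic (l k) (l j))\<^sup>2)"
      by (simp add: power_mult_distrib prod_power_distrib)
    also have "(\<Prod>k\<in>F - {j}. (pseudohyperbolic (l k) (l j))\<^sup>2) \<le> (\<Prod>k\<in>F - {j}. exp (- disc_kernel (l j) (l k)))"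
    proof (rule prod_mono, safe)
      fix k assume "k \<in> F"
      then have "(pseudohyperbolic (l k) (l j))\<^sup>2 = 1 - disc_kernel (l j) (l k)"
        using pseudohyperbolic_sq[of "l k" "l j"] disc j F by (auto simp: disc_kernel_commute)
      then show "(pseudohyperbolic (l k) (l j))\<^sup>2 \<le> exp (- disc_kernel (l j) (l k))"
        using exp_ge_add_one_self[of "- disc_kernel (l j) (l k)"] by simp
    qed simp
    also have "\<dots> = exp (- ?S)" using F by (simp add: exp_sum[symmetric] sum_negf)
    finally have "1 \<le> M\<^sup>2 * exp (- ?S)" by (simp add: mult_left_mono)
    then have "exp ?S \<le> M\<^sup>2" by (simp add: exp_minus field_simps)
    then have "?S \<le> M\<^sup>2" using exp_ge_add_one_self[of ?S] by linarith
    moreover have "(\<Sum>k\<in>F. disc_kernel (l j) (l k)) \<le> ?S + 1"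
    proof (cases "j \<in> F")
      case True then show ?thesis using F disc[OF j] by (simp add: sum.remove[of F j] disc_kernel_self)
    qed auto
    ultimately show "(\<Sum>k\<in>F. disc_kernel (l j) (l k)) \<le> M\<^sup>2 + 1" by linarith
  qed
qed

section \<open>Lacunary sequences\<close>

lemma disc_kernel_le_ratio:
  assumes "norm z < 1" "norm w < 1"
  shows "disc_kernel z w \<le> 4 * (1 - norm w) / (1 - norm z)"
proof -
  have "disc_kernel z w \<le> (2 * (1 - norm z)) * (2 * (1 - norm w)) / (1 - norm z)\<^sup>2"
    unfolding disc_kernel_def
  proof (intro frac_le mult_mono defect_bounds defect_nonneg power_mono assms)
    show "1 - norm z \<le> norm (1 - cnj z * w)"
      using norm_one_minus_cnj_mult_ge[of w z] assms by (simp add: norm_one_minus_cnj_mult_commute[of z w])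
  qed (use assms in auto)
  also have "\<dots> = 4 * (1 - norm w) / (1 - norm z)"
  proof -
    have "(2 * x) * (2 * y) / x\<^sup>2 = 4 * y / x" if "x \<noteq> 0" for x y :: real
      using that by (simp add: power2_eq_square)
    then show ?thesis using assms by (metis diff_gt_0_iff_gt less_irrefl)
  qed
  finally show ?thesis .
qed

lemma pseudohyperbolic_ge_half_of_height_ratio:
  assumes "norm z < 1" "norm w < 1" "16 * (1 - norm w) \<le> 1 - norm z"
  shows "1/2 \<le> pseudohyperbolic z w"
proof -
  have "disc_kernel z w \<le> 4 * (1 - norm w) / (1 - norm z)" by (rule disc_kernel_le_ratio) fact+
  also have "\<dots> \<le> 1/4" using assms by (simp add: divide_le_eq)
  finally have "(1/2)\<^sup>2 \<le> (pseudohyperbolic z w)\<^sup>2"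
    using pseudohyperbolic_sq[OF assms(1,2)] by (simp add: power2_eq_square)
  then show ?thesis by (rule power2_le_imp_le[OF _ pseudohyperbolic_nonneg])
qed

lemma sum_half_powers_le: "finite A \<Longrightarrow> (\<Sum>n\<in>A. (1/2::real) ^ n) \<le> 2"
proof -
  assume "finite A"
  then have "(\<Sum>n\<in>A. (1/2::real) ^ n) \<le> (\<Sum>n. (1/2) ^ n)" by (intro sum_le_suminf summable_geometric) auto
  also have "\<dots> = 2" by (subst suminf_geometric) auto
  finally show ?thesis .
qed

text \<open>
  Used with \<open>u\<close> the distance of levels, of which each value is attained at most
  \<open>m\<close> times.
\<close>

lemma sum_geometric_fibres_le:
  fixes u :: "'a \<Rightarrow> nat" and c :: real
  assumes "finite F" "\<And>n. card {k\<in>F. u k = n} \<le> m" "0 \<le> c" "c < 1"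
  shows "(\<Sum>k\<in>F. c ^ u k) \<le> m / (1 - c)"
proof -
  have "(\<Sum>k\<in>F. c ^ u k) = (\<Sum>n\<in>u ` F. \<Sum>k\<in>{k\<in>F. u k = n}. c ^ u k)"
    by (rule sum.image_gen[OF assms(1)])
  also have "\<dots> = (\<Sum>n\<in>u ` F. card {k\<in>F. u k = n} * c ^ n)"
    by (intro sum.cong refl) simp
  also have "\<dots> \<le> (\<Sum>n\<in>u ` F. m * c ^ n)"
    using assms by (intro sum_mono mult_right_mono) auto
  also have "\<dots> = m * (\<Sum>n\<in>u ` F. c ^ n)" by (simp add: sum_distrib_left)
  also have "(\<Sum>n\<in>u ` F. c ^ n) \<le> (\<Sum>n. c ^ n)"
    by (intro sum_le_suminf) (use assms in \<open>auto intro: summable_geometric\<close>)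
  also have "\<dots> = 1 / (1 - c)" using assms by (intro suminf_geometric) auto
  finally show ?thesis by (simp add: mult_left_mono)
qed

text \<open>
  Points are grouped into levels of at most two points, and the distance to the circle drops
  by the factor 16 from one level to the next. The kernel of two points is then at most
  4/16^d for levels at distance d, which is summable and keeps points of different levels
  apart.
\<close>

lemma lacunary_carleson_sequence:
  fixes v :: "nat \<Rightarrow> nat"
  assumes disc: "\<And>j. norm (l j) < 1"
    and lac: "\<And>j k. v j < v k \<Longrightarrow> 1 - norm (l k) \<le> (1 - norm (l j)) * (1/16) ^ (v k - v j)"
    and same: "\<And>j k. j \<noteq> k \<Longrightarrow> v j = v k \<Longrightarrow> s \<le> pseudohyperbolic (l j) (l k)" and "0 < s"
    and fibres: "\<And>n F. finite F \<Longrightarrow> card {k\<in>F. v k = n} \<le> 2"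
  shows "carleson_sequence UNIV l"
proof (rule carleson_sequence_sufficient)
  have b: "disc_kernel (l j) (l k) \<le> 4 * (1/16) ^ (v k - v j)" if "v j < v k" for j k
  proof -
    have "disc_kernel (l j) (l k) \<le> 4 * (1 - norm (l k)) / (1 - norm (l j))"
      by (intro disc_kernel_le_ratio disc)
    also have "\<dots> \<le> 4 * (1/16) ^ (v k - v j)"
      using lac[OF that] disc[of j] by (simp add: divide_le_eq mult.commute)
    finally show ?thesis .
  qed
  show "separated UNIV l" unfolding separated_def
  proof (intro exI[of _ "min s (1/2)"] conjI ballI impI)
    have half: "1/2 \<le> pseudohyperbolic (l j) (l k)" if "v j < v k" for j k
    proof -
      have "(1/16::real) ^ (v k - v j) \<le> (1/16) ^ 1" using that by (intro power_decreasing) auto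
      then have "(1 - norm (l j)) * (1/16) ^ (v k - v j) \<le> (1 - norm (l j)) * (1/16)"
        using disc[of j] by (intro mult_left_mono) auto
      then show ?thesis using lac[OF that] by (intro pseudohyperbolic_ge_half_of_height_ratio disc) simp
    qed
    fix j k :: nat assume "j \<noteq> k"
    then show "min s (1/2) \<le> pseudohyperbolic (l j) (l k)"
      using same[of j k] half[of j k] half[of k j] pseudohyperbolic_commute[of "l j" "l k"]
      by (cases "v j" "v k" rule: linorder_cases) auto
  qed (use \<open>0 < s\<close> in auto)
  show "kernel_bounded UNIV l" unfolding kernel_bounded_def
  proof (intro exI[of _ 18] ballI allI impI)
    fix j :: nat and F :: "nat set" assume F: "finite F"
    let ?A = "{k\<in>F. v k \<le> v j}" and ?B = "{k\<in>F. v j < v k}"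
    have "disc_kernel (l j) (l k) \<le> 4 * (1/16) ^ (v j - v k)" if "v k \<le> v j" for k
    proof (cases "v k = v j")
      case True then show ?thesis using disc_kernel_le_one[OF disc disc, of j k] by simp
    next
      case False then show ?thesis using b[of k j] that by (simp add: disc_kernel_commute)
    qed
    then have "(\<Sum>k\<in>?A. disc_kernel (l j) (l k)) \<le> (\<Sum>k\<in>?A. 4 * (1/16) ^ (v j - v k))"
      by (intro sum_mono) auto
    also have "\<dots> = 4 * (\<Sum>k\<in>?A. (1/16) ^ (v j - v k))" by (simp add: sum_distrib_left)
    also have "(\<Sum>k\<in>?A. (1/16::real) ^ (v j - v k)) \<le> real 2 / (1 - 1/16)"
    proof (rule sum_geometric_fibres_le)
      show "card {k\<in>?A. v j - v k = n} \<le> 2" for n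
      proof -
        have "{k\<in>?A. v j - v k = n} \<subseteq> {k\<in>F. v k = v j - n}" by auto
        then have "card {k\<in>?A. v j - v k = n} \<le> card {k\<in>F. v k = v j - n}"
          by (intro card_mono) (use F in auto)
        then show ?thesis using fibres[OF F, of "v j - n"] by linarith
      qed
    qed (use F in auto)
    finally have A: "(\<Sum>k\<in>?A. disc_kernel (l j) (l k)) \<le> 9" by simp
    have "(\<Sum>k\<in>?B. disc_kernel (l j) (l k)) \<le> (\<Sum>k\<in>?B. 4 * (1/16) ^ (v k - v j))"
      by (intro sum_mono b) auto
    also have "\<dots> = 4 * (\<Sum>k\<in>?B. (1/16) ^ (v k - v j))" by (simp add: sum_distrib_left)
    also have "(\<Sum>k\<in>?B. (1/16::real) ^ (v k - v j)) \<le> real 2 / (1 - 1/16)"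
    proof (rule sum_geometric_fibres_le)
      show "card {k\<in>?B. v k - v j = n} \<le> 2" for n
      proof -
        have "{k\<in>?B. v k - v j = n} \<subseteq> {k\<in>F. v k = v j + n}" by auto
        then have "card {k\<in>?B. v k - v j = n} \<le> card {k\<in>F. v k = v j + n}"
          by (intro card_mono) (use F in auto)
        then show ?thesis using fibres[OF F, of "v j + n"] by linarith
      qed
    qed (use F in auto)
    finally have B: "(\<Sum>k\<in>?B. disc_kernel (l j) (l k)) \<le> 9" by simp
    have "F = ?A \<union> ?B" "?A \<inter> ?B = {}" by auto
    then have "(\<Sum>k\<in>F. disc_kernel (l j) (l k)) = (\<Sum>k\<in>?A. disc_kernel (l j) (l k)) + (\<Sum>k\<in>?B. disc_kernel (l j) (l k))"
      using F by (metis (no_types, lifting) finite_Un sum.union_disjoint)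
    then show "(\<Sum>k\<in>F. disc_kernel (l j) (l k)) \<le> 18" using A B by linarith
  qed
qed (use disc in auto)

lemma lacunary_decay:
  fixes x y :: "nat \<Rightarrow> real"
  assumes "\<And>n. x (Suc n) \<le> y n / 16" "\<And>n. y n \<le> x n" "m < n"
  shows "x n \<le> y m * (1/16) ^ (n - m)"
proof -
  have "x (m + Suc d) \<le> y m * (1/16) ^ Suc d" for d
  proof (induction d)
    case (Suc d)
    have "x (m + Suc (Suc d)) \<le> y (m + Suc d) / 16" using assms(1)[of "m + Suc d"] by simp
    also have "\<dots> \<le> x (m + Suc d) / 16" using assms(2) by (simp add: divide_right_mono)
    also have "\<dots> \<le> y m * (1/16) ^ Suc d / 16" using Suc by (simp add: divide_right_mono)
    finally show ?case by simp
  qed (use assms(1)[of m] in simp)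
  moreover have "n = m + Suc (n - m - 1)" "n - m = Suc (n - m - 1)" using \<open>m < n\<close> by auto
  ultimately show ?thesis by metis
qed

lemma lacunary_pairs_carleson_sequence:
  assumes disc: "\<And>n. norm (z n) < 1" "\<And>n. norm (w n) < 1"
    and sep: "\<And>n. s \<le> pseudohyperbolic (z n) (w n)" "0 < s"
    and lac: "\<And>n. max (1 - norm (z (Suc n))) (1 - norm (w (Suc n))) \<le> min (1 - norm (z n)) (1 - norm (w n)) / 16"
  shows "carleson_sequence UNIV (\<lambda>j. if even j then z (j div 2) else w (j div 2))" (is "carleson_sequence _ ?l")
proof (rule lacunary_carleson_sequence[where v = "\<lambda>j. j div 2" and s = s])
  define x where "x n = max (1 - norm (z n)) (1 - norm (w n))" for n
  define y where "y n = min (1 - norm (z n)) (1 - norm (w n))" for n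
  have xy: "1 - norm (?l j) \<le> x (j div 2)" "y (j div 2) \<le> 1 - norm (?l j)" for j by (auto simp: x_def y_def)
  fix j k :: nat assume "j div 2 < k div 2"
  then have "x (k div 2) \<le> y (j div 2) * (1/16) ^ (k div 2 - j div 2)"
    by (intro lacunary_decay) (use lac in \<open>auto simp: x_def y_def\<close>)
  also have "\<dots> \<le> (1 - norm (?l j)) * (1/16) ^ (k div 2 - j div 2)" by (intro mult_right_mono xy) auto
  finally show "1 - norm (?l k) \<le> (1 - norm (?l j)) * (1/16) ^ (k div 2 - j div 2)"
    using xy(1)[of k] by linarith
next
  fix j k :: nat assume jk: "j \<noteq> k" "j div 2 = k div 2"
  show "s \<le> pseudohyperbolic (?l j) (?l k)"
  proof (cases "even j")
    case True
    then have "odd k" using jk by (metis even_two_times_div_two)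
    then show ?thesis using sep(1)[of "j div 2"] jk True by simp
  next
    case False
    then have "even k" using jk by (metis odd_two_times_div_two_succ)
    then show ?thesis using sep(1)[of "k div 2"] jk False
      by (simp add: pseudohyperbolic_commute[of "w _"])
  qed
next
  fix n :: nat and F :: "nat set" assume "finite F"
  have "{k\<in>F. k div 2 = n} \<subseteq> {2 * n, 2 * n + 1}" by auto
  then have "card {k\<in>F. k div 2 = n} \<le> card {2 * n, 2 * n + 1}" by (intro card_mono) auto
  then show "card {k\<in>F. k div 2 = n} \<le> 2" by simp
qed (use disc sep in auto)

section \<open>Maps that preserve interpolating sequences\<close>

definition carleson_preserving :: "(complex \<Rightarrow> complex) \<Rightarrow> bool" where
  "carleson_preserving \<Phi> \<longleftrightarrow> (\<forall>(J :: nat set) l. l ` J \<subseteq> unit_disc \<longrightarrow>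
     (carleson_sequence J l \<longleftrightarrow> carleson_sequence J (\<Phi> \<circ> l)))"

lemma carleson_preservingD:
  "carleson_preserving \<Phi> \<Longrightarrow> l ` J \<subseteq> unit_disc \<Longrightarrow> carleson_sequence J l \<longleftrightarrow> carleson_sequence J (\<Phi> \<circ> l)"
  by (simp add: carleson_preserving_def)

lemma pseudohyperbolic_pos:
  assumes "norm z < 1" "norm w < 1" "z \<noteq> w" shows "0 < pseudohyperbolic z w"
  using one_minus_cnj_mult_nonzero[of z w] assms by (simp add: pseudohyperbolic_def)

lemma carleson_sequence_two_points:
  assumes "norm a < 1" "norm b < 1" "a \<noteq> b"
  shows "carleson_sequence {0, 1} (\<lambda>n. if n = 0 then a else b)"
proof (rule carleson_sequence_sufficient)
  show "separated {0, 1} (\<lambda>n. if n = 0 then a else b)"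
    unfolding separated_def using pseudohyperbolic_pos[OF assms]
    by (intro exI[of _ "pseudohyperbolic a b"]) (auto simp: pseudohyperbolic_commute[of b a])
  show "kernel_bounded {0, 1} (\<lambda>n. if n = 0 then a else b)" unfolding kernel_bounded_def
  proof (intro exI[of _ 2] ballI allI impI)
    fix j F assume F: "finite F" "F \<subseteq> {0, 1 :: nat}" "j \<in> {0, 1 :: nat}"
    have "(\<Sum>k\<in>F. disc_kernel (if j = 0 then a else b) (if k = 0 then a else b)) \<le> real (card F) * 1"
      by (rule sum_bounded_above) (use assms in \<open>auto intro: disc_kernel_le_one\<close>)
    moreover have "card F \<le> card {0, 1 :: nat}" by (rule card_mono) (use F in auto)
    ultimately show "(\<Sum>k\<in>F. disc_kernel (if j = 0 then a else b) (if k = 0 then a else b)) \<le> 2" by simp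
  qed
qed (use assms in auto)

lemma carleson_preserving_inj_on:
  assumes "carleson_preserving \<Phi>" shows "inj_on \<Phi> unit_disc"
proof (rule inj_onI, rule ccontr)
  fix a b assume ab: "a \<in> unit_disc" "b \<in> unit_disc" "\<Phi> a = \<Phi> b" "a \<noteq> b"
  let ?l = "\<lambda>n. if n = (0::nat) then a else b"
  have "carleson_sequence {0, 1} ?l" using carleson_sequence_two_points ab by auto
  then have "carleson_sequence {0, 1} (\<Phi> \<circ> ?l)"
    using carleson_preservingD[OF assms, of ?l "{0, 1}"] ab by auto
  then have "inj_on (\<Phi> \<circ> ?l) {0, 1}" by (rule carleson_sequence_inj_on)
  then show False using ab by (auto simp: inj_on_def)
qed

lemma pseudohyperbolic_le_dist:
  assumes "norm u \<le> R" "R < 1" "norm v < 1"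
  shows "pseudohyperbolic u v \<le> norm (u - v) / (1 - R)"
proof -
  have "1 - R \<le> norm (1 - cnj u * v)"
    using norm_one_minus_cnj_mult_ge[of v u] assms by (simp add: norm_one_minus_cnj_mult_commute[of u v])
  then show ?thesis unfolding pseudohyperbolic_def norm_divide using assms by (intro divide_left_mono mult_pos_pos) auto
qed

text \<open>
  Dependent choice of objects whose upper height \<open>hi\<close> is small against the
  lower height \<open>lo\<close> of the preceding one; the objects are single points or
  pairs of points.
\<close>

lemma lacunary_choice:
  fixes lo hi :: "'a \<Rightarrow> real"
  assumes "\<And>n \<delta>. 0 < \<delta> \<Longrightarrow> \<exists>p. P n p \<and> hi p \<le> \<delta>" "\<And>n p. P n p \<Longrightarrow> 0 < lo p"
  obtains p where "\<And>n. P n (p n)" "\<And>n. hi (p (Suc n)) \<le> lo (p n) / 16"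
proof -
  have "\<exists>p. \<forall>n. P n (p n) \<and> hi (p (Suc n)) \<le> lo (p n) / 16"
  proof (rule dependent_nat_choice)
    show "\<exists>x. P 0 x" using assms(1)[of 1 0] by auto
    fix x n assume "P n x"
    then have "0 < lo x / 16" using assms(2) by simp
    then show "\<exists>y. P (Suc n) y \<and> hi y \<le> lo x / 16" by (rule assms(1))
  qed
  then show ?thesis using that by blast
qed

text \<open>
  Otherwise some points tending to the boundary have images in a compact disc. A lacunary
  subsequence of the points is interpolating, but its image has an accumulation point and so
  is not separated.
\<close>

lemma carleson_preserving_proper:
  assumes cp: "carleson_preserving \<Phi>" and map: "\<Phi> ` unit_disc \<subseteq> unit_disc" and "R < 1"
  obtains r where "r < 1" "\<And>z. norm z < 1 \<Longrightarrow> norm (\<Phi> z) \<le> R \<Longrightarrow> norm z \<le> r"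
proof (rule ccontr)
  assume "\<not> thesis"
  with that have far: "\<exists>z. norm z < 1 \<and> norm (\<Phi> z) \<le> R \<and> r < norm z" if "r < 1" for r
    using that by (meson not_le)
  obtain z where z: "\<And>n::nat. norm (z n) < 1 \<and> norm (\<Phi> (z n)) \<le> R"
    "\<And>n. 1 - norm (z (Suc n)) \<le> (1 - norm (z n)) / 16"
  proof (rule lacunary_choice[of "\<lambda>n z. norm z < 1 \<and> norm (\<Phi> z) \<le> R" "\<lambda>z. 1 - norm z" "\<lambda>z. 1 - norm z"])
    show "\<exists>p. (norm p < 1 \<and> norm (\<Phi> p) \<le> R) \<and> 1 - norm p \<le> \<delta>" if "0 < \<delta>" for n :: nat and \<delta>
      using far[of "1 - \<delta>"] that by force
  qed auto
  have "carleson_sequence UNIV z"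
  proof (rule lacunary_carleson_sequence[where v = "\<lambda>j. j" and s = 1])
    show "1 - norm (z k) \<le> (1 - norm (z j)) * (1 / 16) ^ (k - j)" if "j < k" for j k
      by (rule lacunary_decay[of "\<lambda>n. 1 - norm (z n)"]) (use z that in auto)
    show "card {k\<in>F. k = n} \<le> 2" if "finite F" for n :: nat and F
    proof -
      have "card {k\<in>F. k = n} \<le> card {n}" by (rule card_mono) auto
      then show ?thesis by simp
    qed
  qed (use z in auto)
  then have "carleson_sequence UNIV (\<Phi> \<circ> z)"
    using carleson_preservingD[OF cp, of z UNIV] z(1) by (simp add: image_subset_iff)
  then obtain s where s: "s > 0" "\<And>i j. i \<noteq> j \<Longrightarrow> s \<le> pseudohyperbolic (\<Phi> (z i)) (\<Phi> (z j))"
    using carleson_sequence_necessary(1)[of UNIV "\<Phi> \<circ> z"] by (auto simp: separated_def)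
  have far2: "s * (1 - R) \<le> dist (\<Phi> (z i)) (\<Phi> (z j))" if "i \<noteq> j" for i j
    using pseudohyperbolic_le_dist[of "\<Phi> (z i)" R "\<Phi> (z j)"] s(2)[OF that] z \<open>R < 1\<close>
    by (simp add: dist_norm pos_le_divide_eq) (smt (verit) divide_right_mono pos_le_divide_eq)
  have "seq_compact (cball (0::complex) R)" by (simp add: compact_eq_seq_compact_metric[symmetric])
  moreover have "\<forall>n. (\<Phi> \<circ> z) n \<in> cball 0 R" using z by auto
  ultimately obtain a r where r: "strict_mono (r :: nat \<Rightarrow> nat)" "((\<Phi> \<circ> z) \<circ> r) \<longlonglongrightarrow> a"
    unfolding seq_compact_def by blast
  have "Cauchy ((\<Phi> \<circ> z) \<circ> r)" using r(2) by (rule LIMSEQ_imp_Cauchy)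
  moreover have "0 < s * (1 - R)" using s \<open>R < 1\<close> by simp
  ultimately obtain N where "\<forall>m\<ge>N. \<forall>n\<ge>N. dist (((\<Phi> \<circ> z) \<circ> r) m) (((\<Phi> \<circ> z) \<circ> r) n) < s * (1 - R)"
    unfolding Cauchy_def by blast
  then have "dist (\<Phi> (z (r N))) (\<Phi> (z (r (Suc N)))) < s * (1 - R)" by simp
  moreover have "r N \<noteq> r (Suc N)" using r(1) by (metis n_not_Suc_n strict_mono_eq)
  ultimately show False using far2 by (meson not_le)
qed

text \<open>
  The image is open by invariance of domain and, by properness, relatively closed in the
  disc.
\<close>

lemma carleson_preserving_homeomorphism:
  assumes cp: "carleson_preserving \<Phi>" and cont: "continuous_on unit_disc \<Phi>"
    and map: "\<Phi> ` unit_disc \<subseteq> unit_disc"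
  obtains \<Psi> where "homeomorphism unit_disc unit_disc \<Phi> \<Psi>"
proof -
  note inj = carleson_preserving_inj_on[OF cp]
  have "open (\<Phi> ` unit_disc)" by (rule invariance_of_domain[OF cont _ inj]) simp
  moreover have "open (unit_disc - \<Phi> ` unit_disc)"
    unfolding open_contains_ball
  proof
    fix y assume y: "y \<in> unit_disc - \<Phi> ` unit_disc"
    define R where "R = (1 + norm y) / 2"
    have R: "R < 1" "norm y < R" using y by (auto simp: R_def)
    obtain r where r: "r < 1" "\<And>z. norm z < 1 \<Longrightarrow> norm (\<Phi> z) \<le> R \<Longrightarrow> norm z \<le> r"
      using carleson_preserving_proper[OF cp map R(1)] by blast
    have "cball 0 r \<subseteq> unit_disc" using r by auto
    then have "compact (\<Phi> ` cball 0 r)" "y \<notin> \<Phi> ` cball 0 r"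
      using y by (auto intro: compact_continuous_image continuous_on_subset[OF cont])
    then have "open (ball 0 R - \<Phi> ` cball 0 r)" "y \<in> ball 0 R - \<Phi> ` cball 0 r"
      using R by (auto intro: open_Diff compact_imp_closed)
    then obtain e where e: "e > 0" "ball y e \<subseteq> ball 0 R - \<Phi> ` cball 0 r"
      using open_contains_ball by blast
    have "ball 0 R - \<Phi> ` cball 0 r \<subseteq> unit_disc - \<Phi> ` unit_disc"
      using r R by fastforce
    then show "\<exists>e>0. ball y e \<subseteq> unit_disc - \<Phi> ` unit_disc" using e by blast
  qed
  moreover have "connected unit_disc" by simp
  moreover have "\<Phi> 0 \<in> \<Phi> ` unit_disc" by auto
  ultimately have "unit_disc - \<Phi> ` unit_disc = {}"
    using connectedD[of unit_disc "\<Phi> ` unit_disc" "unit_disc - \<Phi> ` unit_disc"] map by blast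
  then have "\<Phi> ` unit_disc = unit_disc" using map by blast
  then show ?thesis
    using invariance_of_domain_homeomorphism[OF _ cont _ inj] that by auto
qed

text \<open>
  Only the first point is confined to a compact disc; the second one is arbitrary. On the
  compact disc with the midpoint radius the pseudohyperbolic and the Euclidean distance are
  comparable.
\<close>

lemma pseudohyperbolic_continuous_near_compact:
  assumes cont: "continuous_on unit_disc \<Phi>" and map: "\<Phi> ` unit_disc \<subseteq> unit_disc"
    and "r < 1" "0 < \<epsilon>"
  obtains \<eta> where "0 < \<eta>" "\<And>z w. norm z \<le> r \<Longrightarrow> norm w < 1 \<Longrightarrow> pseudohyperbolic z w < \<eta> \<Longrightarrow>
    pseudohyperbolic (\<Phi> z) (\<Phi> w) < \<epsilon>"
proof -
  define r' where "r' = (1 + r) / 2"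
  have r': "r' < 1" "r < r'" using \<open>r < 1\<close> by (auto simp: r'_def)
  let ?K = "cball (0::complex) r'"
  have K: "?K \<subseteq> unit_disc" using r' by auto
  have contK: "continuous_on ?K \<Phi>" by (rule continuous_on_subset[OF cont K])
  obtain R where R: "R < 1" "\<And>z. z \<in> ?K \<Longrightarrow> norm (\<Phi> z) \<le> R"
  proof (cases "?K = {}")
    case False
    have "continuous_on ?K (\<lambda>z. norm (\<Phi> z))" by (intro continuous_intros contK)
    then obtain z0 where "z0 \<in> ?K" "\<forall>z\<in>?K. norm (\<Phi> z) \<le> norm (\<Phi> z0)"
      using continuous_attains_sup[OF compact_cball False] by blast
    then show ?thesis using that[of "norm (\<Phi> z0)"] K map by (auto simp: image_subset_iff)
  qed (use that[of 0] in auto)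
  have "uniformly_continuous_on ?K \<Phi>" by (rule compact_uniformly_continuous[OF contK]) simp
  moreover have "0 < \<epsilon> * (1 - R)" using \<open>0 < \<epsilon>\<close> R by simp
  ultimately obtain \<delta> where \<delta>: "\<delta> > 0" "\<And>z w. z \<in> ?K \<Longrightarrow> w \<in> ?K \<Longrightarrow> dist w z < \<delta> \<Longrightarrow> dist (\<Phi> w) (\<Phi> z) < \<epsilon> * (1 - R)"
    unfolding uniformly_continuous_on_def by metis
  show ?thesis
  proof (rule that[of "min (\<delta> / 2) ((1 - r) / 4)"])
    show "0 < min (\<delta> / 2) ((1 - r) / 4)" using \<delta> \<open>r < 1\<close> by simp
    fix z w assume z: "norm z \<le> r" and w: "norm w < 1" and p: "pseudohyperbolic z w < min (\<delta> / 2) ((1 - r) / 4)"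
    have nz: "1 - cnj z * w \<noteq> 0" using one_minus_cnj_mult_nonzero[of z w] z w \<open>r < 1\<close> by simp
    have "norm (1 - cnj z * w) \<le> norm (1::complex) + norm (cnj z * w)" by (rule norm_triangle_ineq4)
    also have "\<dots> \<le> 2" using z w \<open>r < 1\<close> by (simp add: norm_mult mult_le_one)
    finally have "norm (1 - cnj z * w) \<le> 2" .
    then have "pseudohyperbolic z w * norm (1 - cnj z * w) \<le> pseudohyperbolic z w * 2"
      by (intro mult_left_mono pseudohyperbolic_nonneg)
    moreover have "norm (z - w) = pseudohyperbolic z w * norm (1 - cnj z * w)"
      using nz by (simp add: pseudohyperbolic_def norm_divide)
    ultimately have d: "norm (z - w) \<le> 2 * pseudohyperbolic z w" by simp
    then have "norm w \<le> r'" using z p norm_triangle_ineq2[of w z] by (simp add: r'_def norm_minus_commute field_simps)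
    moreover have "norm z \<le> r'" using z r' by simp
    moreover have "dist w z < \<delta>" using d p by (simp add: dist_norm norm_minus_commute)
    ultimately have "dist (\<Phi> w) (\<Phi> z) < \<epsilon> * (1 - R)" using \<delta>(2)[of z w] by simp
    then have "norm (\<Phi> z - \<Phi> w) / (1 - R) < \<epsilon>" using R(1) by (simp add: dist_norm norm_minus_commute divide_less_eq)
    moreover have "pseudohyperbolic (\<Phi> z) (\<Phi> w) \<le> norm (\<Phi> z - \<Phi> w) / (1 - R)"
      using R \<open>norm z \<le> r'\<close> w map by (intro pseudohyperbolic_le_dist) (auto simp: image_subset_iff)
    ultimately show "pseudohyperbolic (\<Phi> z) (\<Phi> w) < \<epsilon>" by linarith
  qed
qed

text \<open>
  By properness and continuity on compact sets, the pairs that violate uniform continuity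
  have images arbitrarily close to the circle. A lacunary choice of such pairs makes the
  images an interpolating sequence, while the distances of the original pairs tend to zero.
\<close>

lemma carleson_preserving_uniformly_continuous:
  assumes cp: "carleson_preserving \<Phi>" and cont: "continuous_on unit_disc \<Phi>"
    and map: "\<Phi> ` unit_disc \<subseteq> unit_disc"
  shows "pseudohyperbolic_uniformly_continuous \<Phi>"
proof (rule ccontr)
  assume "\<not> ?thesis"
  then obtain \<epsilon> where \<epsilon>: "\<epsilon> > 0" "\<And>d. d > 0 \<Longrightarrow> \<exists>z w. norm z < 1 \<and> norm w < 1 \<and> pseudohyperbolic z w < d
      \<and> \<epsilon> \<le> pseudohyperbolic (\<Phi> z) (\<Phi> w)"
    unfolding pseudohyperbolic_uniformly_continuous_def by (fastforce simp: not_less)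
  have disc: "norm (\<Phi> z) < 1" if "norm z < 1" for z using map that by (simp add: image_subset_iff)
  define P where "P n p \<longleftrightarrow> norm (fst p) < 1 \<and> norm (snd p) < 1 \<and>
    pseudohyperbolic (fst p) (snd p) < 1 / real (Suc n) \<and> \<epsilon> \<le> pseudohyperbolic (\<Phi> (fst p)) (\<Phi> (snd p))" for n p
  obtain p where p: "\<And>n. P n (p n)"
    "\<And>n. max (1 - norm (\<Phi> (fst (p (Suc n))))) (1 - norm (\<Phi> (snd (p (Suc n)))))
      \<le> min (1 - norm (\<Phi> (fst (p n)))) (1 - norm (\<Phi> (snd (p n)))) / 16"
  proof (rule lacunary_choice[of P "\<lambda>p. max (1 - norm (\<Phi> (fst p))) (1 - norm (\<Phi> (snd p)))"
        "\<lambda>p. min (1 - norm (\<Phi> (fst p))) (1 - norm (\<Phi> (snd p)))"])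
    fix n :: nat and \<delta> :: real assume "0 < \<delta>"
    obtain r where r: "r < 1" "\<And>z. norm z < 1 \<Longrightarrow> norm (\<Phi> z) \<le> 1 - \<delta> \<Longrightarrow> norm z \<le> r"
      using carleson_preserving_proper[OF cp map, of "1 - \<delta>"] \<open>0 < \<delta>\<close> by auto
    obtain \<eta> where \<eta>: "0 < \<eta>" "\<And>z w. norm z \<le> r \<Longrightarrow> norm w < 1 \<Longrightarrow> pseudohyperbolic z w < \<eta> \<Longrightarrow>
      pseudohyperbolic (\<Phi> z) (\<Phi> w) < \<epsilon>"
      using pseudohyperbolic_continuous_near_compact[OF cont map r(1) \<epsilon>(1)] by blast
    obtain z w where zw: "norm z < 1" "norm w < 1" "pseudohyperbolic z w < min \<eta> (1 / real (Suc n))"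
      "\<epsilon> \<le> pseudohyperbolic (\<Phi> z) (\<Phi> w)"
      using \<epsilon>(2)[of "min \<eta> (1 / real (Suc n))"] \<eta>(1) by auto
    have "\<not> norm z \<le> r" using \<eta>(2)[of z w] zw by auto
    moreover have "\<not> norm w \<le> r"
      using \<eta>(2)[of w z] zw by (auto simp: pseudohyperbolic_commute[of w z] pseudohyperbolic_commute[of "\<Phi> w" "\<Phi> z"])
    ultimately have "1 - \<delta> < norm (\<Phi> z)" "1 - \<delta> < norm (\<Phi> w)" using r(2) zw by force+
    then show "\<exists>p. P n p \<and> max (1 - norm (\<Phi> (fst p))) (1 - norm (\<Phi> (snd p))) \<le> \<delta>"
      using zw by (intro exI[of _ "(z, w)"]) (auto simp: P_def)
  qed (use disc in \<open>auto simp: P_def\<close>)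
  define l where "l j = (if even j then fst (p (j div 2)) else snd (p (j div 2)))" for j
  have "carleson_sequence UNIV (\<lambda>j. if even j then \<Phi> (fst (p (j div 2))) else \<Phi> (snd (p (j div 2))))"
    by (rule lacunary_pairs_carleson_sequence[where s = \<epsilon>])
       (use p disc \<epsilon> in \<open>auto simp: P_def\<close>)
  also have "(\<lambda>j. if even j then \<Phi> (fst (p (j div 2))) else \<Phi> (snd (p (j div 2)))) = \<Phi> \<circ> l"
    by (auto simp: l_def)
  finally have "carleson_sequence UNIV (\<Phi> \<circ> l)" .
  moreover have "range l \<subseteq> unit_disc" using p(1) by (auto simp: l_def P_def)
  ultimately have "carleson_sequence UNIV l"
    using carleson_preservingD[OF cp] by blast
  then obtain s where s: "s > 0" "\<And>i j. i \<noteq> j \<Longrightarrow> s \<le> pseudohyperbolic (l i) (l j)"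
    using carleson_sequence_necessary(1)[of UNIV l] by (auto simp: separated_def)
  have "s \<le> 1 / real (Suc n)" for n
    using s(2)[of "2 * n" "2 * n + 1"] p(1)[of n] by (simp add: l_def P_def)
  moreover obtain n where "inverse (of_nat (Suc n)) < s" using reals_Archimedean[OF s(1)] by blast
  ultimately show False by (metis inverse_eq_divide not_le)
qed

section \<open>Arcs and Carleson boxes\<close>

text \<open>
  Angles are measured in turns, so that the normalized length of an arc is the length of an
  interval.
\<close>

abbreviation turn :: "real \<Rightarrow> complex" where "turn t \<equiv> cis (2 * pi * t)"

lemma turn_eq_iff: "turn t = turn s \<longleftrightarrow> (\<exists>k::int. t = s + of_int k)"
proof -
  have "turn t = turn s \<longleftrightarrow> (\<exists>k::int. 2 * pi * t = 2 * pi * s + 2 * pi * of_int k)"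
    using sin_cos_eq_iff[of "2 * pi * t" "2 * pi * s"] by (auto simp: complex_eq_iff mult.commute)
  also have "\<dots> \<longleftrightarrow> (\<exists>k::int. t = s + of_int k)"
  proof -
    have "2 * pi * t = 2 * pi * s + 2 * pi * u \<longleftrightarrow> t = s + u" for u
      by (simp add: distrib_left[symmetric])
    then show ?thesis by simp
  qed
  finally show ?thesis .
qed

lemma polar_turn:
  obtains t where "0 \<le> t" "t < 1" "w = of_real (norm w) * turn t"
proof
  show "0 \<le> Arg2pi w / (2 * pi)" "Arg2pi w / (2 * pi) < 1"
    using Arg2pi[of w] by auto
  show "w = of_real (norm w) * turn (Arg2pi w / (2 * pi))"
    using Arg2pi[of w] by (simp add: cis_conv_exp is_Arg_def)
qed

lemma norm_turn_diff_polar: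
  assumes "w = of_real (norm w) * turn t" "norm w < 1"
  shows "norm (turn t - w) = 1 - norm w"
proof -
  have "turn t - w = of_real (1 - norm w) * turn t"
    by (subst assms(1)) (simp add: algebra_simps)
  then have "norm (turn t - w) = \<bar>1 - norm w\<bar> * 1" by (simp only: norm_mult norm_of_real norm_cis)
  then show ?thesis using assms(2) by simp
qed

lemma sphere_turn:
  assumes "norm \<zeta> = 1" obtains t where "0 \<le> t" "t < 1" "\<zeta> = turn t"
  using polar_turn[of \<zeta>] assms by auto

text \<open>
  Half-open arcs suffice for all constructions; other arcs are compared with them.
\<close>

lemma arc_measure_half_open:
  assumes "a \<le> b" "b \<le> a + 1"
  shows "arc_measure (turn ` {a..<b}) = b - a"
proof -
  \<comment> \<open>After a shift by n the interval starts in the unit interval, and its part beyond 1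
    wraps around to an initial segment.\<close>
  define n where "n = \<lfloor>a\<rfloor>"
  define a' where "a' = a - n"
  define b' where "b' = b - n"
  have a': "0 \<le> a'" "a' < 1" by (auto simp: a'_def n_def) linarith
  have b': "a' \<le> b'" "b' \<le> a' + 1" using assms by (auto simp: a'_def b'_def)
  have "turn t \<in> turn ` {a..<b} \<longleftrightarrow> t \<in> {a'..<min b' 1} \<union> {0..<b' - 1}" if t: "0 \<le> t" "t < 1" for t
  proof
    assume "turn t \<in> turn ` {a..<b}"
    then obtain s k where s: "a \<le> s" "s < b" "t = s + of_int k" by (auto simp: turn_eq_iff)
    define k' where "k' = k + n"
    have k': "t = (s - n) + of_int k'" "a' \<le> s - n" "s - n < b'" using s by (auto simp: k'_def a'_def b'_def)
    then have "- 2 < real_of_int k'" "real_of_int k' < 1" using t a' b' by linarith+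
    then have "k' = 0 \<or> k' = - 1" by linarith
    then show "t \<in> {a'..<min b' 1} \<union> {0..<b' - 1}" using k' t by auto
  next
    assume "t \<in> {a'..<min b' 1} \<union> {0..<b' - 1}"
    then have "(a \<le> t + n \<and> t + n < b) \<or> (a \<le> t + (n + 1) \<and> t + (n + 1) < b)"
      using a' b' by (auto simp: a'_def b'_def)
    then show "turn t \<in> turn ` {a..<b}"
    proof
      assume "a \<le> t + n \<and> t + n < b"
      then show ?thesis by (intro image_eqI[of _ _ "t + of_int n"]) (auto simp: turn_eq_iff intro!: exI[of _ "- n"])
    next
      assume "a \<le> t + (n + 1) \<and> t + (n + 1) < b"
      then show ?thesis by (intro image_eqI[of _ _ "t + of_int (n + 1)"]) (auto simp: turn_eq_iff intro!: exI[of _ "- n - 1"])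
    qed
  qed
  then have "{t \<in> {0..<1}. turn t \<in> turn ` {a..<b}} = {t \<in> {0..<1}. t \<in> {a'..<min b' 1} \<union> {0..<b' - 1}}"
    by (intro Collect_cong conj_cong) auto
  also have "\<dots> = {a'..<min b' 1} \<union> {0..<b' - 1}" using a' b' by auto
  finally have E: "{t \<in> {0..<1}. turn t \<in> turn ` {a..<b}} = {a'..<min b' 1} \<union> {0..<b' - 1}" .
  have "measure lborel ({a'..<min b' 1} \<union> {0..<b' - 1}) = b' - a'"
  proof (cases "b' \<le> 1")
    case False
    then have "measure lborel ({a'..<min b' 1} \<union> {0..<b' - 1}) = measure lborel {a'..<min b' 1} + measure lborel {0..<b' - 1}"
      by (intro measure_Union) (use a' b' in auto)
    then show ?thesis using False a' b' by simp
  qed (use b' in simp)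
  then show ?thesis unfolding arc_measure_def E by (simp add: a'_def b'_def)
qed

lemma arc_measure_circle: "arc_measure unit_circle = 1"
proof -
  have "{t \<in> {0..<1}. turn t \<in> unit_circle} = {0..<1}" by auto
  then show ?thesis by (simp only: arc_measure_def) simp
qed

lemma circle_in_carleson_arcs: "unit_circle \<in> carleson_arcs"
proof -
  have "unit_circle = turn ` UNIV"
  proof
    show "unit_circle \<subseteq> turn ` UNIV"
    proof
      fix \<zeta> assume "\<zeta> \<in> unit_circle"
      then obtain t where "\<zeta> = turn t" using sphere_turn[of \<zeta>] by auto
      then show "\<zeta> \<in> turn ` UNIV" by auto
    qed
  qed auto
  then have "circle_arc unit_circle" unfolding circle_arc_def by (intro exI[of _ UNIV]) (auto simp: is_interval_univ)
  then show ?thesis by (simp add: carleson_arcs_def arc_measure_circle)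
qed

lemma carleson_box_circle: "carleson_box unit_circle = unit_disc"
  by (simp add: carleson_box_def)

lemma half_open_arc_in_carleson_arcs:
  assumes "a < b" "b < a + 1" shows "turn ` {a..<b} \<in> carleson_arcs"
  using assms arc_measure_half_open[of a b]
  by (auto simp: carleson_arcs_def circle_arc_def is_interval_1 intro!: exI[of _ "{a..<b}"])

lemma mem_carleson_box_half_open:
  assumes "a < b" "b < a + 1" "w = of_real r * turn t" "a \<le> t" "t < b" "0 < r" "r < 1" "1 - r \<le> b - a"
  shows "w \<in> carleson_box (turn ` {a..<b})"
proof (cases "turn ` {a..<b} = unit_circle")
  case True
  then show ?thesis using assms by (auto simp: carleson_box_def norm_mult)
next
  case False
  have "turn t \<in> turn ` {a..<b}" using assms by auto
  then have "w \<in> {of_real r * \<zeta> |r \<zeta>. \<zeta> \<in> turn ` {a..<b} \<and> 0 < r \<and> r < 1 \<and> 1 - r \<le> arc_measure (turn ` {a..<b})}"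
    using assms arc_measure_half_open[of a b] by (intro CollectI exI[of _ r] exI[of _ "turn t"]) simp
  then show ?thesis using False unfolding carleson_box_def by simp
qed

text \<open>
  What is needed about a general arc: except for the full circle, it is parametrized by an
  interval of diameter at most its measure.
\<close>

lemma carleson_arc_cases:
  assumes "I \<in> carleson_arcs"
  obtains "I = unit_circle"
  | A where "I \<noteq> unit_circle" "I = turn ` A" "is_interval A" "0 < arc_measure I" "arc_measure I < 1"
      "\<And>p q. p \<in> A \<Longrightarrow> q \<in> A \<Longrightarrow> \<bar>p - q\<bar> \<le> arc_measure I"
proof (cases "I = unit_circle")
  case False
  obtain A where A: "is_interval A" "I = turn ` A" using assms by (auto simp: carleson_arcs_def circle_arc_def)
  let ?E = "\<lambda>I. {t \<in> {0..<1}. turn t \<in> I}"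
  have pos: "0 < arc_measure I" using assms by (simp add: carleson_arcs_def)
  \<comment> \<open>Non-measurable sets have measure 0, so that positivity of the measure yields
    measurability.\<close>
  then have sets: "?E I \<in> sets lborel" unfolding arc_measure_def by (metis less_irrefl measure_notin_sets)
  have fm: "?E I \<in> fmeasurable lborel"
  proof (rule fmeasurableI2)
    show "{0..<1::real} \<in> fmeasurable lborel" by (simp add: fmeasurable_def)
  qed (use sets in auto)
  have "arc_measure I \<le> measure lborel {0..<1::real}"
    unfolding arc_measure_def by (rule measure_mono_fmeasurable) (use sets in \<open>auto simp: fmeasurable_def\<close>)
  then have lt: "arc_measure I < 1" using False assms by (auto simp: carleson_arcs_def)
  have half: "q - p \<le> arc_measure I" if "p \<in> A" "q \<in> A" "p \<le> q" "q \<le> p + 1" for p q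
  proof -
    have "x \<in> A" if "p \<le> x" "x \<le> q" for x
      using A(1) \<open>p \<in> A\<close> \<open>q \<in> A\<close> that unfolding is_interval_1 by blast
    then have sub: "turn ` {p..<q} \<subseteq> I" using A(2) by auto
    have "measure lborel (?E (turn ` {p..<q})) \<le> measure lborel (?E I)"
    proof (cases "?E (turn ` {p..<q}) \<in> sets lborel")
      case True
      then show ?thesis using sub by (intro measure_mono_fmeasurable fm) blast+
    next
      case False
      then show ?thesis by (simp add: measure_notin_sets)
    qed
    then show ?thesis using arc_measure_half_open[of p q] that by (simp add: arc_measure_def)
  qed
  have le: "q - p \<le> arc_measure I" if "p \<in> A" "q \<in> A" "p \<le> q" for p q
  proof (rule ccontr)
    assume "\<not> q - p \<le> arc_measure I"
    then have "q > p + 1" using half[of p q] that by (cases "q \<le> p + 1") auto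
    then have "p \<le> p + 1 \<and> p + 1 \<le> q" by simp
    then have "p + 1 \<in> A" using A(1) that unfolding is_interval_1 by blast
    then show False using half[of p "p + 1"] that lt by simp
  qed
  show ?thesis
  proof (rule that(2)[OF False A(2,1) pos lt])
    show "\<bar>p - q\<bar> \<le> arc_measure I" if "p \<in> A" "q \<in> A" for p q
      using le[of p q] le[of q p] that by (cases "p \<le> q") auto
  qed
qed (use that in blast)

lemma carleson_box_subset: "I \<in> carleson_arcs \<Longrightarrow> carleson_box I \<subseteq> unit_disc"
  by (erule carleson_arc_cases) (auto simp: carleson_box_def norm_mult)

lemma carleson_box_height:
  assumes "I \<in> carleson_arcs" "w \<in> carleson_box I" shows "1 - norm w \<le> arc_measure I"
  using assms(1)
proof (cases rule: carleson_arc_cases)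
  case 1
  then show ?thesis by (simp add: arc_measure_circle)
next
  case (2 A)
  then show ?thesis using assms(2) by (auto simp: carleson_box_def norm_mult)
qed

text \<open>
  Up to its end points an arc is a compact arc, hence Borel, and the box is its preimage
  under the projection to the circle, cut off by heights. Measurability matters because the
  norm of a measure is defined through its values on boxes.
\<close>

lemma carleson_box_measurable:
  assumes "I \<in> carleson_arcs" shows "carleson_box I \<in> sets disc_borel"
  using assms
proof (cases rule: carleson_arc_cases)
  case 1
  then show ?thesis by (simp add: carleson_box_def sets_restrict_space_iff)
next
  case (2 A)
  have "A \<noteq> {}" using 2 by (auto simp: arc_measure_def)
  then obtain p0 where p0: "p0 \<in> A" by auto
  have bdd: "bdd_above A" "bdd_below A"
    using 2(6)[OF _ p0] by (auto simp: bdd_above_def bdd_below_def intro: exI[of _ "p0 + arc_measure I"] exI[of _ "p0 - arc_measure I"])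
       (metis abs_le_iff diff_le_eq add.commute, smt (verit))
  define p q where "p = Inf A" and "q = Sup A"
  have AK: "A \<subseteq> {p..q}" using bdd by (auto simp: p_def q_def intro: cInf_lower cSup_upper)
  have KA: "{p..q} - {p, q} \<subseteq> A"
  proof
    fix x assume "x \<in> {p..q} - {p, q}"
    then have "p < x" "x < q" by auto
    then obtain u v where "u \<in> A" "u < x" "v \<in> A" "x < v"
      using cInf_less_iff[OF \<open>A \<noteq> {}\<close> bdd(2)] less_cSup_iff[OF \<open>A \<noteq> {}\<close> bdd(1)] by (auto simp: p_def q_def)
    then show "x \<in> A" using 2(3) unfolding is_interval_1 by (meson less_imp_le)
  qed
  let ?K = "turn ` {p..q}"
  have "closed ?K" by (intro compact_imp_closed compact_continuous_image continuous_intros) auto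
  moreover have "I = ?K - (?K - I)" "?K - I \<subseteq> {turn p, turn q}"
    using AK KA 2(2) by blast+
  moreover from this have "finite (?K - I)" using finite_subset by blast
  ultimately have I: "I \<in> sets borel" by (metis borel_closed finite_imp_closed sets.Diff)
  have "carleson_box I = {w \<in> unit_disc - {0}. 1 - norm w \<le> arc_measure I \<and> w / of_real (norm w) \<in> I}" (is "_ = ?R")
  proof
    show "carleson_box I \<subseteq> ?R"
      using 2(1,2) by (auto simp: carleson_box_def norm_mult)
    show "?R \<subseteq> carleson_box I"
    proof
      fix w assume w: "w \<in> ?R"
      then have "w = of_real (norm w) * (w / of_real (norm w))" by auto
      moreover have "0 < norm w" "norm w < 1" using w by auto
      ultimately show "w \<in> carleson_box I" using w 2(1) unfolding carleson_box_def by auto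
    qed
  qed
  also have "\<dots> = ((unit_disc - {0}) \<inter> {w. 1 - norm w \<le> arc_measure I}) \<inter> (\<lambda>w. w / of_real (norm w)) -` I" by auto
  also have "\<dots> \<in> sets borel"
  proof -
    have "(\<lambda>w::complex. w / of_real (norm w)) \<in> borel_measurable borel" by measurable
    then have "(\<lambda>w. w / of_real (norm w)) -` I \<in> sets borel" using I measurable_sets_borel by blast
    moreover have "closed {w::complex. 1 - norm w \<le> arc_measure I}" by (intro closed_Collect_le continuous_intros)
    ultimately show ?thesis by auto
  qed
  finally show ?thesis using carleson_box_subset[OF assms] by (auto simp: sets_restrict_space_iff)
qed

section \<open>Carleson boxes, discs at boundary points and kernel sums\<close>

text \<open>
  Greedy selection: take a point of largest \<open>x\<close>, discard the points in its
  window, and repeat. A point chosen later has a smaller \<open>x\<close> and lies outside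
  the earlier windows, so the windows of half size are disjoint.
\<close>

lemma sum_le_of_disjoint_windows:
  fixes t x w :: "'a \<Rightarrow> real"
  assumes "finite F" "\<And>j. j \<in> F \<Longrightarrow> 0 < x j" "\<And>j. j \<in> F \<Longrightarrow> 0 \<le> w j"
    and "\<And>j. j \<in> F \<Longrightarrow> (\<Sum>k\<in>{k\<in>F. x k \<le> x j \<and> \<bar>t k - t j\<bar> \<le> x j}. w k) \<le> K * x j"
  shows "\<exists>A\<subseteq>F. (\<Sum>k\<in>F. w k) \<le> K * (\<Sum>j\<in>A. x j) \<and>
    disjoint_family_on (\<lambda>j. {t j - x j / 2 <..< t j + x j / 2}) A"
  using assms
proof (induction F rule: finite_psubset_induct)
  case (psubset F)
  show ?case
  proof (cases "F = {}")
    case False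
    then obtain j where j: "j \<in> F" "\<And>k. k \<in> F \<Longrightarrow> x k \<le> x j"
    proof -
      have "Max (x ` F) \<in> x ` F" using psubset.hyps(1) False by (intro Max_in) auto
      then obtain j where "j \<in> F" "x j = Max (x ` F)" by auto
      then show ?thesis using that psubset.hyps(1) by auto
    qed
    define G where "G = {k\<in>F. \<not> \<bar>t k - t j\<bar> \<le> x j}"
    have "0 < x j" using psubset.prems j by auto
    then have "j \<notin> G" by (simp add: G_def)
    then have GF: "G \<subset> F" using j unfolding G_def by blast
    have near: "(\<Sum>k\<in>{k\<in>G. x k \<le> x i \<and> \<bar>t k - t i\<bar> \<le> x i}. w k) \<le> K * x i" if "i \<in> G" for i
    proof -
      have "(\<Sum>k\<in>{k\<in>G. x k \<le> x i \<and> \<bar>t k - t i\<bar> \<le> x i}. w k)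
          \<le> (\<Sum>k\<in>{k\<in>F. x k \<le> x i \<and> \<bar>t k - t i\<bar> \<le> x i}. w k)"
        using psubset.hyps(1) psubset.prems(2) GF by (intro sum_mono2) auto
      then show ?thesis using psubset.prems(3)[of i] that GF by force
    qed
    have "\<exists>A\<subseteq>G. (\<Sum>k\<in>G. w k) \<le> K * (\<Sum>j\<in>A. x j) \<and>
        disjoint_family_on (\<lambda>j. {t j - x j / 2 <..< t j + x j / 2}) A"
      by (rule psubset.IH[OF GF]) (use GF psubset.prems near in auto)
    then obtain A where A: "A \<subseteq> G" "(\<Sum>k\<in>G. w k) \<le> K * (\<Sum>j\<in>A. x j)"
      "disjoint_family_on (\<lambda>j. {t j - x j / 2 <..< t j + x j / 2}) A" by blast
    have finA: "finite A" using A(1) GF psubset.hyps(1) by (meson finite_subset psubset_imp_subset)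
    have jA: "j \<notin> A" using A(1) \<open>0 < x j\<close> by (auto simp: G_def)
    have "{k\<in>F. x k \<le> x j \<and> \<bar>t k - t j\<bar> \<le> x j} = F - G" using j by (auto simp: G_def)
    then have "(\<Sum>k\<in>F - G. w k) \<le> K * x j" using psubset.prems(3)[OF j(1)] by simp
    moreover have "(\<Sum>k\<in>F. w k) = (\<Sum>k\<in>F - G. w k) + (\<Sum>k\<in>G. w k)"
      using GF psubset.hyps(1) by (intro sum.subset_diff) auto
    ultimately have "(\<Sum>k\<in>F. w k) \<le> K * (\<Sum>i\<in>insert j A. x i)"
      using A(2) finA jA by (simp add: distrib_left)
    moreover have False
      if "k \<in> A" "s \<in> {t k - x k / 2 <..< t k + x k / 2}" "s \<in> {t j - x j / 2 <..< t j + x j / 2}" for k s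
    proof -
      have "x k \<le> x j" "\<bar>t k - t j\<bar> > x j" using that A(1) j GF by (auto simp: G_def)
      then show ?thesis using that by (auto simp: abs_if split: if_splits)
    qed
    then have "disjoint_family_on (\<lambda>j. {t j - x j / 2 <..< t j + x j / 2}) (insert j A)"
      using A(3) jA unfolding disjoint_family_on_insert[OF jA] by blast
    ultimately show ?thesis using A(1) j(1) GF by (intro exI[of _ "insert j A"]) auto
  qed (auto simp: disjoint_family_on_def)
qed

text \<open>
  The selected windows are disjoint intervals within an interval of length 2h, which bounds
  the sum of their lengths.
\<close>

lemma sum_le_of_window_sums:
  fixes t x w :: "'a \<Rightarrow> real"
  assumes fin: "finite F" and x: "\<And>j. j \<in> F \<Longrightarrow> 0 < x j" "\<And>j. j \<in> F \<Longrightarrow> x j \<le> h"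
    and w: "\<And>j. j \<in> F \<Longrightarrow> 0 \<le> w j"
    and win: "\<And>j. j \<in> F \<Longrightarrow> (\<Sum>k\<in>{k\<in>F. x k \<le> x j \<and> \<bar>t k - t j\<bar> \<le> x j}. w k) \<le> K * x j"
    and t: "\<And>j k. j \<in> F \<Longrightarrow> k \<in> F \<Longrightarrow> \<bar>t j - t k\<bar> \<le> h" and "0 \<le> K" "0 \<le> h"
  shows "(\<Sum>k\<in>F. w k) \<le> 2 * K * h"
proof (cases "F = {}")
  case False
  obtain A where A: "A \<subseteq> F" "(\<Sum>k\<in>F. w k) \<le> K * (\<Sum>j\<in>A. x j)"
    "disjoint_family_on (\<lambda>j. {t j - x j / 2 <..< t j + x j / 2}) A"
    using sum_le_of_disjoint_windows[of F x w t K] assms by blast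
  obtain m where m: "m \<in> F" "\<And>k. k \<in> F \<Longrightarrow> t m \<le> t k"
    using fin False by (metis arg_min_if_finite(1) arg_min_least)
  have finA: "finite A" using A fin finite_subset by blast
  have len: "measure lborel {t j - x j / 2 <..< t j + x j / 2} = x j" if "j \<in> A" for j
    using x(1)[of j] that A(1) by auto
  have "(\<Sum>j\<in>A. x j) = measure lborel (\<Union>j\<in>A. {t j - x j / 2 <..< t j + x j / 2})"
    using len by (subst measure_finite_Union[OF finA _ A(3)]) (use x(1) A(1) in \<open>auto simp: subset_iff less_imp_le\<close>)
  also have "\<dots> \<le> measure lborel {t m - h / 2 .. t m + h + h / 2}"
  proof (rule measure_mono_fmeasurable)
    show "(\<Union>j\<in>A. {t j - x j / 2 <..< t j + x j / 2}) \<subseteq> {t m - h / 2 .. t m + h + h / 2}"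
    proof
      fix s assume "s \<in> (\<Union>j\<in>A. {t j - x j / 2 <..< t j + x j / 2})"
      then obtain j where j: "j \<in> A" "t j - x j / 2 < s" "s < t j + x j / 2" by auto
      then have "j \<in> F" using A by auto
      then show "s \<in> {t m - h / 2 .. t m + h + h / 2}"
        using j m(2)[of j] x(2)[of j] t[of j m] m(1) by auto
    qed
    show "(\<Union>j\<in>A. {t j - x j / 2 <..< t j + x j / 2}) \<in> sets lborel" by (simp add: open_UN)
    show "{t m - h / 2 .. t m + h + h / 2} \<in> fmeasurable lborel" by (rule fmeasurable_compact) simp
  qed
  also have "\<dots> = 2 * h" using \<open>0 \<le> h\<close> by simp
  finally have "K * (\<Sum>j\<in>A. x j) \<le> K * (2 * h)" using \<open>0 \<le> K\<close> by (rule mult_left_mono)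
  then show ?thesis using A(2) by simp
qed (use assms in auto)

lemma norm_turn_diff_le: "norm (turn a - turn b) \<le> 2 * pi * \<bar>a - b\<bar>"
proof -
  have "turn a - turn b = turn b * (exp (\<i> * of_real (2 * pi * (a - b))) - 1)"
    by (simp add: cis_conv_exp exp_add[symmetric] algebra_simps)
  then have "norm (turn a - turn b) = 2 * \<bar>sin (pi * (a - b))\<bar>"
    by (simp only: norm_mult dist_exp_i_1) simp
  also have "\<dots> \<le> 2 * \<bar>pi * (a - b)\<bar>" using abs_sin_x_le_abs_x by simp
  finally show ?thesis by (simp add: abs_mult)
qed

lemma sin_ge_quarter:
  fixes x :: real assumes "0 \<le> x" "x \<le> pi / 2" shows "x / 4 \<le> sin x"
proof (cases "x \<le> pi / 3")
  case True
  have "sin 0 - 0 / 4 \<le> sin x - x / 4"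
  proof (rule DERIV_nonneg_imp_nondecreasing[OF assms(1)])
    fix u assume u: "0 \<le> u" "u \<le> x"
    have "cos (pi / 3) \<le> cos u" using u True by (intro cos_monotone_0_pi_le) auto
    then have "0 \<le> cos u - 1 / 4" by (simp add: cos_60)
    moreover have "((\<lambda>u. sin u - u / 4) has_real_derivative cos u - 1 / 4) (at u)"
      by (auto intro!: derivative_eq_intros)
    ultimately show "\<exists>y. ((\<lambda>u. sin u - u / 4) has_real_derivative y) (at u) \<and> 0 \<le> y" by blast
  qed
  then show ?thesis by simp
next
  case False
  have "sin (pi / 6) \<le> sin x" using False assms by (intro sin_monotone_2pi_le) auto
  then show ?thesis using assms pi_less_4 by (simp add: sin_30)
qed

text \<open>
  After reduction to a difference \<tau> of at most half a turn this is a weak form of the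
  Jordan inequality, as the chord has length 2 |sin(\<pi>\<tau>)|.
\<close>

lemma turn_diff_ge:
  obtains k :: int where "\<bar>a - b - of_int k\<bar> \<le> norm (turn a - turn b)"
proof
  define k where "k = round (a - b)"
  define \<tau> where "\<tau> = a - b - of_int k"
  have \<tau>: "\<bar>\<tau>\<bar> \<le> 1 / 2" unfolding \<tau>_def k_def using of_int_round_abs_le[of "a - b"] by (simp add: abs_minus_commute)
  have "turn a = turn (b + \<tau>)" by (auto simp: turn_eq_iff \<tau>_def intro!: exI[of _ k])
  then have "turn a - turn b = turn b * (exp (\<i> * of_real (2 * pi * \<tau>)) - 1)"
    by (simp add: cis_conv_exp exp_add[symmetric] algebra_simps)
  then have "norm (turn a - turn b) = 2 * \<bar>sin (pi * \<tau>)\<bar>"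
    by (simp only: norm_mult dist_exp_i_1) simp
  moreover have "\<bar>sin (pi * \<tau>)\<bar> = \<bar>sin (pi * \<bar>\<tau>\<bar>)\<bar>" by (simp add: abs_if)
  moreover have "pi * \<bar>\<tau>\<bar> / 4 \<le> sin (pi * \<bar>\<tau>\<bar>)"
    using \<tau> by (intro sin_ge_quarter) auto
  ultimately have "pi * \<bar>\<tau>\<bar> / 2 \<le> norm (turn a - turn b)" by linarith
  moreover have "2 * \<bar>\<tau>\<bar> \<le> pi * \<bar>\<tau>\<bar>" using pi_ge_two by (intro mult_right_mono) auto
  ultimately show "\<bar>a - b - of_int k\<bar> \<le> norm (turn a - turn b)" by (simp add: \<tau>_def)
qed

text \<open>
  The kernel of z and w is comparable to (1-|w|^2)/(1-|z|) if w lies in the box below z; the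
  constant comes from |1-(cnj z) w|\<le> (2+2\<pi>)(1-|z|) \<le> 10 (1-|z|).
\<close>

lemma disc_kernel_ge_of_close:
  assumes z: "z = of_real (norm z) * turn s" "norm z < 1" and w: "w = of_real (norm w) * turn t" "norm w < 1"
    and "1 - norm w \<le> 1 - norm z" "\<bar>t - s\<bar> \<le> 1 - norm z"
  shows "defect w \<le> 100 * (1 - norm z) * disc_kernel z w"
proof -
  let ?x = "1 - norm z"
  have x: "0 < ?x" using z by simp
  have cz: "cnj z = of_real (norm z) * cnj (turn s)"
    by (subst z(1)) (simp add: cis_cnj)
  have ss: "cnj (turn s) * turn s = 1" by (simp add: cis_cnj cis_mult)
  have eq: "1 - cnj z * w = of_real (1 - norm z * norm w) - of_real (norm z * norm w) * (cnj (turn s) * (turn t - turn s))"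
    using ss by (subst w(1), subst cz) (simp add: algebra_simps)
  have "norm (1 - cnj z * w) \<le> norm (complex_of_real (1 - norm z * norm w)) + norm (of_real (norm z * norm w) * (cnj (turn s) * (turn t - turn s)))"
    unfolding eq by (rule norm_triangle_ineq4)
  also have "norm (complex_of_real (1 - norm z * norm w)) \<le> 2 * ?x"
  proof -
    have "norm z * norm w \<le> 1" using z w by (simp add: mult_le_one)
    moreover have "1 - norm z * norm w \<le> (1 - norm z) + (1 - norm w)"
    proof -
      have "0 \<le> (1 - norm z) * (1 - norm w)" using z w by simp
      then show ?thesis by (simp add: algebra_simps)
    qed
    ultimately show ?thesis using assms(5) by (simp only: norm_of_real) simp
  qed
  also have "norm (of_real (norm z * norm w) * (cnj (turn s) * (turn t - turn s))) \<le> 8 * ?x"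
  proof -
    have "norm (turn t - turn s) \<le> 8 * ?x"
    proof -
      have "2 * pi * \<bar>t - s\<bar> \<le> 8 * ?x" using pi_less_4 assms(6) by (intro mult_mono) auto
      then show ?thesis using norm_turn_diff_le[of t s] by linarith
    qed
    moreover have "norm (of_real (norm z * norm w) * (cnj (turn s) * (turn t - turn s))) = (norm z * norm w) * norm (turn t - turn s)"
      by (simp only: norm_mult complex_mod_cnj norm_cis norm_of_real abs_norm_cancel abs_mult)
    moreover have "(norm z * norm w) * norm (turn t - turn s) \<le> norm (turn t - turn s)"
      using z w by (intro mult_left_le_one_le mult_le_one) auto
    ultimately show ?thesis by linarith
  qed
  finally have le: "norm (1 - cnj z * w) \<le> 10 * ?x" by simp
  have nz: "0 < norm (1 - cnj z * w)" using one_minus_cnj_mult_nonzero[of z w] z w by simp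
  have "(norm (1 - cnj z * w))\<^sup>2 \<le> (10 * ?x)\<^sup>2" using le by (intro power_mono) auto
  then have "?x * defect w / (10 * ?x)\<^sup>2 \<le> disc_kernel z w"
    unfolding disc_kernel_def using defect_bounds[OF z(2)] defect_pos[OF w(2)] nz
    by (intro frac_le mult_right_mono) auto
  then have "100 * ?x * (?x * defect w / (10 * ?x)\<^sup>2) \<le> 100 * ?x * disc_kernel z w"
    using x by (intro mult_left_mono) auto
  moreover have "100 * ?x * (?x * defect w / (10 * ?x)\<^sup>2) = defect w"
  proof -
  have "100 * y * (y * u / (10 * y)\<^sup>2) = u" if "y \<noteq> 0" for y u :: real
    using that by (simp add: power2_eq_square)
  from this[of ?x] x show ?thesis by (metis less_irrefl)
  qed
  ultimately show ?thesis by linarith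
qed

abbreviation box_mass :: "('a \<Rightarrow> complex) \<Rightarrow> complex set \<Rightarrow> 'a set \<Rightarrow> real" where
  "box_mass l I F \<equiv> (\<Sum>k\<in>{k\<in>F. l k \<in> carleson_box I}. defect (l k))"

text \<open>
  Discs centred on the circle play the role of Carleson boxes where angles would be a
  nuisance.
\<close>

abbreviation ball_mass :: "('a \<Rightarrow> complex) \<Rightarrow> complex \<Rightarrow> real \<Rightarrow> 'a set \<Rightarrow> real" where
  "ball_mass l \<zeta> y F \<equiv> (\<Sum>k\<in>{k\<in>F. norm (l k - \<zeta>) \<le> y}. defect (l k))"

text \<open>
  Kernel sums at the points of the family itself suffice: they control the mass in the
  window below each of its points, and the greedy selection assembles these windows.
\<close>

lemma kernel_sum_imp_box_sum:
  assumes fin: "finite F" and disc: "\<And>j. j \<in> F \<Longrightarrow> norm (l j) < 1"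
    and K: "\<And>j. j \<in> F \<Longrightarrow> (\<Sum>k\<in>F. disc_kernel (l j) (l k)) \<le> K" and "0 \<le> K"
    and I: "I \<in> carleson_arcs"
  shows "box_mass l I F \<le> 200 * K * arc_measure I"
proof -
  let ?F = "{k\<in>F. l k \<in> carleson_box I}"
  have "\<exists>A. (\<forall>p\<in>A. \<forall>q\<in>A. \<bar>p - q\<bar> \<le> arc_measure I) \<and> (\<forall>k\<in>?F. \<exists>t\<in>A. l k = of_real (norm (l k)) * turn t)"
    using I
  proof (cases rule: carleson_arc_cases)
    case 1
    have "\<exists>t\<in>{0..<1}. l k = of_real (norm (l k)) * turn t" for k
      using polar_turn[of "l k"] by (metis atLeastLessThan_iff)
    then show ?thesis using 1 by (intro exI[of _ "{0..<1}"]) (auto simp: arc_measure_circle)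
  next
    case (2 A)
    have "\<exists>t\<in>A. l k = of_real (norm (l k)) * turn t" if "k \<in> ?F" for k
      using that 2(1,2) by (auto simp: carleson_box_def norm_mult)
    then show ?thesis using 2(6) by blast
  qed
  then obtain A t where A: "\<And>p q. p \<in> A \<Longrightarrow> q \<in> A \<Longrightarrow> \<bar>p - q\<bar> \<le> arc_measure I"
    "\<And>k. k \<in> ?F \<Longrightarrow> t k \<in> A \<and> l k = of_real (norm (l k)) * turn (t k)" by metis
  have "(\<Sum>k\<in>?F. defect (l k)) \<le> 2 * (100 * K) * arc_measure I"
  proof (rule sum_le_of_window_sums[where x = "\<lambda>k. 1 - norm (l k)" and t = t])
    fix j assume j: "j \<in> ?F"
    show "0 < 1 - norm (l j)" using disc j by auto
    show "1 - norm (l j) \<le> arc_measure I" using carleson_box_height[OF I] j by auto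
    show "0 \<le> defect (l j)" using defect_pos[OF disc, of j] j by auto
    let ?N = "{k\<in>?F. 1 - norm (l k) \<le> 1 - norm (l j) \<and> \<bar>t k - t j\<bar> \<le> 1 - norm (l j)}"
    have "(\<Sum>k\<in>?N. defect (l k)) \<le> (\<Sum>k\<in>?N. 100 * (1 - norm (l j)) * disc_kernel (l j) (l k))"
      using A(2) j disc by (intro sum_mono disc_kernel_ge_of_close[where s = "t j"]) auto
    also have "\<dots> = 100 * (1 - norm (l j)) * (\<Sum>k\<in>?N. disc_kernel (l j) (l k))" by (simp add: sum_distrib_left)
    also have "(\<Sum>k\<in>?N. disc_kernel (l j) (l k)) \<le> (\<Sum>k\<in>F. disc_kernel (l j) (l k))"
      using fin j disc by (intro sum_mono2 disc_kernel_nonneg) auto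
    also have "\<dots> \<le> K" using K j by auto
    finally show "(\<Sum>k\<in>?N. defect (l k)) \<le> 100 * K * (1 - norm (l j))"
      using disc j by (simp add: mult_left_mono mult_ac)
  next
    show "\<bar>t j - t k\<bar> \<le> arc_measure I" if "j \<in> ?F" "k \<in> ?F" for j k
      using A that by blast
    show "0 \<le> arc_measure I" by (simp add: arc_measure_def)
  qed (use fin \<open>0 \<le> K\<close> in auto)
  then show ?thesis by simp
qed

text \<open>
  A point within distance y of \<zeta> has a projection to the circle within 2y, hence an
  angle within 2y turns.
\<close>

lemma disc_inter_ball_subset_box:
  assumes "norm \<zeta> = 1" "0 < y"
  obtains I where "I \<in> carleson_arcs" "arc_measure I \<le> 8 * y" "unit_disc \<inter> cball \<zeta> y \<subseteq> carleson_box I"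
proof (cases "8 * y < 1")
  case False
  then show ?thesis
    by (intro that[OF circle_in_carleson_arcs]) (auto simp: carleson_box_circle arc_measure_circle)
next
  case True
  obtain c where c: "\<zeta> = turn c" using sphere_turn[OF assms(1)] by blast
  let ?I = "turn ` {c - 4 * y..<c + 4 * y}"
  have "w \<in> carleson_box ?I" if w: "norm w < 1" "norm (w - \<zeta>) \<le> y" for w
  proof -
    obtain t where t: "w = of_real (norm w) * turn t" using polar_turn[of w] by blast
    have h: "1 - norm w \<le> y"
      using norm_triangle_ineq2[of \<zeta> w] w(2) assms(1) by (simp add: norm_minus_commute)
    have "norm (turn t - w) = 1 - norm w" by (rule norm_turn_diff_polar[OF t w(1)])
    then have "norm (turn t - turn c) \<le> 2 * y"
      using norm_triangle_ineq[of "turn t - w" "w - \<zeta>"] h w(2) c by simp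
    then obtain k :: int where k: "\<bar>t - c - of_int k\<bar> \<le> 2 * y" using turn_diff_ge[of t c] by (meson order_trans)
    have "turn t = turn (t - of_int k)" by (auto simp: turn_eq_iff intro!: exI[of _ k])
    then have "w = of_real (norm w) * turn (t - of_int k)" using t by simp
    then show ?thesis
      by (rule mem_carleson_box_half_open[rotated 2]) (use k h w True \<open>0 < y\<close> in \<open>auto simp: abs_le_iff\<close>)
  qed
  then have "unit_disc \<inter> cball \<zeta> y \<subseteq> carleson_box ?I" by (auto simp: dist_norm norm_minus_commute)
  moreover have "?I \<in> carleson_arcs" using True \<open>0 < y\<close> by (intro half_open_arc_in_carleson_arcs) auto
  moreover have "arc_measure ?I \<le> 8 * y" using True \<open>0 < y\<close> by (subst arc_measure_half_open) auto
  ultimately show ?thesis using that by blast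
qed

text \<open>
  Decomposition into dyadic shells 2^m x \<le> u \<le> 2^{m+1} x, whose contributions decay
  geometrically.
\<close>

lemma sum_divide_square_le:
  fixes u w :: "'a \<Rightarrow> real"
  assumes fin: "finite F" and w: "\<And>k. k \<in> F \<Longrightarrow> 0 \<le> w k" and u: "\<And>k. k \<in> F \<Longrightarrow> x \<le> u k" and "0 < x"
    and A: "\<And>y. 0 < y \<Longrightarrow> (\<Sum>k\<in>{k\<in>F. u k \<le> y}. w k) \<le> A * y" and "0 \<le> A"
  shows "(\<Sum>k\<in>F. w k / (u k)\<^sup>2) \<le> 4 * A / x"
proof -
  obtain M where M: "\<And>k. k \<in> F \<Longrightarrow> u k \<le> 2 ^ Suc M * x"
  proof -
    obtain M :: nat where "(\<Sum>k\<in>F. \<bar>u k\<bar>) / x < 2 ^ M" using real_arch_pow[of 2] by auto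
    then have "(\<Sum>k\<in>F. \<bar>u k\<bar>) < 2 ^ M * x" using \<open>0 < x\<close> by (simp add: divide_less_eq)
    moreover have "2 ^ Suc M * x = 2 ^ M * x + 2 ^ M * x" by simp
    moreover have "0 < 2 ^ M * x" using \<open>0 < x\<close> by simp
    ultimately have "(\<Sum>k\<in>F. \<bar>u k\<bar>) \<le> 2 ^ Suc M * x" by linarith
    moreover have "u k \<le> (\<Sum>k\<in>F. \<bar>u k\<bar>)" if "k \<in> F" for k
      using member_le_sum[OF that, of "\<lambda>k. \<bar>u k\<bar>"] fin by simp
    ultimately show ?thesis using that by (meson order_trans)
  qed
  have shell: "\<exists>m\<le>M. 2 ^ m * x \<le> v \<and> v \<le> 2 ^ Suc m * x" if "x \<le> v" "v \<le> 2 ^ Suc M * x" for v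
    using that
  proof (induction M)
    case (Suc M)
    then show ?case by (cases "v \<le> 2 ^ Suc M * x") (auto intro: le_SucI)
  qed auto
  \<comment> \<open>The bound for the m-th shell, extended to all points below its outer radius, where the
    hypothesis applies.\<close>
  let ?g = "\<lambda>m k. if u k \<le> 2 ^ Suc m * x then w k / (2 ^ m * x)\<^sup>2 else 0"
  have "w k / (u k)\<^sup>2 \<le> (\<Sum>m\<le>M. ?g m k)" if k: "k \<in> F" for k
  proof -
    obtain m where m: "m \<le> M" "2 ^ m * x \<le> u k" "u k \<le> 2 ^ Suc m * x" using shell[OF u[OF k] M[OF k]] by blast
    have "w k / (u k)\<^sup>2 \<le> w k / (2 ^ m * x)\<^sup>2"
    proof (intro divide_left_mono mult_pos_pos zero_less_power w k power_mono m)
      have "0 < 2 ^ m * x" using \<open>0 < x\<close> by simp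
      then show "0 < u k" using m(2) by linarith
    qed (use \<open>0 < x\<close> in auto)
    also have "\<dots> = ?g m k" using m by simp
    also have "\<dots> \<le> (\<Sum>m\<le>M. ?g m k)" using m(1) w[OF k] by (intro member_le_sum) auto
    finally show ?thesis .
  qed
  then have "(\<Sum>k\<in>F. w k / (u k)\<^sup>2) \<le> (\<Sum>k\<in>F. \<Sum>m\<le>M. ?g m k)" by (rule sum_mono)
  also have "\<dots> = (\<Sum>m\<le>M. \<Sum>k\<in>F. ?g m k)" by (rule sum.swap)
  also have "\<dots> \<le> (\<Sum>m\<le>M. 2 * A / x * (1 / 2) ^ m)"
  proof (rule sum_mono)
    fix m
    have "(\<Sum>k\<in>F. ?g m k) = (\<Sum>k\<in>{k\<in>F. u k \<le> 2 ^ Suc m * x}. w k / (2 ^ m * x)\<^sup>2)"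
      using fin by (simp only: sum.inter_filter)
    also have "\<dots> = (\<Sum>k\<in>{k\<in>F. u k \<le> 2 ^ Suc m * x}. w k) / (2 ^ m * x)\<^sup>2" by (simp only: sum_divide_distrib)
    also have "\<dots> \<le> A * (2 ^ Suc m * x) / (2 ^ m * x)\<^sup>2"
      using A[of "2 ^ Suc m * x"] \<open>0 < x\<close> by (intro divide_right_mono) auto
    also have "\<dots> = 2 * A / x * (1 / 2) ^ m"
      using \<open>0 < x\<close> by (simp add: power2_eq_square field_simps power_one_over)
    finally show "(\<Sum>k\<in>F. ?g m k) \<le> 2 * A / x * (1 / 2) ^ m" .
  qed
  also have "\<dots> = 2 * A / x * (\<Sum>m\<le>M. (1 / 2) ^ m)" by (simp add: sum_distrib_left)
  also have "\<dots> \<le> 2 * A / x * 2"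
    by (rule mult_left_mono[OF sum_half_powers_le]) (use \<open>0 \<le> A\<close> \<open>0 < x\<close> in simp_all)
  finally show ?thesis by simp
qed

text \<open>
  With z = |z|\<zeta>, the number |1-(cnj z) w| is at least half the distance from w to
  \<zeta>; hence its sublevel sets lie in discs centred at \<zeta>.
\<close>

lemma ball_sum_imp_kernel_sum:
  assumes fin: "finite F" and disc: "\<And>k. k \<in> F \<Longrightarrow> norm (l k) < 1"
    and A: "\<And>\<zeta> y. norm \<zeta> = 1 \<Longrightarrow> 0 < y \<Longrightarrow> ball_mass l \<zeta> y F \<le> A * y"
    and "0 \<le> A" "norm z < 1"
  shows "(\<Sum>k\<in>F. disc_kernel z (l k)) \<le> 16 * A"
proof -
  obtain s where s: "z = of_real (norm z) * turn s" using polar_turn[of z] by blast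
  let ?x = "1 - norm z" and ?u = "\<lambda>k. norm (1 - cnj z * l k)" and ?w = "\<lambda>k. defect (l k)"
  have x: "0 < ?x" using assms by simp
  have near: "norm (w - turn s) \<le> 2 * norm (1 - cnj z * w)" if w: "norm w < 1" for w
  proof -
    have "norm (w - turn s) = norm (1 - cnj (turn s) * w)"
    proof -
      have "w - turn s = - turn s * (1 - cnj (turn s) * w)" by (simp add: algebra_simps cis_cnj cis_mult)
      then show ?thesis by (simp only: norm_mult norm_minus_cancel norm_cis mult_1)
    qed
    also have "\<dots> = norm ((1 - cnj z * w) - (cnj (turn s) - cnj z) * w)" by (simp add: algebra_simps)
    also have "\<dots> \<le> norm (1 - cnj z * w) + norm ((cnj (turn s) - cnj z) * w)" by (rule norm_triangle_ineq4)
    also have "norm ((cnj (turn s) - cnj z) * w) \<le> norm (cnj (turn s) - cnj z)"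
      using w by (simp add: norm_mult mult_right_le_one_le)
    also have "norm (cnj (turn s) - cnj z) = norm (turn s - z)" by (metis complex_cnj_diff complex_mod_cnj)
    also have "norm (turn s - z) = ?x" by (rule norm_turn_diff_polar[OF s assms(5)])
    also have "?x \<le> norm (1 - cnj z * w)"
      using norm_one_minus_cnj_mult_ge[of w z] w by (simp add: norm_one_minus_cnj_mult_commute[of z w])
    finally show ?thesis by simp
  qed
  have "(\<Sum>k\<in>F. ?w k / (?u k)\<^sup>2) \<le> 4 * (2 * A) / ?x"
  proof (rule sum_divide_square_le[OF fin])
    fix y :: real assume "0 < y"
    have "(\<Sum>k\<in>{k\<in>F. ?u k \<le> y}. ?w k) \<le> (\<Sum>k\<in>{k\<in>F. norm (l k - turn s) \<le> 2 * y}. ?w k)"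
    proof (rule sum_mono2)
      show "{k\<in>F. ?u k \<le> y} \<subseteq> {k\<in>F. norm (l k - turn s) \<le> 2 * y}" using near disc by fastforce
    qed (use fin disc defect_pos in \<open>auto intro: less_imp_le\<close>)
    also have "\<dots> \<le> A * (2 * y)" using A[of "turn s" "2 * y"] \<open>0 < y\<close> by simp
    finally show "(\<Sum>k\<in>{k\<in>F. ?u k \<le> y}. ?w k) \<le> 2 * A * y" by simp
  next
    fix k assume "k \<in> F"
    then show "?x \<le> ?u k" using norm_one_minus_cnj_mult_ge[of "l k" z] disc[of k]
      by (simp add: norm_one_minus_cnj_mult_commute[of z])
    show "0 \<le> ?w k" using defect_pos[OF disc[OF \<open>k \<in> F\<close>]] by simp
  qed (use x \<open>0 \<le> A\<close> in auto)
  then have "defect z * (\<Sum>k\<in>F. ?w k / (?u k)\<^sup>2) \<le> (2 * ?x) * (4 * (2 * A) / ?x)"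
    using defect_bounds[OF assms(5)] x \<open>0 \<le> A\<close> defect_pos disc
    by (intro mult_mono sum_nonneg divide_nonneg_nonneg) (auto intro: less_imp_le)
  moreover have "(\<Sum>k\<in>F. disc_kernel z (l k)) = defect z * (\<Sum>k\<in>F. ?w k / (?u k)\<^sup>2)"
    by (simp add: disc_kernel_def sum_distrib_left)
  moreover have "(2 * ?x) * (4 * (2 * A) / ?x) = 16 * A"
  proof -
    have "(2 * y) * (4 * (2 * A) / y) = 16 * A" if "y \<noteq> 0" for y :: real using that by simp
    from this[of ?x] x show ?thesis by (metis less_irrefl)
  qed
  ultimately show ?thesis by simp
qed

lemma carleson_sequence_box_sum:
  assumes "carleson_sequence J l"
  obtains C where "0 \<le> C" "\<And>F I. finite F \<Longrightarrow> F \<subseteq> J \<Longrightarrow> I \<in> carleson_arcs \<Longrightarrow>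
    box_mass l I F \<le> C * arc_measure I"
proof -
  obtain K where K: "\<And>j F. j \<in> J \<Longrightarrow> finite F \<Longrightarrow> F \<subseteq> J \<Longrightarrow> (\<Sum>k\<in>F. disc_kernel (l j) (l k)) \<le> K"
    using carleson_sequence_necessary(2)[OF assms] unfolding kernel_bounded_def by metis
  have disc: "norm (l j) < 1" if "j \<in> J" for j using assms that by (auto simp: carleson_sequence_def)
  show ?thesis
  proof (rule that[of "200 * max K 0"])
    fix F I assume "finite F" "F \<subseteq> J" "I \<in> carleson_arcs"
    then show "box_mass l I F \<le> 200 * max K 0 * arc_measure I"
      by (intro kernel_sum_imp_box_sum) (use K disc in \<open>auto intro: order_trans[OF K]\<close>)
  qed auto
qed

lemma carleson_sequenceI_ball_sum:
  assumes l: "l ` J \<subseteq> unit_disc" and "separated J l" and "0 \<le> A"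
    and A: "\<And>F \<zeta> y. finite F \<Longrightarrow> F \<subseteq> J \<Longrightarrow> norm \<zeta> = 1 \<Longrightarrow> 0 < y \<Longrightarrow>
      ball_mass l \<zeta> y F \<le> A * y"
  shows "carleson_sequence J l"
proof (rule carleson_sequence_sufficient[OF l])
  show "kernel_bounded J l" unfolding kernel_bounded_def
  proof (intro exI[of _ "16 * A"] ballI allI impI)
    fix j F assume "j \<in> J" "finite F" "F \<subseteq> J"
    then show "(\<Sum>k\<in>F. disc_kernel (l j) (l k)) \<le> 16 * A"
      using l \<open>0 \<le> A\<close> A by (intro ball_sum_imp_kernel_sum) (auto simp: image_subset_iff subset_iff)
  qed
qed fact

lemma carleson_sequenceI_box_sum:
  assumes l: "l ` J \<subseteq> unit_disc" and "separated J l" and "0 \<le> C"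
    and C: "\<And>F I. finite F \<Longrightarrow> F \<subseteq> J \<Longrightarrow> I \<in> carleson_arcs \<Longrightarrow>
      box_mass l I F \<le> C * arc_measure I"
  shows "carleson_sequence J l"
proof (rule carleson_sequenceI_ball_sum[OF l assms(2), of "8 * C"])
  fix F and \<zeta> :: complex and y :: real assume F: "finite F" "F \<subseteq> J" and "norm \<zeta> = 1" "0 < y"
  then obtain I where I: "I \<in> carleson_arcs" "arc_measure I \<le> 8 * y" "unit_disc \<inter> cball \<zeta> y \<subseteq> carleson_box I"
    by (rule_tac disc_inter_ball_subset_box)
  have "ball_mass l \<zeta> y F \<le> box_mass l I F"
  proof (rule sum_mono2)
    show "{k\<in>F. norm (l k - \<zeta>) \<le> y} \<subseteq> {k\<in>F. l k \<in> carleson_box I}"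
      using I(3) F l by (auto simp: dist_norm norm_minus_commute subset_iff)
    show "0 \<le> defect (l k)" if "k \<in> {k\<in>F. l k \<in> carleson_box I} - {k\<in>F. norm (l k - \<zeta>) \<le> y}" for k
      using defect_pos[of "l k"] that F l by (auto intro: less_imp_le simp: image_subset_iff)
  qed (use F in auto)
  also have "\<dots> \<le> C * arc_measure I" using C F I by blast
  also have "\<dots> \<le> C * (8 * y)" using I(2) \<open>0 \<le> C\<close> by (rule mult_left_mono)
  finally show "ball_mass l \<zeta> y F \<le> 8 * C * y" by simp
qed (use \<open>0 \<le> C\<close> in simp)

section \<open>Bounded pushforwards preserve interpolating sequences\<close>

text \<open>
  The measure \<Sum>_j (1-|l_j|^2) \<delta>(l_j), with repeated points counted repeatedly.
\<close>

definition sequence_measure :: "nat set \<Rightarrow> (nat \<Rightarrow> complex) \<Rightarrow> complex measure" where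
  "sequence_measure J l = distr (density (count_space J) (\<lambda>j. ennreal (defect (l j)))) disc_borel l"

lemma space_disc_borel [simp]: "space disc_borel = unit_disc"
  by (simp add: space_restrict_space)

lemma sets_sequence_measure [simp]: "sets (sequence_measure J l) = sets disc_borel"
  by (simp add: sequence_measure_def)

lemma nn_integral_sequence_measure:
  assumes "l ` J \<subseteq> unit_disc" "f \<in> borel_measurable disc_borel"
  shows "(\<integral>\<^sup>+z. f z \<partial>sequence_measure J l) = (\<integral>\<^sup>+j. ennreal (defect (l j)) * f (l j) \<partial>count_space J)"
proof -
  have l: "l \<in> measurable (density (count_space J) (\<lambda>j. ennreal (defect (l j)))) disc_borel"
    using assms(1) by (subst measurable_cong_sets[OF sets_density refl]) auto
  have "(\<integral>\<^sup>+z. f z \<partial>sequence_measure J l)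
      = (\<integral>\<^sup>+j. f (l j) \<partial>density (count_space J) (\<lambda>j. ennreal (defect (l j))))"
    unfolding sequence_measure_def by (rule nn_integral_distr[OF l]) (use assms(2) in simp)
  also have "\<dots> = (\<integral>\<^sup>+j. ennreal (defect (l j)) * f (l j) \<partial>count_space J)"
    by (rule nn_integral_density) auto
  finally show ?thesis .
qed

text \<open>
  The integral is the supremum of the sums over finite subsets.
\<close>

lemma nn_integral_count_space_nat_le:
  fixes g :: "nat \<Rightarrow> ennreal"
  assumes "\<And>F. finite F \<Longrightarrow> F \<subseteq> J \<Longrightarrow> (\<Sum>j\<in>F. g j) \<le> c"
  shows "(\<integral>\<^sup>+j. g j \<partial>count_space J) \<le> c"
proof -
  have "(\<integral>\<^sup>+j. g j \<partial>count_space J) = (\<integral>\<^sup>+j. (if j \<in> J then g j else 0) \<partial>count_space UNIV)"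
    by (subst nn_integral_count_space_indicator) (auto intro!: nn_integral_cong simp: NO_MATCH_def)
  also have "\<dots> = (\<Sum>j. if j \<in> J then g j else 0)" by (rule nn_integral_count_space_nat)
  also have "\<dots> \<le> c"
  proof (rule suminf_le_const)
    fix n
    have "(\<Sum>j<n. if j \<in> J then g j else 0) = (\<Sum>j\<in>{..<n} \<inter> J. g j)"
      by (simp add: sum.inter_restrict)
    then show "(\<Sum>j<n. if j \<in> J then g j else 0) \<le> c" using assms[of "{..<n} \<inter> J"] by simp
  qed auto
  finally show ?thesis .
qed

lemma sum_le_nn_integral_count_space:
  fixes g :: "'a \<Rightarrow> ennreal"
  assumes "finite F" "F \<subseteq> J"
  shows "(\<Sum>j\<in>F. g j) \<le> (\<integral>\<^sup>+j. g j \<partial>count_space J)"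
proof -
  have "(\<Sum>j\<in>F. g j) = (\<integral>\<^sup>+j. g j * indicator F j \<partial>count_space J)"
    using assms by (subst nn_integral_count_space'[of F]) auto
  also have "\<dots> \<le> (\<integral>\<^sup>+j. g j \<partial>count_space J)"
    by (intro nn_integral_mono) (auto simp: indicator_def)
  finally show ?thesis .
qed

lemma carleson_arc_measure_pos: "I \<in> carleson_arcs \<Longrightarrow> 0 < arc_measure I"
  by (simp add: carleson_arcs_def)

text \<open>
  Quotients of extended nonnegative reals are awkward; all later estimates use this form
  without division.
\<close>

lemma carleson_norm_le_iff:
  "carleson_norm \<mu> \<le> c \<longleftrightarrow> (\<forall>I\<in>carleson_arcs. emeasure \<mu> (carleson_box I) \<le> c * ennreal (arc_measure I))"
proof -
  have "emeasure \<mu> (carleson_box I) / ennreal (arc_measure I) \<le> c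
      \<longleftrightarrow> emeasure \<mu> (carleson_box I) \<le> c * ennreal (arc_measure I)" if "I \<in> carleson_arcs" for I
    using carleson_arc_measure_pos[OF that]
    by (cases "emeasure \<mu> (carleson_box I)"; cases c)
       (auto simp: divide_ennreal ennreal_mult[symmetric] ennreal_le_iff field_simps ennreal_top_mult ennreal_top_divide top_unique)
  then show ?thesis unfolding carleson_norm_def by (auto simp: SUP_le_iff)
qed

lemma emeasure_carleson_box_le:
  "I \<in> carleson_arcs \<Longrightarrow> emeasure \<mu> (carleson_box I) \<le> carleson_norm \<mu> * ennreal (arc_measure I)"
  using carleson_norm_le_iff[of \<mu> "carleson_norm \<mu>"] by blast

lemma sum_ennreal_indicator:
  assumes "finite F" "\<And>j. j \<in> F \<Longrightarrow> 0 \<le> g j"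
  shows "(\<Sum>j\<in>F. ennreal (g j) * indicator S (l j)) = ennreal (\<Sum>j\<in>{j\<in>F. l j \<in> S}. g j)"
proof -
  have "(\<Sum>j\<in>F. ennreal (g j) * indicator S (l j)) = (\<Sum>j\<in>F. if l j \<in> S then ennreal (g j) else 0)"
    by (intro sum.cong) auto
  also have "\<dots> = (\<Sum>j\<in>{j\<in>F. l j \<in> S}. ennreal (g j))" using assms(1) by (simp only: sum.inter_filter)
  also have "\<dots> = ennreal (\<Sum>j\<in>{j\<in>F. l j \<in> S}. g j)" using assms(2) by (intro sum_ennreal) auto
  finally show ?thesis .
qed

lemma sequence_measure_carleson:
  assumes "carleson_sequence J l"
  shows "positive_carleson_measure (sequence_measure J l)"
proof -
  have l: "l ` J \<subseteq> unit_disc" using assms by (simp add: carleson_sequence_def)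
  have pos: "0 \<le> defect (l j)" if "j \<in> J" for j
    using defect_pos[of "l j"] l that by (auto simp: image_subset_iff intro: less_imp_le)
  obtain C where C: "0 \<le> C" "\<And>F I. finite F \<Longrightarrow> F \<subseteq> J \<Longrightarrow> I \<in> carleson_arcs \<Longrightarrow>
    box_mass l I F \<le> C * arc_measure I"
    using carleson_sequence_box_sum[OF assms] by blast
  have "emeasure (sequence_measure J l) (carleson_box I) \<le> ennreal C * ennreal (arc_measure I)"
    if I: "I \<in> carleson_arcs" for I
  proof -
    have S: "carleson_box I \<in> sets disc_borel" by (rule carleson_box_measurable[OF I])
    have "emeasure (sequence_measure J l) (carleson_box I) = (\<integral>\<^sup>+z. indicator (carleson_box I) z \<partial>sequence_measure J l)"
      using S by simp
    also have "\<dots> = (\<integral>\<^sup>+j. ennreal (defect (l j)) * indicator (carleson_box I) (l j) \<partial>count_space J)"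
      by (rule nn_integral_sequence_measure[OF l]) (use S in simp)
    also have "\<dots> \<le> ennreal (C * arc_measure I)"
    proof (rule nn_integral_count_space_nat_le)
      fix F assume F: "finite F" "F \<subseteq> J"
      have "(\<Sum>j\<in>F. ennreal (defect (l j)) * indicator (carleson_box I) (l j))
          = ennreal (box_mass l I F)"
        using F pos by (intro sum_ennreal_indicator) auto
      also have "\<dots> \<le> ennreal (C * arc_measure I)" using C(2)[OF F I] by (rule ennreal_leI)
      finally show "(\<Sum>j\<in>F. ennreal (defect (l j)) * indicator (carleson_box I) (l j)) \<le> ennreal (C * arc_measure I)" .
    qed
    finally show ?thesis using C(1) carleson_arc_measure_pos[OF I] by (simp add: ennreal_mult)
  qed
  then have "carleson_norm (sequence_measure J l) \<le> ennreal C" by (simp add: carleson_norm_le_iff)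
  then show ?thesis by (auto simp: positive_carleson_measure_def intro: le_less_trans)
qed

lemma borel_measurable_disc:
  fixes f :: "complex \<Rightarrow> 'b :: topological_space"
  assumes "continuous_on unit_disc f" shows "f \<in> borel_measurable disc_borel"
  using borel_measurable_continuous_on_restrict[OF assms] .

lemma disc_map_measurable:
  assumes "continuous_on unit_disc \<Phi>" "\<Phi> ` unit_disc \<subseteq> unit_disc"
  shows "\<Phi> \<in> measurable disc_borel disc_borel"
  by (rule measurable_restrict_space2) (use assms in \<open>auto intro: borel_measurable_disc\<close>)

lemma conformal_weight_measurable:
  assumes "continuous_on unit_disc \<Phi>"
  shows "(\<lambda>z. ennreal (conformal_weight \<Phi> z)) \<in> borel_measurable disc_borel"
proof -
  have "conformal_weight \<Phi> \<in> borel_measurable disc_borel"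
    unfolding conformal_weight_def[abs_def]
  proof (rule borel_measurable_disc, intro continuous_intros assms ballI)
    fix z assume "z \<in> unit_disc"
    then show "defect z \<noteq> 0" using defect_pos[of z] by simp
  qed
  then show ?thesis by simp
qed

lemma emeasure_weighted_pushforward:
  assumes \<Phi>: "continuous_on unit_disc \<Phi>" "\<Phi> ` unit_disc \<subseteq> unit_disc"
    and \<mu>: "sets \<mu> = sets disc_borel" and E: "E \<in> sets disc_borel"
  shows "emeasure (weighted_pushforward \<Phi> \<mu>) E = (\<integral>\<^sup>+z. ennreal (conformal_weight \<Phi> z) * indicator E (\<Phi> z) \<partial>\<mu>)"
proof -
  note [measurable_cong] = \<mu>
  note [measurable] = disc_map_measurable[OF \<Phi>] conformal_weight_measurable[OF \<Phi>(1)]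
  have sp: "space \<mu> = unit_disc" using sets_eq_imp_space_eq[OF \<mu>] by simp
  have "emeasure (weighted_pushforward \<Phi> \<mu>) E = (\<integral>\<^sup>+z. indicator E z \<partial>weighted_pushforward \<Phi> \<mu>)"
    using E by (simp add: weighted_pushforward_def)
  also have "\<dots> = (\<integral>\<^sup>+z. indicator E (\<Phi> z) \<partial>density \<mu> (\<lambda>z. ennreal (conformal_weight \<Phi> z)))"
    unfolding weighted_pushforward_def using E by (intro nn_integral_distr) (simp_all, measurable)
  also have "\<dots> = (\<integral>\<^sup>+z. ennreal (conformal_weight \<Phi> z) * indicator E (\<Phi> z) \<partial>\<mu>)"
  proof (rule nn_integral_density)
    show "(\<lambda>z. ennreal (conformal_weight \<Phi> z)) \<in> borel_measurable \<mu>"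
      using conformal_weight_measurable[OF \<Phi>(1)] by (simp only: measurable_cong_sets[OF \<mu> refl])
    show "(\<lambda>z. indicator E (\<Phi> z) :: ennreal) \<in> borel_measurable \<mu>"
      using measurable_compose[OF disc_map_measurable[OF \<Phi>] borel_measurable_indicator[OF E]]
      by (simp only: measurable_cong_sets[OF \<mu> refl])
  qed
  finally show ?thesis .
qed

lemma carleson_sequence_cong:
  assumes "\<And>j. j \<in> J \<Longrightarrow> l j = m j" "carleson_sequence J l"
  shows "carleson_sequence J m"
  using assms unfolding carleson_sequence_def by (auto simp: image_subset_iff)

text \<open>
  Separation of the images is the uniform continuity of the inverse, and their Carleson
  condition is the boundedness of the pushforward on the measure of the sequence.
\<close>

lemma carleson_sequence_pushforward:
  assumes \<Phi>: "continuous_on unit_disc \<Phi>" "\<Phi> ` unit_disc \<subseteq> unit_disc"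
    and \<Psi>: "pseudohyperbolic_uniformly_continuous \<Psi>" "\<And>z. norm z < 1 \<Longrightarrow> \<Psi> (\<Phi> z) = z"
    and C: "\<And>\<mu>. positive_carleson_measure \<mu> \<Longrightarrow>
       carleson_norm (weighted_pushforward \<Phi> \<mu>) \<le> ennreal C * carleson_norm \<mu>"
    and l: "carleson_sequence J l"
  shows "carleson_sequence J (\<Phi> \<circ> l)"
proof -
  have lJ: "l ` J \<subseteq> unit_disc" using l by (simp add: carleson_sequence_def)
  have disc: "norm (l j) < 1" "norm (\<Phi> (l j)) < 1" if "j \<in> J" for j
    using lJ \<Phi>(2) that by (auto simp: image_subset_iff)
  let ?\<mu> = "sequence_measure J l"
  define N where "N = enn2real (ennreal C * carleson_norm ?\<mu>)"
  have fin: "ennreal C * carleson_norm ?\<mu> < \<infinity>"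
    using sequence_measure_carleson[OF l] by (simp add: positive_carleson_measure_def ennreal_mult_less_top)
  show ?thesis
  proof (rule carleson_sequenceI_box_sum)
    show "(\<Phi> \<circ> l) ` J \<subseteq> unit_disc" using disc by auto
    obtain s where s: "0 < s" "\<And>j k. j \<in> J \<Longrightarrow> k \<in> J \<Longrightarrow> j \<noteq> k \<Longrightarrow> s \<le> pseudohyperbolic (l j) (l k)"
      using carleson_sequence_necessary(1)[OF l] unfolding separated_def by blast
    obtain d where d: "0 < d" "\<And>z w. norm z < 1 \<Longrightarrow> norm w < 1 \<Longrightarrow> pseudohyperbolic z w < d \<Longrightarrow> pseudohyperbolic (\<Psi> z) (\<Psi> w) < s"
      using \<Psi>(1) s(1) unfolding pseudohyperbolic_uniformly_continuous_def by (metis mem_ball_0)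
    have "d \<le> pseudohyperbolic (\<Phi> (l j)) (\<Phi> (l k))" if "j \<in> J" "k \<in> J" "j \<noteq> k" for j k
      using d(2)[of "\<Phi> (l j)" "\<Phi> (l k)"] s(2)[OF that] disc that \<Psi>(2) by (metis not_le)
    then show "separated J (\<Phi> \<circ> l)" unfolding separated_def using d(1) by auto
    show "0 \<le> N" by (simp add: N_def)
    fix F I assume F: "finite F" "F \<subseteq> J" and I: "I \<in> carleson_arcs"
    let ?S = "carleson_box I"
    have S: "?S \<in> sets disc_borel" by (rule carleson_box_measurable[OF I])
    note [measurable] = disc_map_measurable[OF \<Phi>] conformal_weight_measurable[OF \<Phi>(1)]
    have w: "ennreal (defect (l j)) * ennreal (conformal_weight \<Phi> (l j)) = ennreal (defect (\<Phi> (l j)))"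
      if "j \<in> J" for j
    proof -
      have "0 < defect (l j)" "0 < defect (\<Phi> (l j))"
        using disc[OF that] defect_pos by blast+
      then show ?thesis by (simp add: conformal_weight_def ennreal_mult'[symmetric])
    qed
    have pos: "0 \<le> defect (\<Phi> (l j))" if "j \<in> F" for j
      using defect_pos[of "\<Phi> (l j)"] disc that F by (auto intro: less_imp_le)
    have "ennreal (box_mass (\<Phi> \<circ> l) I F)
        = (\<Sum>j\<in>F. ennreal (defect (\<Phi> (l j))) * indicator ?S (\<Phi> (l j)))"
      using sum_ennreal_indicator[OF F(1), of "\<lambda>j. defect (\<Phi> (l j))" ?S "\<lambda>j. \<Phi> (l j)"] pos by simp
    also have "\<dots> = (\<Sum>j\<in>F. ennreal (defect (l j)) * (ennreal (conformal_weight \<Phi> (l j)) * indicator ?S (\<Phi> (l j))))"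
      using w F by (intro sum.cong refl) (auto simp: mult.assoc[symmetric])
    also have "\<dots> \<le> (\<integral>\<^sup>+j. ennreal (defect (l j)) * (ennreal (conformal_weight \<Phi> (l j)) * indicator ?S (\<Phi> (l j))) \<partial>count_space J)"
      by (rule sum_le_nn_integral_count_space[OF F])
    also have "\<dots> = (\<integral>\<^sup>+z. ennreal (conformal_weight \<Phi> z) * indicator ?S (\<Phi> z) \<partial>?\<mu>)"
      by (rule nn_integral_sequence_measure[OF lJ, symmetric]) (use S in measurable)
    also have "\<dots> = emeasure (weighted_pushforward \<Phi> ?\<mu>) ?S"
      by (rule emeasure_weighted_pushforward[OF \<Phi> _ S, symmetric]) simp
    also have "\<dots> \<le> carleson_norm (weighted_pushforward \<Phi> ?\<mu>) * ennreal (arc_measure I)"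
      by (rule emeasure_carleson_box_le[OF I])
    also have "\<dots> \<le> (ennreal C * carleson_norm ?\<mu>) * ennreal (arc_measure I)"
      by (intro mult_right_mono C sequence_measure_carleson l) simp
    also have "\<dots> = ennreal (N * arc_measure I)"
      using fin carleson_arc_measure_pos[OF I] by (simp add: N_def ennreal_mult)
    finally show "box_mass (\<Phi> \<circ> l) I F \<le> N * arc_measure I"
      using carleson_arc_measure_pos[OF I] by (subst (asm) ennreal_le_iff) (auto simp: N_def)
  qed
qed

lemma carleson_preserving_of_bounded:
  assumes \<Phi>: "continuous_on unit_disc \<Phi>" "\<Phi> ` unit_disc \<subseteq> unit_disc"
    and hom: "homeomorphism unit_disc unit_disc \<Phi> \<Psi>"
    and uc: "pseudohyperbolic_uniformly_continuous \<Phi>" "pseudohyperbolic_uniformly_continuous \<Psi>"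
    and C: "\<And>\<mu>. positive_carleson_measure \<mu> \<Longrightarrow>
       carleson_norm (weighted_pushforward \<Phi> \<mu>) \<le> ennreal C * carleson_norm \<mu>"
       "\<And>\<mu>. positive_carleson_measure \<mu> \<Longrightarrow>
       carleson_norm (weighted_pushforward \<Psi> \<mu>) \<le> ennreal C * carleson_norm \<mu>"
  shows "carleson_preserving \<Phi>"
  unfolding carleson_preserving_def
proof (intro allI impI iffI)
  fix J and l :: "nat \<Rightarrow> complex" assume l: "l ` J \<subseteq> unit_disc"
  have inv: "\<And>z. norm z < 1 \<Longrightarrow> \<Psi> (\<Phi> z) = z" "\<And>z. norm z < 1 \<Longrightarrow> \<Phi> (\<Psi> z) = z"
    and \<Psi>: "continuous_on unit_disc \<Psi>" "\<Psi> ` unit_disc \<subseteq> unit_disc"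
    using hom by (auto simp: homeomorphism_def)
  show "carleson_sequence J (\<Phi> \<circ> l)" if "carleson_sequence J l"
    by (rule carleson_sequence_pushforward[OF \<Phi> uc(2) inv(1) C(1) that])
  assume cs: "carleson_sequence J (\<Phi> \<circ> l)"
  have "carleson_sequence J (\<Psi> \<circ> (\<Phi> \<circ> l))"
    by (rule carleson_sequence_pushforward[OF \<Psi> uc(1) inv(2) C(2) cs])
  then show "carleson_sequence J l"
    by (rule carleson_sequence_cong[rotated]) (use l inv(1) in \<open>auto simp: image_subset_iff\<close>)
qed

section \<open>A uniform estimate on separated families of points\<close>

text \<open>
  Finite sets with fixed constants of separation and of the Carleson condition. In contrast
  to an interpolating sequence, such a set carries quantitative information.
\<close>

definition carleson_family :: "real \<Rightarrow> real \<Rightarrow> complex set \<Rightarrow> bool" where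
  "carleson_family s K F \<longleftrightarrow> finite F \<and> F \<subseteq> unit_disc \<and>
     (\<forall>z\<in>F. \<forall>w\<in>F. z \<noteq> w \<longrightarrow> s \<le> pseudohyperbolic z w) \<and>
     (\<forall>\<zeta> y. norm \<zeta> = 1 \<longrightarrow> 0 < y \<longrightarrow> ball_mass (\<lambda>z. z) \<zeta> y F \<le> K * y)"

lemma carleson_familyD:
  assumes "carleson_family s K F"
  shows "finite F" "F \<subseteq> unit_disc" "\<And>z. z \<in> F \<Longrightarrow> norm z < 1"
    "\<And>z w. z \<in> F \<Longrightarrow> w \<in> F \<Longrightarrow> z \<noteq> w \<Longrightarrow> s \<le> pseudohyperbolic z w"
    "\<And>\<zeta> y. norm \<zeta> = 1 \<Longrightarrow> 0 < y \<Longrightarrow> ball_mass (\<lambda>z. z) \<zeta> y F \<le> K * y"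
  using assms unfolding carleson_family_def by (blast, blast, force, blast, blast)

lemma carleson_family_subset:
  assumes F: "carleson_family s K F" and "G \<subseteq> F" shows "carleson_family s K G"
  unfolding carleson_family_def
proof (intro conjI allI ballI impI)
  show "finite G" using carleson_familyD(1)[OF F] assms(2) by (rule finite_subset[rotated])
  show "G \<subseteq> unit_disc" using carleson_familyD(2)[OF F] assms(2) by blast
  show "s \<le> pseudohyperbolic z w" if "z \<in> G" "w \<in> G" "z \<noteq> w" for z w using carleson_familyD(4)[OF F] assms(2) that by blast
  fix \<zeta> :: complex and y :: real assume y: "norm \<zeta> = 1" "0 < y"
  have "ball_mass (\<lambda>z. z) \<zeta> y G \<le> ball_mass (\<lambda>z. z) \<zeta> y F"
  proof (rule sum_mono2)
    fix z assume "z \<in> {z\<in>F. norm (z - \<zeta>) \<le> y} - {z\<in>G. norm (z - \<zeta>) \<le> y}"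
    then have "norm z < 1" using carleson_familyD(3)[OF F] by blast
    then show "0 \<le> defect z" by (rule defect_nonneg)
  qed (use carleson_familyD(1)[OF F] assms(2) in auto)
  also have "\<dots> \<le> K * y" by (rule carleson_familyD(5)[OF F y])
  finally show "ball_mass (\<lambda>z. z) \<zeta> y G \<le> K * y" .
qed

lemma carleson_family_mass_le:
  assumes "carleson_family s K F" shows "(\<Sum>z\<in>F. defect z) \<le> 2 * K"
proof -
  have "norm (z - 1) \<le> 2" if "z \<in> F" for z
    using carleson_familyD(3)[OF assms that] norm_triangle_ineq4[of z 1] by simp
  then have "{z\<in>F. norm (z - 1) \<le> 2} = F" by auto
  moreover have "(\<Sum>z\<in>{z\<in>F. norm (z - 1) \<le> 2}. defect z) \<le> K * 2"
    by (rule carleson_familyD(5)[OF assms]) auto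
  ultimately show ?thesis by simp
qed

lemma sum_UN_le:
  fixes f :: "'b \<Rightarrow> real"
  assumes "finite I" "\<And>i. i \<in> I \<Longrightarrow> finite (A i)" "\<And>i x. i \<in> I \<Longrightarrow> x \<in> A i \<Longrightarrow> 0 \<le> f x"
  shows "(\<Sum>x\<in>(\<Union>i\<in>I. A i). f x) \<le> (\<Sum>i\<in>I. \<Sum>x\<in>A i. f x)"
  using assms
proof (induction I rule: finite_induct)
  case (insert i I)
  have "(\<Sum>x\<in>A i \<union> (\<Union>i\<in>I. A i). f x) \<le> (\<Sum>x\<in>A i. f x) + (\<Sum>x\<in>(\<Union>i\<in>I. A i). f x)"
  proof -
    have "(\<Sum>x\<in>A i \<union> (\<Union>i\<in>I. A i). f x) = (\<Sum>x\<in>A i. f x) + (\<Sum>x\<in>(\<Union>i\<in>I. A i). f x) - (\<Sum>x\<in>A i \<inter> (\<Union>i\<in>I. A i). f x)"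
      using insert by (intro sum_Un) auto
    moreover have "0 \<le> (\<Sum>x\<in>A i \<inter> (\<Union>i\<in>I. A i). f x)" using insert.prems by (intro sum_nonneg) auto
    ultimately show ?thesis by simp
  qed
  also have "\<dots> \<le> (\<Sum>x\<in>A i. f x) + (\<Sum>i\<in>I. \<Sum>x\<in>A i. f x)"
    by (intro add_left_mono insert.IH) (use insert.prems in auto)
  finally show ?case using insert by simp
qed simp

text \<open>
  A family that violates an estimate with a large enough constant can be trimmed to one of
  small mass near the circle that still violates it. Deleting the points at distance at
  least \<theta> from the circle costs little since their number is bounded, and one of
  finitely many small discs that cover the circle contains a proportional part of the
  remaining sum.
\<close>

lemma small_carleson_family:
  assumes map: "\<Phi> ` unit_disc \<subseteq> unit_disc" and "0 < K" "0 < \<eta>"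
    and unbounded: "\<And>C. \<exists>F I. carleson_family s K F \<and> I \<in> carleson_arcs \<and> C * arc_measure I < box_mass \<Phi> I F"
  obtains F I where "carleson_family s K F" "I \<in> carleson_arcs" "real n * arc_measure I < box_mass \<Phi> I F"
    "\<And>z. z \<in> F \<Longrightarrow> 1 - norm z \<le> \<eta>" "(\<Sum>z\<in>F. defect z) \<le> \<eta>"
proof -
  define y where "y = \<eta> / K"
  define \<theta> where "\<theta> = min \<eta> (y / 2)"
  have y: "0 < y" "0 < \<theta>" using assms by (auto simp: y_def \<theta>_def)
  obtain Z where Z: "Z \<subseteq> unit_circle" "finite Z" "unit_circle \<subseteq> (\<Union>\<zeta>\<in>Z. ball \<zeta> (y / 2))"
  proof (rule compactE_image[OF compact_sphere, of unit_circle "\<lambda>\<zeta>. ball \<zeta> (y / 2)" 0 1])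
    show "sphere (0::complex) 1 \<subseteq> (\<Union>c\<in>unit_circle. ball c (y / 2))" using y by auto
  qed (use that in auto)
  obtain F I where F: "carleson_family s K F" and I: "I \<in> carleson_arcs"
    and big: "(real n * card Z + 4 * K / \<theta>) * arc_measure I < box_mass \<Phi> I F" using unbounded by blast
  note fin = carleson_familyD(1)[OF F] and disc = carleson_familyD(3)[OF F]
  have disc2: "norm (\<Phi> z) < 1" if "z \<in> F" for z using disc[OF that] map by (simp add: image_subset_iff)
  note pos = carleson_arc_measure_pos[OF I]
  let ?g = "\<lambda>z. defect (\<Phi> z)"
  have g0: "0 \<le> ?g z" if "z \<in> F" for z using disc2[OF that] by (rule defect_nonneg)
  define near where "near = {z\<in>F. 1 - norm z < \<theta>}"
  define far where "far = {z\<in>F. \<not> 1 - norm z < \<theta>}"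
  \<comment> \<open>A point mapped into the box contributes at most twice the length of the arc, whatever
    its own position.\<close>
  have far: "box_mass \<Phi> I far \<le> 4 * K / \<theta> * arc_measure I"
  proof -
    have "?g z \<le> 2 * arc_measure I" if "z \<in> F" "\<Phi> z \<in> carleson_box I" for z
    proof -
      have "1 - norm (\<Phi> z) \<le> arc_measure I" by (rule carleson_box_height[OF I that(2)])
      then have "2 * (1 - norm (\<Phi> z)) \<le> 2 * arc_measure I" by simp
      then show ?thesis using defect_bounds(2)[OF disc2[OF that(1)]] by (rule order_trans[rotated])
    qed
    then have "box_mass \<Phi> I far \<le> real (card {z\<in>far. \<Phi> z \<in> carleson_box I}) * (2 * arc_measure I)"
      by (intro sum_bounded_above) (auto simp: far_def)
    also have "\<dots> \<le> real (card far) * (2 * arc_measure I)"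
      using pos fin by (intro mult_right_mono of_nat_mono card_mono) (auto simp: far_def)
    also have "real (card far) \<le> 2 * K / \<theta>"
    proof -
      have "real (card far) * \<theta> \<le> (\<Sum>z\<in>far. defect z)"
      proof (rule sum_bounded_below)
        fix z assume z: "z \<in> far"
        then show "\<theta> \<le> defect z" using defect_bounds(1)[OF disc, of z] by (auto simp: far_def)
      qed
      also have "\<dots> \<le> 2 * K" by (rule carleson_family_mass_le[OF carleson_family_subset[OF F]]) (auto simp: far_def)
      finally show ?thesis using y by (simp add: pos_le_divide_eq)
    qed
    finally show ?thesis using pos by (simp add: mult_right_mono)
  qed
  have "box_mass \<Phi> I F = box_mass \<Phi> I near + box_mass \<Phi> I far"
  proof -
    have "{z\<in>F. \<Phi> z \<in> carleson_box I} = {z\<in>near. \<Phi> z \<in> carleson_box I} \<union> {z\<in>far. \<Phi> z \<in> carleson_box I}"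
      by (auto simp: near_def far_def)
    then show ?thesis using fin by (simp only:) (intro sum.union_disjoint, auto simp: near_def far_def)
  qed
  then have near: "real n * card Z * arc_measure I < box_mass \<Phi> I near"
    using big far by (simp add: distrib_right)
  define part where "part \<zeta> = {z\<in>near. norm (z - \<zeta>) \<le> y}" for \<zeta>
  have "near \<subseteq> (\<Union>\<zeta>\<in>Z. part \<zeta>)"
  proof
    fix z assume z: "z \<in> near"
    obtain t where t: "z = of_real (norm z) * turn t" using polar_turn[of z] by blast
    have "turn t \<in> unit_circle" by simp
    then obtain \<zeta> where \<zeta>: "\<zeta> \<in> Z" "dist \<zeta> (turn t) < y / 2" using Z(3) by fastforce
    have "norm z < 1" using disc z by (simp add: near_def)
    then have "norm (z - turn t) = 1 - norm z"
      using norm_turn_diff_polar[OF t] by (simp add: norm_minus_commute)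
    moreover have "1 - norm z < y / 2" using z by (auto simp: near_def \<theta>_def)
    ultimately have "norm (z - \<zeta>) \<le> y"
      using norm_triangle_ineq[of "z - turn t" "turn t - \<zeta>"] \<zeta>(2) by (simp add: dist_norm norm_minus_commute)
    then show "z \<in> (\<Union>\<zeta>\<in>Z. part \<zeta>)" using \<zeta>(1) z by (auto simp: part_def)
  qed
  then have "box_mass \<Phi> I near \<le> (\<Sum>z\<in>(\<Union>\<zeta>\<in>Z. {z\<in>part \<zeta>. \<Phi> z \<in> carleson_box I}). ?g z)"
    using fin Z(2) g0 by (intro sum_mono2) (auto simp: part_def near_def)
  also have "\<dots> \<le> (\<Sum>\<zeta>\<in>Z. box_mass \<Phi> I (part \<zeta>))"
    using fin Z(2) g0 by (intro sum_UN_le) (auto simp: part_def near_def)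
  finally have "real (card Z) * (real n * arc_measure I) < (\<Sum>\<zeta>\<in>Z. box_mass \<Phi> I (part \<zeta>))"
    using near by (simp add: mult_ac)
  then obtain \<zeta> where \<zeta>: "\<zeta> \<in> Z" "real n * arc_measure I < box_mass \<Phi> I (part \<zeta>)"
    using sum_bounded_above[of Z "\<lambda>\<zeta>. box_mass \<Phi> I (part \<zeta>)" "real n * arc_measure I"] by (meson not_le)
  have sub: "part \<zeta> \<subseteq> F" by (auto simp: part_def near_def)
  show ?thesis
  proof (rule that[OF carleson_family_subset[OF F sub] I \<zeta>(2)])
    show "1 - norm z \<le> \<eta>" if "z \<in> part \<zeta>" for z using that by (auto simp: part_def near_def \<theta>_def)
    have "(\<Sum>z\<in>part \<zeta>. defect z) \<le> ball_mass (\<lambda>z. z) \<zeta> y F"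
      using fin disc defect_nonneg by (intro sum_mono2) (auto simp: part_def near_def)
    also have "\<dots> \<le> K * y" by (rule carleson_familyD(5)[OF F]) (use \<zeta>(1) Z(1) y in auto)
    also have "\<dots> = \<eta>" using \<open>0 < K\<close> by (simp add: y_def)
    finally show "(\<Sum>z\<in>part \<zeta>. defect z) \<le> \<eta>" .
  qed
qed

lemma carleson_sequence_of_set:
  assumes A: "countable A" "A \<subseteq> unit_disc" and "0 < s" "0 \<le> K"
    and sep: "\<And>z w. z \<in> A \<Longrightarrow> w \<in> A \<Longrightarrow> z \<noteq> w \<Longrightarrow> s \<le> pseudohyperbolic z w"
    and sum: "\<And>G \<zeta> y. finite G \<Longrightarrow> G \<subseteq> A \<Longrightarrow> norm \<zeta> = 1 \<Longrightarrow> 0 < y \<Longrightarrow>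
      ball_mass (\<lambda>z. z) \<zeta> y G \<le> K * y"
  shows "carleson_sequence (to_nat_on A ` A) (from_nat_into A)"
proof (rule carleson_sequenceI_ball_sum[OF _ _ \<open>0 \<le> K\<close>])
  let ?l = "from_nat_into A"
  have l: "?l (to_nat_on A z) = z" if "z \<in> A" for z using that A(1) by simp
  show "?l ` to_nat_on A ` A \<subseteq> unit_disc" using l A(2) by auto
  show "separated (to_nat_on A ` A) ?l" unfolding separated_def
  proof (intro exI[of _ s] conjI ballI impI \<open>0 < s\<close>)
    fix j k assume "j \<in> to_nat_on A ` A" "k \<in> to_nat_on A ` A" "j \<noteq> k"
    then obtain z w where "z \<in> A" "w \<in> A" "j = to_nat_on A z" "k = to_nat_on A w" "z \<noteq> w" by blast
    then show "s \<le> pseudohyperbolic (?l j) (?l k)" using sep l by simp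
  qed
  fix F and \<zeta> :: complex and y :: real assume F: "finite F" "F \<subseteq> to_nat_on A ` A" "norm \<zeta> = 1" "0 < y"
  have inj: "inj_on ?l F"
    by (rule inj_on_inverseI[where g = "to_nat_on A"]) (use F(2) l in auto)
  have "(\<Sum>k\<in>{k\<in>F. norm (?l k - \<zeta>) \<le> y}. defect (?l k)) = (\<Sum>z\<in>?l ` {k\<in>F. norm (?l k - \<zeta>) \<le> y}. defect z)"
    by (rule sum.reindex[symmetric, unfolded o_def]) (rule inj_on_subset[OF inj], auto)
  also have "?l ` {k\<in>F. norm (?l k - \<zeta>) \<le> y} = {z\<in>?l ` F. norm (z - \<zeta>) \<le> y}" by auto
  also have "(\<Sum>z\<in>\<dots>. defect z) \<le> K * y"
    using F l by (intro sum) auto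
  finally show "(\<Sum>k\<in>{k\<in>F. norm (?l k - \<zeta>) \<le> y}. defect (?l k)) \<le> K * y" .
qed

text \<open>
  If no constant works, choose families recursively with image sums exceeding n|I|, so close
  to the circle and of so small a mass, relative to the least height in the preceding
  families, that their union satisfies the Carleson condition: in a disc of radius y the
  first family that reaches below height y contributes at most Ky and the later ones a
  geometric series. The union is interpolating, but its image is not.
\<close>

lemma carleson_family_box_mass_bounded:
  assumes cp: "carleson_preserving \<Phi>" and map: "\<Phi> ` unit_disc \<subseteq> unit_disc" and "0 < s" "0 < K"
  obtains C where "0 \<le> C" "\<And>F I. carleson_family s K F \<Longrightarrow> I \<in> carleson_arcs \<Longrightarrow> box_mass \<Phi> I F \<le> C * arc_measure I"
proof (rule ccontr)
  assume no: "\<not> thesis"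
  have unbounded: "\<exists>F I. carleson_family s K F \<and> I \<in> carleson_arcs \<and> C * arc_measure I < box_mass \<Phi> I F" for C
  proof (rule ccontr)
    assume bdd: "\<not> (\<exists>F I. carleson_family s K F \<and> I \<in> carleson_arcs \<and> C * arc_measure I < box_mass \<Phi> I F)"
    have "box_mass \<Phi> I F \<le> max C 0 * arc_measure I" if "carleson_family s K F" "I \<in> carleson_arcs" for F I
    proof -
      have "box_mass \<Phi> I F \<le> C * arc_measure I" using bdd that by (meson not_le)
      also have "\<dots> \<le> max C 0 * arc_measure I"
        using carleson_arc_measure_pos[OF that(2)] by (intro mult_right_mono) auto
      finally show ?thesis .
    qed
    then show False using no that[of "max C 0"] by auto
  qed
  define \<delta> where "\<delta> F = Min ((\<lambda>z. 1 - norm z) ` F)" for F :: "complex set"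
  define P where "P n F \<longleftrightarrow> carleson_family s K F \<and> F \<noteq> {} \<and>
    (\<exists>I\<in>carleson_arcs. real n * arc_measure I < box_mass \<Phi> I F)" for n :: nat and F
  define Q where "Q n F G \<longleftrightarrow> (\<forall>z\<in>G. 1 - norm z \<le> \<delta> F / 16) \<and> (\<Sum>z\<in>G. defect z) \<le> \<delta> F / 2 ^ Suc n"
    for n :: nat and F G :: "complex set"
  have step: "\<exists>F. P n F \<and> (\<forall>z\<in>F. 1 - norm z \<le> \<eta>) \<and> (\<Sum>z\<in>F. defect z) \<le> \<eta>" if eta: "0 < \<eta>" for n \<eta>
  proof -
    obtain F I where F: "carleson_family s K F" "I \<in> carleson_arcs" "real n * arc_measure I < box_mass \<Phi> I F"
      "\<And>z. z \<in> F \<Longrightarrow> 1 - norm z \<le> \<eta>" "(\<Sum>z\<in>F. defect z) \<le> \<eta>"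
      by (rule small_carleson_family[OF map \<open>0 < K\<close> eta unbounded]) blast
    have "0 \<le> real n * arc_measure I" using carleson_arc_measure_pos[OF F(2)] by simp
    then have "F \<noteq> {}" using F(3) by auto
    then show ?thesis using F unfolding P_def by blast
  qed
  have \<delta>pos: "0 < \<delta> F" if "P n F" for n F
  proof -
    have "carleson_family s K F" "F \<noteq> {}" using that by (auto simp: P_def)
    then show ?thesis unfolding \<delta>_def using carleson_familyD(1,3)[of s K F] by (subst Min_gr_iff) auto
  qed
  have "\<exists>F. \<forall>n. P n (F n) \<and> Q n (F n) (F (Suc n))"
  proof (rule dependent_nat_choice)
    show "\<exists>F. P 0 F" using step[of 1 0] by auto
    fix F n assume "P n F"
    then have "0 < \<delta> F" by (rule \<delta>pos)
    then have "0 < min (\<delta> F / 16) (\<delta> F / 2 ^ Suc n)" by simp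
    from step[OF this, of "Suc n"] show "\<exists>G. P (Suc n) G \<and> Q n F G" unfolding Q_def by auto
  qed
  then obtain F where F: "\<And>n. P n (F n)" "\<And>n. Q n (F n) (F (Suc n))" by blast
  have famF: "carleson_family s K (F n)" for n using F(1)[of n] by (simp add: P_def)
  note fin = carleson_familyD(1)[OF famF] and disc = carleson_familyD(3)[OF famF]
  let ?d = "\<lambda>n. \<delta> (F n)"
  have dle: "?d n \<le> 1 - norm z" if "z \<in> F n" for n z
    unfolding \<delta>_def using fin that by (intro Min_le) auto
  have QD: "z \<in> F (Suc n) \<Longrightarrow> 1 - norm z \<le> ?d n / 16" "(\<Sum>z\<in>F (Suc n). defect z) \<le> ?d n * (1/2) ^ Suc n" for n z
  proof -
    have "(\<Sum>z\<in>F (Suc n). defect z) \<le> ?d n / 2 ^ Suc n" using F(2)[of n] unfolding Q_def by blast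
    also have "?d n / 2 ^ Suc n = ?d n * (1/2) ^ Suc n" by (simp add: power_one_over)
    finally show "(\<Sum>z\<in>F (Suc n). defect z) \<le> ?d n * (1/2) ^ Suc n" .
  qed (use F(2)[of n] in \<open>unfold Q_def, blast\<close>)
  have dSuc: "?d (Suc n) \<le> ?d n / 16" for n
  proof -
    obtain z where z: "z \<in> F (Suc n)" using F(1)[of "Suc n"] by (auto simp: P_def)
    then show ?thesis using dle[OF z] QD(1)[OF z] by linarith
  qed
  have dmono: "?d n \<le> ?d m" if "m \<le> n" for m n
  proof (rule lift_Suc_antimono_le[OF _ that])
    fix i
    have "0 < ?d i" by (rule \<delta>pos[OF F(1)])
    then show "?d (Suc i) \<le> ?d i" using dSuc[of i] by linarith
  qed
  have later: "16 * (1 - norm z) \<le> ?d m" "(\<Sum>z\<in>F n. defect z) \<le> ?d m * (1/2) ^ n"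
    if "m < n" "z \<in> F n" for m n z
  proof -
    obtain n' where n': "n = Suc n'" using \<open>m < n\<close> by (cases n) auto
    have d: "?d n' \<le> ?d m" using n' that by (intro dmono) simp
    show "16 * (1 - norm z) \<le> ?d m" using QD(1)[of z n'] that(2) d by (simp add: n')
    have "(\<Sum>z\<in>F n. defect z) \<le> ?d n' * (1/2) ^ n" unfolding n' by (rule QD(2))
    also have "\<dots> \<le> ?d m * (1/2) ^ n" using d by (intro mult_right_mono) auto
    finally show "(\<Sum>z\<in>F n. defect z) \<le> ?d m * (1/2) ^ n" .
  qed
  define A where "A = (\<Union>n. F n)"
  have A: "countable A" using fin by (auto simp: A_def countable_finite)
  have "carleson_sequence (to_nat_on A ` A) (from_nat_into A)"
  proof (rule carleson_sequence_of_set[OF A])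
    show "A \<subseteq> unit_disc" using disc by (auto simp: A_def)
    show "0 < min s (1/2)" "0 \<le> K + 2" using \<open>0 < s\<close> \<open>0 < K\<close> by auto
    fix z w assume zw: "z \<in> A" "w \<in> A" "z \<noteq> w"
    then obtain m n where mn: "z \<in> F m" "w \<in> F n" by (auto simp: A_def)
    have half: "1/2 \<le> pseudohyperbolic u v" if "u \<in> F i" "v \<in> F j" "i < j" for u v i j
      using later(1)[OF that(3,2)] dle[OF that(1)] disc that
      by (intro pseudohyperbolic_ge_half_of_height_ratio) auto
    show "min s (1/2) \<le> pseudohyperbolic z w"
    proof (cases m n rule: linorder_cases)
      case less then show ?thesis using half[OF mn] by simp
    next
      case equal
      then have "s \<le> pseudohyperbolic z w" using carleson_familyD(4)[OF famF] mn zw(3) by blast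
      then show ?thesis by simp
    next
      case greater then show ?thesis using half[OF mn(2,1)] by (simp add: pseudohyperbolic_commute[of z])
    qed
  next
    fix G and \<zeta> :: complex and y :: real assume G: "finite G" "G \<subseteq> A" "norm \<zeta> = 1" "0 < y"
    let ?B = "\<lambda>n. {z\<in>F n. norm (z - \<zeta>) \<le> y}"
    have B0: "0 \<le> defect z" if "z \<in> F n" for z n using disc[OF that] by (rule defect_nonneg)
    have "\<exists>N. G \<subseteq> (\<Union>n<N. F n)"
    proof -
      have "\<exists>n. z \<in> F n" if "z \<in> G" for z using G(2) that by (auto simp: A_def)
      then obtain f where "\<And>z. z \<in> G \<Longrightarrow> z \<in> F (f z)" by metis
      moreover have "\<forall>z\<in>G. f z < Suc (Max (f ` G))" using G(1) by (simp add: less_Suc_eq_le)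
      ultimately show ?thesis by (intro exI[of _ "Suc (Max (f ` G))"]) blast
    qed
    then obtain N where N: "G \<subseteq> (\<Union>n<N. F n)" by blast
    have "ball_mass (\<lambda>z. z) \<zeta> y G \<le> (\<Sum>z\<in>(\<Union>n<N. ?B n). defect z)"
      using N fin B0 by (intro sum_mono2) auto
    also have "\<dots> \<le> (\<Sum>n<N. \<Sum>z\<in>?B n. defect z)"
      using fin B0 by (intro sum_UN_le) auto
    also have "\<dots> \<le> (K + 2) * y"
    proof (cases "\<exists>n. ?d n \<le> y")
      case False
      have empty: "?B n = {}" for n
      proof -
        have False if "z \<in> ?B n" for z
          using dle[of z n] that False norm_triangle_ineq2[of \<zeta> z] G(3) by (auto simp: norm_minus_commute not_le) (smt (verit))
        then show ?thesis by blast
      qed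
      have "(\<Sum>n<N. \<Sum>z\<in>?B n. defect z) = 0" by (simp only: empty) simp
      then show ?thesis using G(4) \<open>0 < K\<close> by simp
    next
      case True
      \<comment> \<open>Families before n0 have no point of height at most y, hence none in the disc.\<close>
      define n0 where "n0 = (LEAST n. ?d n \<le> y)"
      have n0: "?d n0 \<le> y" unfolding n0_def by (rule LeastI_ex[OF True])
      have n0_less: "y < ?d n" if "n < n0" for n
        using not_less_Least[OF that[unfolded n0_def]] by (simp only: not_le)
      have "(\<Sum>z\<in>?B n. defect z) \<le> (if n = n0 then K * y else 0) + y * (1/2) ^ n" for n
      proof (cases n n0 rule: linorder_cases)
        case less
        have False if "z \<in> ?B n" for z
          using dle[of z n] that n0_less[OF less] norm_triangle_ineq2[of \<zeta> z] G(3) by (auto simp: norm_minus_commute)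
        then have "?B n = {}" by blast
        then have "(\<Sum>z\<in>?B n. defect z) = 0" by (simp only: sum.empty)
        then show ?thesis using less G(4) by simp
      next
        case equal
        have "(\<Sum>z\<in>?B n. defect z) \<le> K * y" by (rule carleson_familyD(5)[OF famF G(3,4)])
        then show ?thesis using equal G(4) by (simp add: add_increasing2)
      next
        case greater
        obtain z where z: "z \<in> F n" using F(1)[of n] by (auto simp: P_def)
        have "(\<Sum>z\<in>?B n. defect z) \<le> (\<Sum>z\<in>F n. defect z)"
          using fin B0 by (intro sum_mono2) auto
        also have "\<dots> \<le> ?d n0 * (1/2) ^ n" by (rule later(2)[OF greater z])
        also have "\<dots> \<le> y * (1/2) ^ n" using n0 by (intro mult_right_mono) auto
        finally show ?thesis using greater by simp
      qed
      then have "(\<Sum>n<N. \<Sum>z\<in>?B n. defect z) \<le> (\<Sum>n<N. (if n = n0 then K * y else 0) + y * (1/2) ^ n)"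
        by (rule sum_mono)
      also have "\<dots> = (if n0 < N then K * y else 0) + y * (\<Sum>n<N. (1/2) ^ n)"
        by (simp add: sum.distrib sum_distrib_left)
      also have "(\<Sum>n<N. (1/2::real) ^ n) \<le> 2" by (rule sum_half_powers_le) simp
      finally show ?thesis using G(4) \<open>0 < K\<close> by (auto simp: algebra_simps split: if_splits intro: order_trans)
    qed
    finally show "ball_mass (\<lambda>z. z) \<zeta> y G \<le> (K + 2) * y" .
  qed
  moreover have "A \<subseteq> unit_disc" using disc by (auto simp: A_def)
  then have "from_nat_into A ` to_nat_on A ` A \<subseteq> unit_disc" using A by auto
  ultimately have "carleson_sequence (to_nat_on A ` A) (\<Phi> \<circ> from_nat_into A)"
    using carleson_preservingD[OF cp] by blast
  then obtain C where C: "0 \<le> C" "\<And>G I. finite G \<Longrightarrow> G \<subseteq> to_nat_on A ` A \<Longrightarrow> I \<in> carleson_arcs \<Longrightarrow>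
    (\<Sum>k\<in>{k\<in>G. (\<Phi> \<circ> from_nat_into A) k \<in> carleson_box I}. defect ((\<Phi> \<circ> from_nat_into A) k)) \<le> C * arc_measure I"
    by (rule carleson_sequence_box_sum) blast
  obtain n where n: "C \<le> real n" using real_arch_simple by blast
  obtain I where I: "I \<in> carleson_arcs" "real n * arc_measure I < box_mass \<Phi> I (F n)"
    using F(1)[of n] by (auto simp: P_def)
  have FA: "F n \<subseteq> A" by (auto simp: A_def)
  let ?S = "{z\<in>F n. \<Phi> z \<in> carleson_box I}"
  have inv: "from_nat_into A (to_nat_on A z) = z" if "z \<in> F n" for z using that A FA by auto
  have "box_mass \<Phi> I (F n) = (\<Sum>k\<in>to_nat_on A ` ?S. defect ((\<Phi> \<circ> from_nat_into A) k))"
    by (subst sum.reindex) (use inv in \<open>auto intro!: inj_onI sum.cong, metis\<close>)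
  also have "to_nat_on A ` ?S = {k\<in>to_nat_on A ` F n. (\<Phi> \<circ> from_nat_into A) k \<in> carleson_box I}"
    using inv by auto
  also have "(\<Sum>k\<in>\<dots>. defect ((\<Phi> \<circ> from_nat_into A) k)) \<le> C * arc_measure I"
    using fin FA I(1) by (intro C(2)) auto
  also have "\<dots> \<le> real n * arc_measure I"
    using n carleson_arc_measure_pos[OF I(1)] by (intro mult_right_mono) auto
  finally show False using I(2) by simp
qed

section \<open>Sparse subfamilies of laminar families\<close>

lemma exists_maximal_above:
  assumes "finite S" "Q \<in> S"
  obtains P where "P \<in> S" "Q \<subseteq> P" "\<And>R. R \<in> S \<Longrightarrow> \<not> P \<subset> R"
proof -
  obtain P where "P \<in> S" "Q \<subseteq> P" "\<forall>R\<in>S. P \<subseteq> R \<longrightarrow> P = R"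
    using finite_has_maximal2[OF assms] by blast
  then show ?thesis using that[of P] by blast
qed

definition top_sets :: "'a set set \<Rightarrow> ('a set \<Rightarrow> real) \<Rightarrow> real \<Rightarrow> 'a set set" where
  "top_sets \<Q> g c = {Q\<in>\<Q>. c < g Q \<and> (\<forall>P\<in>\<Q>. Q \<subset> P \<longrightarrow> g P \<le> c)}"

lemma exists_top_set:
  assumes "finite \<Q>" "Q \<in> \<Q>" "c < g Q"
  obtains P where "P \<in> top_sets \<Q> g c" "Q \<subseteq> P"
proof -
  obtain P where "P \<in> {P\<in>\<Q>. c < g P}" "Q \<subseteq> P" "\<And>R. R \<in> {P\<in>\<Q>. c < g P} \<Longrightarrow> \<not> P \<subset> R"
    by (rule exists_maximal_above[of "{P\<in>\<Q>. c < g P}" Q]) (use assms in auto)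
  then show ?thesis using that[of P] unfolding top_sets_def by force
qed

text \<open>
  Let L_k be the union of the maximal sets on which \<open>g\<close> exceeds \<epsilon> 4^k;
  these unions decrease. Keep a maximal set of level k if at most half of it is covered by
  the next union; the rest is its private part \<open>E\<close>, and private parts are
  disjoint. The sets that are not kept at level k have total measure at most twice that of
  the next union, which the factor 4 between the thresholds turns into half of the next
  term, so the kept sets carry at least half of the sum.
\<close>

lemma laminar_sparse_subfamily:
  fixes \<Q> :: "'a set set" and g :: "'a set \<Rightarrow> real"
  assumes fin: "finite \<Q>" and lam: "\<And>P Q. P \<in> \<Q> \<Longrightarrow> Q \<in> \<Q> \<Longrightarrow> P \<inter> Q = {} \<or> P \<subseteq> Q \<or> Q \<subseteq> P"
    and meas: "\<And>Q. Q \<in> \<Q> \<Longrightarrow> Q \<in> fmeasurable M" "\<And>Q. Q \<in> \<Q> \<Longrightarrow> 0 < measure M Q"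
    and "0 < \<epsilon>" and K: "\<And>Q. Q \<in> \<Q> \<Longrightarrow> g Q \<le> \<epsilon> * 4 ^ K"
  obtains \<F> E where "\<F> \<subseteq> \<Q>" "\<And>Q. Q \<in> \<F> \<Longrightarrow> 0 < g Q"
    "\<And>Q. Q \<in> \<F> \<Longrightarrow> E Q \<subseteq> Q" "\<And>Q. Q \<in> \<F> \<Longrightarrow> E Q \<in> fmeasurable M"
    "\<And>Q. Q \<in> \<F> \<Longrightarrow> measure M Q \<le> 2 * measure M (E Q)" "disjoint_family_on E \<F>"
    "(\<Sum>k<K. \<epsilon> * 4 ^ k * (\<Sum>Q\<in>top_sets \<Q> g (\<epsilon> * 4 ^ k). measure M Q)) \<le> 2 * (\<Sum>Q\<in>\<F>. g Q * measure M Q)"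
proof -
  define c where "c k = \<epsilon> * 4 ^ k" for k :: nat
  define T where "T k = top_sets \<Q> g (c k)" for k
  define L where "L k = \<Union> (T k)" for k
  define kept where "kept k = {Q\<in>T k. 2 * measure M (Q \<inter> L (Suc k)) \<le> measure M Q}" for k
  define \<F> where "\<F> = (\<Union>k<K. kept k)"
  have c: "0 < c k" "c (Suc k) = 4 * c k" for k using \<open>0 < \<epsilon>\<close> by (auto simp: c_def)
  have TQ: "T k \<subseteq> \<Q>" "finite (T k)" for k using fin by (auto simp: T_def top_sets_def)
  have Tg: "c k < g Q" if "Q \<in> T k" for k Q using that by (auto simp: T_def top_sets_def)
  have Lfm: "L k \<in> fmeasurable M" for k
    unfolding L_def using TQ meas(1) by (intro fmeasurable.finite_Union) auto
  have LSuc: "L (Suc k) \<subseteq> L k" for k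
  proof
    fix x assume "x \<in> L (Suc k)"
    then obtain Q where Q: "Q \<in> T (Suc k)" "x \<in> Q" by (auto simp: L_def)
    have "c k < g Q" using Tg[OF Q(1)] c[of k] by simp
    then obtain P where "P \<in> top_sets \<Q> g (c k)" "Q \<subseteq> P"
      using exists_top_set[OF fin, of Q] Q(1) TQ by blast
    then show "x \<in> L k" using Q(2) by (auto simp: L_def T_def)
  qed
  have Lmono: "L n \<subseteq> L m" if "m \<le> n" for m n
    using lift_Suc_antimono_le[of L, OF LSuc that] .
  have Tdisj: "P \<inter> Q = {}" if "P \<in> T k" "Q \<in> T k" "P \<noteq> Q" for P Q k
  proof (rule ccontr)
    assume "P \<inter> Q \<noteq> {}"
    have PQ: "P \<in> \<Q>" "Q \<in> \<Q>" using that(1,2) TQ(1)[of k] by auto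
    have "P \<subset> Q \<or> Q \<subset> P" using lam[OF PQ] \<open>P \<inter> Q \<noteq> {}\<close> \<open>P \<noteq> Q\<close> by auto
    moreover have "g Q \<le> c k" if "P \<subset> Q" using \<open>P \<in> T k\<close> PQ(2) that by (simp add: T_def top_sets_def)
    moreover have "g P \<le> c k" if "Q \<subset> P" using \<open>Q \<in> T k\<close> PQ(1) that by (simp add: T_def top_sets_def)
    ultimately show False using Tg[OF that(1)] Tg[OF that(2)] by linarith
  qed
  have Tmeas: "measure M (L k) = (\<Sum>Q\<in>T k. measure M Q)" for k
    unfolding L_def using TQ[of k] meas(1) Tdisj
    by (intro measure_Union') (auto simp: pairwise_def disjnt_def)
  have TK: "T K = {}" using K Tg[of _ K] TQ(1)[of K] by (fastforce simp: c_def)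
  have kT: "kept k \<subseteq> T k" for k by (auto simp: kept_def)
  \<comment> \<open>A set kept at two levels would be contained in its own covered half.\<close>
  have kunique: False if "Q \<in> kept k" "Q \<in> kept n" "k < n" for Q k n
  proof -
    have "Q \<subseteq> L n" using that(2) kT by (auto simp: L_def)
    then have "Q \<inter> L (Suc k) = Q" using Lmono[of "Suc k" n] that(3) by auto
    moreover have "0 < measure M Q" using that(1) kT TQ meas(2) by blast
    ultimately show False using that(1) by (simp add: kept_def)
  qed
  define idx where "idx Q = (SOME k. Q \<in> kept k)" for Q
  have idx: "Q \<in> kept (idx Q)" if "Q \<in> \<F>" for Q
    using that unfolding idx_def \<F>_def by (metis UN_E someI_ex)
  define E where "E Q = Q - L (Suc (idx Q))" for Q
  have F\<Q>: "\<F> \<subseteq> \<Q>" using kT TQ by (fastforce simp: \<F>_def)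
  show ?thesis
  proof (rule that[of \<F> E])
    show "\<F> \<subseteq> \<Q>" by (rule F\<Q>)
    fix Q assume Q: "Q \<in> \<F>"
    show "0 < g Q" using Tg[of Q "idx Q"] c(1)[of "idx Q"] idx[OF Q] kT by (meson less_trans subsetD)
    show "E Q \<subseteq> Q" by (auto simp: E_def)
    have Qfm: "Q \<in> fmeasurable M" using Q F\<Q> meas(1) by blast
    then show "E Q \<in> fmeasurable M" unfolding E_def using Lfm by (intro fmeasurable.Diff)
    have "measure M Q = measure M (Q \<inter> L (Suc (idx Q))) + measure M (E Q)"
    proof -
      have "Q = (Q \<inter> L (Suc (idx Q))) \<union> E Q" by (auto simp: E_def)
      then have "measure M Q = measure M ((Q \<inter> L (Suc (idx Q))) \<union> E Q)" by simp
      also have "\<dots> = measure M (Q \<inter> L (Suc (idx Q))) + measure M (E Q)"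
        unfolding E_def using Qfm Lfm
        by (intro measure_Un_AE) (auto intro!: fmeasurable.Diff fmeasurable_Int_fmeasurable dest: fmeasurableD)
      finally show ?thesis .
    qed
    then show "measure M Q \<le> 2 * measure M (E Q)" using idx[OF Q] by (simp add: kept_def)
  next
    show "disjoint_family_on E \<F>"
      unfolding disjoint_family_on_def
    proof (intro ballI impI)
      fix P Q assume PQ: "P \<in> \<F>" "Q \<in> \<F>" "P \<noteq> Q"
      have sub: "E B \<inter> E A = {}" if "A \<in> \<F>" "B \<in> \<F>" "idx A < idx B" for A B
      proof -
        have "B \<subseteq> L (idx B)" using idx[OF that(2)] kT by (auto simp: L_def)
        also have "\<dots> \<subseteq> L (Suc (idx A))" using that(3) by (intro Lmono) simp
        finally show ?thesis by (auto simp: E_def)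
      qed
      show "E P \<inter> E Q = {}"
      proof (cases "idx P" "idx Q" rule: linorder_cases)
        case less then show ?thesis using sub[OF PQ(1,2)] by blast
      next
        case equal
        then have "P \<inter> Q = {}" using idx[OF PQ(1)] idx[OF PQ(2)] kT Tdisj PQ(3) by (metis subsetD)
        then show ?thesis by (auto simp: E_def)
      next
        case greater then show ?thesis using sub[OF PQ(2,1)] by blast
      qed
    qed
  next
    define a where "a k = c k * (\<Sum>Q\<in>T k. measure M Q)" for k
    have fink: "finite (kept k)" for k using kT TQ finite_subset by blast
    have a0: "0 \<le> a k" for k using c(1)[of k] by (auto simp: a_def intro!: mult_nonneg_nonneg sum_nonneg)
    have score: "(\<Sum>k<K. c k * (\<Sum>Q\<in>kept k. measure M Q)) \<le> (\<Sum>Q\<in>\<F>. g Q * measure M Q)"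
    proof -
      have "(\<Sum>Q\<in>\<F>. g Q * measure M Q) = (\<Sum>k<K. \<Sum>Q\<in>kept k. g Q * measure M Q)"
        unfolding \<F>_def using fink
        by (intro sum.UNION_disjoint) (auto, metis kunique linorder_neqE_nat)
      also have "\<dots> \<ge> (\<Sum>k<K. \<Sum>Q\<in>kept k. c k * measure M Q)"
      proof (intro sum_mono mult_right_mono measure_nonneg)
        fix k Q assume "Q \<in> kept k"
        then show "c k \<le> g Q" using Tg[of Q k] kT[of k] by auto
      qed
      finally show ?thesis by (simp add: sum_distrib_left)
    qed
    \<comment> \<open>The second term accounts for the sets that are not kept.\<close>
    have one: "a k \<le> c k * (\<Sum>Q\<in>kept k. measure M Q) + a (Suc k) / 2" for k
    proof -
      have "(\<Sum>Q\<in>T k. measure M Q) = (\<Sum>Q\<in>kept k. measure M Q) + (\<Sum>Q\<in>T k - kept k. measure M Q)"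
        using kT TQ by (metis add.commute sum.subset_diff)
      also have "(\<Sum>Q\<in>T k - kept k. measure M Q) \<le> (\<Sum>Q\<in>T k - kept k. 2 * measure M (Q \<inter> L (Suc k)))"
        by (intro sum_mono) (auto simp: kept_def)
      also have "\<dots> = 2 * (\<Sum>Q\<in>T k - kept k. measure M (Q \<inter> L (Suc k)))" by (simp add: sum_distrib_left)
      also have "(\<Sum>Q\<in>T k - kept k. measure M (Q \<inter> L (Suc k))) = measure M (\<Union>Q\<in>T k - kept k. Q \<inter> L (Suc k))"
      proof (rule measure_UNION'[symmetric])
        show "finite (T k - kept k)" using TQ(2)[of k] by simp
        show "Q \<inter> L (Suc k) \<in> fmeasurable M" if "Q \<in> T k - kept k" for Q
          using that TQ(1)[of k] meas(1) Lfm by (intro fmeasurable_Int_fmeasurable) (auto dest: fmeasurableD)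
        show "pairwise (\<lambda>P Q. disjnt (P \<inter> L (Suc k)) (Q \<inter> L (Suc k))) (T k - kept k)"
          unfolding pairwise_def disjnt_def using Tdisj[of _ k] by blast
      qed
      also have "\<dots> \<le> measure M (L (Suc k))"
      proof (rule measure_mono_fmeasurable[OF _ _ Lfm])
        show "(\<Union>Q\<in>T k - kept k. Q \<inter> L (Suc k)) \<in> sets M"
        proof (rule sets.finite_UN)
          show "Q \<inter> L (Suc k) \<in> sets M" if "Q \<in> T k - kept k" for Q
            using that TQ(1)[of k] meas(1) Lfm[of "Suc k"] by (intro sets.Int) (auto dest: fmeasurableD)
        qed (use TQ(2)[of k] in simp)
      qed auto
      also have "\<dots> = (\<Sum>Q\<in>T (Suc k). measure M Q)" by (rule Tmeas)
      finally have "(\<Sum>Q\<in>T k. measure M Q) \<le> (\<Sum>Q\<in>kept k. measure M Q) + 2 * (\<Sum>Q\<in>T (Suc k). measure M Q)" by simp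
      then have "a k \<le> c k * ((\<Sum>Q\<in>kept k. measure M Q) + 2 * (\<Sum>Q\<in>T (Suc k). measure M Q))"
        unfolding a_def using c(1)[of k] by (intro mult_left_mono) auto
      then show ?thesis by (simp add: a_def c(2) distrib_left)
    qed
    have "(\<Sum>k<K. a (Suc k)) \<le> (\<Sum>k<K. a k)"
    proof -
      have "(\<Sum>k<K. a (Suc k)) + a 0 = (\<Sum>k<Suc K. a k)" by (simp only: sum.lessThan_Suc_shift add.commute)
      also have "\<dots> = (\<Sum>k<K. a k)" using TK by (simp add: a_def)
      finally show ?thesis using a0[of 0] by simp
    qed
    moreover have "(\<Sum>k<K. a k) \<le> (\<Sum>k<K. c k * (\<Sum>Q\<in>kept k. measure M Q)) + (\<Sum>k<K. a (Suc k)) / 2"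
      using sum_mono[of "{..<K}", OF one] by (simp add: sum.distrib sum_divide_distrib)
    ultimately have "(\<Sum>k<K. a k) \<le> 2 * (\<Sum>Q\<in>\<F>. g Q * measure M Q)" using score by linarith
    then show "(\<Sum>k<K. \<epsilon> * 4 ^ k * (\<Sum>Q\<in>top_sets \<Q> g (\<epsilon> * 4 ^ k). measure M Q)) \<le> 2 * (\<Sum>Q\<in>\<F>. g Q * measure M Q)"
      by (simp add: a_def c_def T_def)
  qed
qed

section \<open>Dyadic cells of the disc\<close>

definition dyadic :: "nat \<Rightarrow> nat \<Rightarrow> real set" where
  "dyadic n i = {real i / 2 ^ n ..< (real i + 1) / 2 ^ n}"

lemma dyadic_fmeasurable: "dyadic n i \<in> fmeasurable lborel"
  and measure_dyadic [simp]: "measure lborel (dyadic n i) = (1/2) ^ n"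
proof -
  have le: "real i / 2 ^ n \<le> (real i + 1) / 2 ^ n" by (simp add: divide_right_mono)
  show "dyadic n i \<in> fmeasurable lborel"
    unfolding dyadic_def by (rule fmeasurableI) (use le in auto)
  show "measure lborel (dyadic n i) = (1/2) ^ n"
    unfolding dyadic_def using le by (simp add: diff_divide_distrib[symmetric] power_one_over)
qed

lemma dyadic_subset_unit: "i < 2 ^ n \<Longrightarrow> dyadic n i \<subseteq> {0..<1}"
proof -
  assume "i < 2 ^ n"
  then have "real i + 1 \<le> 2 ^ n"
    by (metis Suc_leI of_nat_Suc of_nat_le_iff of_nat_numeral of_nat_power add.commute)
  then have "(real i + 1) / 2 ^ n \<le> 1" by simp
  then show ?thesis unfolding dyadic_def by (auto intro: order_trans)
qed

lemma dyadic_laminar: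
  assumes "n \<le> m" shows "dyadic n i \<inter> dyadic m j = {} \<or> dyadic m j \<subseteq> dyadic n i"
proof (rule disjCI)
  assume "\<not> dyadic m j \<subseteq> dyadic n i"
  define p where "p = (2::nat) ^ (m - n)"
  have pm: "(2::real) ^ m = 2 ^ n * real p" using assms by (simp add: p_def power_add[symmetric])
  show "dyadic n i \<inter> dyadic m j = {}"
  proof (rule ccontr)
    assume "dyadic n i \<inter> dyadic m j \<noteq> {}"
    then obtain x where "x \<in> dyadic n i" "x \<in> dyadic m j" by blast
    then have x: "real i / 2 ^ n \<le> x" "x < (real i + 1) / 2 ^ n" "real j / 2 ^ m \<le> x" "x < (real j + 1) / 2 ^ m"
      by (auto simp: dyadic_def)
    have p0: "0 < p" by (simp add: p_def)
    have "real i \<le> x * 2 ^ n" "x * 2 ^ n < real i + 1" using x(1,2) by (simp_all add: field_simps)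
    then have "real i * real p \<le> (x * 2 ^ n) * real p" "(x * 2 ^ n) * real p < (real i + 1) * real p"
      using p0 by (simp_all add: mult_right_mono mult_strict_right_mono del: distrib_right)
    then have "real i * real p \<le> x * 2 ^ m" "x * 2 ^ m < (real i + 1) * real p" by (simp_all add: pm mult.assoc)
    moreover have "real j \<le> x * 2 ^ m" "x * 2 ^ m < real j + 1" using x(3,4) by (simp_all add: field_simps)
    ultimately have "real (i * p) < real (j + 1)" "real j < real ((i + 1) * p)" by (simp_all add: algebra_simps)
    then have "i * p \<le> j" "j + 1 \<le> (i + 1) * p" by linarith+
    then have le: "real i * real p \<le> real j" "real j + 1 \<le> (real i + 1) * real p"
      by (metis of_nat_le_iff of_nat_mult, metis of_nat_1 of_nat_add of_nat_le_iff of_nat_mult)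
    have "real i / 2 ^ n \<le> real j / 2 ^ m" "(real j + 1) / 2 ^ m \<le> (real i + 1) / 2 ^ n"
    proof -
      have eq: "u / 2 ^ n = u * real p / 2 ^ m" for u :: real using p0 by (simp add: pm)
      show "real i / 2 ^ n \<le> real j / 2 ^ m" "(real j + 1) / 2 ^ m \<le> (real i + 1) / 2 ^ n"
        using le by (simp_all only: eq divide_right_mono zero_le_power zero_le_numeral)
    qed
    then have "dyadic m j \<subseteq> dyadic n i" unfolding dyadic_def by auto
    then show False using \<open>\<not> dyadic m j \<subseteq> dyadic n i\<close> by blast
  qed
qed

definition dyadic_family :: "nat \<Rightarrow> real set set" where
  "dyadic_family N = {dyadic n i |n i. n \<le> N \<and> i < 2 ^ n}"

lemma finite_dyadic_family: "finite (dyadic_family N)"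
proof -
  have "dyadic_family N \<subseteq> (\<lambda>(n, i). dyadic n i) ` ({..N} \<times> {..<2 ^ N})"
  proof
    fix Q assume "Q \<in> dyadic_family N"
    then obtain n i where "Q = dyadic n i" "n \<le> N" "i < 2 ^ n" by (auto simp: dyadic_family_def)
    moreover have "(2::nat) ^ n \<le> 2 ^ N" using \<open>n \<le> N\<close> by (intro power_increasing) auto
    ultimately show "Q \<in> (\<lambda>(n, i). dyadic n i) ` ({..N} \<times> {..<2 ^ N})"
      by (intro image_eqI[of _ _ "(n, i)"]) (auto intro: less_le_trans)
  qed
  then show ?thesis using finite_subset by blast
qed

lemma dyadic_family_laminar:
  assumes "P \<in> dyadic_family N" "Q \<in> dyadic_family N"
  shows "P \<inter> Q = {} \<or> P \<subseteq> Q \<or> Q \<subseteq> P"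
proof -
  obtain n i m j where "P = dyadic n i" "Q = dyadic m j" using assms by (auto simp: dyadic_family_def)
  then show ?thesis using dyadic_laminar[of n m i j] dyadic_laminar[of m n j i] by (cases "n \<le> m") auto
qed

definition angle :: "complex \<Rightarrow> real" where "angle w = Arg2pi w / (2 * pi)"

lemma angle: "0 \<le> angle w" "angle w < 1" "w = of_real (norm w) * turn (angle w)"
  using Arg2pi[of w] by (auto simp: angle_def cis_conv_exp is_Arg_def)

text \<open>
  The part of the disc above the arc \<open>Q\<close> whose distance to the circle is
  comparable to the length of \<open>Q\<close>. For dyadic arcs these cells form a partition
  of the disc.
\<close>

definition cell :: "real set \<Rightarrow> complex set" where
  "cell Q = {w \<in> unit_disc. angle w \<in> Q \<and> 1 - norm w \<le> measure lborel Q \<and> measure lborel Q < 2 * (1 - norm w)}"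

lemma exists_cell:
  assumes "norm w < 1" "(1/2) ^ N \<le> 1 - norm w"
  obtains Q where "Q \<in> dyadic_family N" "w \<in> cell Q"
proof -
  define n where "n = (LEAST n. (1/2) ^ n < 2 * (1 - norm w))"
  have exN: "(1/2) ^ N < 2 * (1 - norm w)" using assms by simp
  have n: "(1/2) ^ n < 2 * (1 - norm w)" "n \<le> N"
    unfolding n_def using exN by (rule LeastI[where P = "\<lambda>n. (1/2) ^ n < 2 * (1 - norm w)"])
      (rule Least_le[where P = "\<lambda>n. (1/2) ^ n < 2 * (1 - norm w)", OF exN])
  have up: "1 - norm w \<le> (1/2) ^ n"
  proof (cases n)
    case (Suc m)
    have "\<not> (1/2) ^ m < 2 * (1 - norm w)" by (rule not_less_Least) (simp only: n_def[symmetric] Suc lessI)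
    then show ?thesis using Suc by simp
  qed simp
  define i where "i = nat \<lfloor>angle w * 2 ^ n\<rfloor>"
  have i: "real i \<le> angle w * 2 ^ n" "angle w * 2 ^ n < real i + 1" using angle(1)[of w] by (auto simp: i_def)
  have "real i < 2 ^ n"
  proof -
    have "angle w * 2 ^ n < 1 * 2 ^ n" using angle(2)[of w] by (intro mult_strict_right_mono) auto
    then show ?thesis using i(1) by linarith
  qed
  then have "i < 2 ^ n" by (metis of_nat_less_iff of_nat_numeral of_nat_power)
  moreover have "angle w \<in> dyadic n i" using i by (simp add: dyadic_def field_simps)
  ultimately show ?thesis using that[of "dyadic n i"] n up assms(1) by (auto simp: dyadic_family_def cell_def)
qed

text \<open>
  At level 0 the arc is the whole circle, whose Carleson box is the disc including the
  origin.
\<close>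

lemma dyadic_box:
  assumes "Q \<in> dyadic_family N"
  obtains I where "I \<in> carleson_arcs" "arc_measure I = measure lborel Q"
    "\<And>w. norm w < 1 \<Longrightarrow> angle w \<in> Q \<Longrightarrow> 1 - norm w \<le> measure lborel Q \<Longrightarrow> w \<in> carleson_box I"
proof -
  obtain n i where Q: "Q = dyadic n i" using assms by (auto simp: dyadic_family_def)
  show ?thesis
  proof (cases n)
    case 0
    then show ?thesis
      using Q by (intro that[OF circle_in_carleson_arcs]) (auto simp: arc_measure_circle carleson_box_circle)
  next
    case (Suc m)
    let ?a = "real i / 2 ^ n" and ?b = "(real i + 1) / 2 ^ n"
    have ba: "?b - ?a = (1/2) ^ n" by (simp add: diff_divide_distrib[symmetric] power_one_over)
    have half: "(1/2::real) ^ n \<le> 1/2" using Suc power_decreasing[of 1 n "1/2::real"] by simp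
    have "0 < (1/2::real) ^ n" by simp
    then have ab: "?a < ?b" "?b < ?a + 1" using ba half by linarith+
    have am: "arc_measure (turn ` {?a..<?b}) = (1/2) ^ n" using arc_measure_half_open[of ?a ?b] ab ba by simp
    show ?thesis
    proof (rule that[OF half_open_arc_in_carleson_arcs[OF ab]])
      show "arc_measure (turn ` {?a..<?b}) = measure lborel Q" using am Q by simp
      fix w assume w: "norm w < 1" "angle w \<in> Q" "1 - norm w \<le> measure lborel Q"
      show "w \<in> carleson_box (turn ` {?a..<?b})"
        by (rule mem_carleson_box_half_open[OF ab angle(3)])
           (use w Q half ba in \<open>auto simp: dyadic_def[of n i]\<close>)
    qed
  qed
qed

text \<open>
  Two cells of the same colour are far apart: at different levels their heights differ by a
  factor 16, and at the same level at least 15 arcs lie between them, also across the angle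
  0, since 16 divides 2^n for n\<ge> 4 and since there are at most 8 arcs otherwise.
\<close>

definition colour :: "nat \<Rightarrow> nat \<Rightarrow> nat \<times> nat" where "colour n i = (n mod 5, i mod 16)"

text \<open>
  Moving both points radially to the circle at most doubles |1-(cnj z) w|.
\<close>

lemma norm_one_minus_cnj_mult_ge_turn:
  assumes "norm z \<le> 1" "norm w \<le> 1" "z = of_real (norm z) * turn a" "w = of_real (norm w) * turn b"
  shows "norm (turn b - turn a) \<le> 2 * norm (1 - cnj z * w)"
proof -
  let ?p = "norm z * norm w" and ?u = "cnj (turn a) * turn b"
  have p: "0 \<le> ?p" "?p \<le> 1" using assms by (auto intro: mult_le_one)
  have eq: "cnj z * w = of_real ?p * ?u"
  proof -
    have "cnj z = of_real (norm z) * cnj (turn a)" by (subst assms(3)) simp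
    then show ?thesis by (subst assms(4)) (simp add: mult_ac)
  qed
  have "turn b - turn a = turn a * (?u - 1)" by (simp add: algebra_simps cis_cnj cis_mult)
  then have "norm (turn b - turn a) = norm (1 - ?u)" by (simp only: norm_mult norm_cis norm_minus_commute mult_1)
  also have "\<dots> \<le> norm (1 - of_real ?p * ?u) + norm (of_real ?p * ?u - ?u)"
    by (rule order_trans[OF _ norm_triangle_ineq]) simp
  also have "norm (of_real ?p * ?u - ?u) = 1 - ?p"
  proof -
    have "of_real ?p * ?u - ?u = of_real (?p - 1) * ?u" by (simp add: algebra_simps)
    then have "norm (of_real ?p * ?u - ?u) = \<bar>?p - 1\<bar> * norm ?u" by (simp only: norm_mult norm_of_real)
    also have "norm ?u = 1" by (simp add: norm_mult)
    finally show ?thesis using p by simp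
  qed
  also have "1 - ?p \<le> norm (1 - of_real ?p * ?u)"
  proof -
    have "norm (of_real ?p * ?u) = ?p" using p by (simp only: norm_mult norm_of_real complex_mod_cnj norm_cis mult_1_right abs_of_nonneg)
    then show ?thesis using norm_triangle_ineq2[of 1 "of_real ?p * ?u"] by simp
  qed
  finally show ?thesis using eq by simp
qed

lemma same_colour_separated:
  assumes z: "z \<in> cell (dyadic n i)" and w: "w \<in> cell (dyadic m j)" and ij: "i < 2 ^ n" "j < 2 ^ m"
    and col: "colour n i = colour m j" and ne: "(n, i) \<noteq> (m, j)"
  shows "1/2 \<le> pseudohyperbolic z w"
proof -
  have far: "1/2 \<le> pseudohyperbolic z w"
    if z: "z \<in> cell (dyadic n i)" and w: "w \<in> cell (dyadic m j)" and "n < m" "n mod 5 = m mod 5" for z w n m i j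
  proof -
    obtain d where d: "m = n + 5 * d" "0 < d"
      using \<open>n < m\<close> \<open>n mod 5 = m mod 5\<close> by (metis add.commute less_imp_le mod_eq_nat2E mult.commute nat_neq_iff add_0_right mult_0_right neq0_conv)
    have "(1/2::real) ^ m \<le> (1/2) ^ (n + 5)" using d by (intro power_decreasing) auto
    then have "32 * (1/2::real) ^ m \<le> (1/2) ^ n" by (simp add: power_add power_one_over)
    then show ?thesis using z w by (intro pseudohyperbolic_ge_half_of_height_ratio) (auto simp: cell_def)
  qed
  show ?thesis
  proof (cases n m rule: linorder_cases)
    case less then show ?thesis using far[OF z w] col by (simp add: colour_def)
  next
    case greater then show ?thesis using far[OF w z] col by (simp add: colour_def pseudohyperbolic_commute[of z])
  next
    case equal
    define h where "h = (1/2::real) ^ n"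
    have h: "0 < h" "h * 2 ^ n = 1" by (simp_all add: h_def power_one_over)
    have zw: "norm z < 1" "norm w < 1" "1 - norm z \<le> h" "1 - norm w \<le> h" "angle z \<in> dyadic n i" "angle w \<in> dyadic n j"
      using z w equal by (auto simp: cell_def h_def)
    obtain k :: int where k: "\<bar>angle w - angle z - of_int k\<bar> \<le> norm (turn (angle w) - turn (angle z))"
      by (rule turn_diff_ge)
    have "15 \<le> \<bar>(angle w - angle z - of_int k) * 2 ^ n\<bar>"
    proof -
      have a: "\<bar>angle z * 2 ^ n - real i\<bar> < 1" "\<bar>angle w * 2 ^ n - real j\<bar> < 1"
          "0 \<le> angle z * 2 ^ n - real i" "0 \<le> angle w * 2 ^ n - real j"
        using zw(5,6) by (auto simp: dyadic_def field_simps)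
      \<comment> \<open>The difference of the positions, taken modulo a full turn; it is a non-zero
        multiple of 16.\<close>
      define D where "D = int j - int i - k * 2 ^ n"
      have "16 \<le> \<bar>D\<bar>"
      proof -
        have "i \<noteq> j" using ne equal by simp
        have lt: "\<bar>int j - int i\<bar> < 2 ^ n"
        proof -
          have "int i < int (2 ^ n)" "int j < int (2 ^ n)" using ij equal by (simp_all only: of_nat_less_iff)
          then have "int i < 2 ^ n" "int j < 2 ^ n" by (simp_all only: of_nat_power of_nat_numeral)
          then show ?thesis by linarith
        qed
        have "D \<noteq> 0"
        proof
          assume "D = 0"
          then have eq: "int j - int i = k * 2 ^ n" by (simp add: D_def)
          then have "k \<noteq> 0" using \<open>i \<noteq> j\<close> by auto
          then have "1 * (2::int) ^ n \<le> \<bar>k\<bar> * 2 ^ n" by (intro mult_right_mono) auto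
          then show False using lt eq by (simp add: abs_mult)
        qed
        moreover have "(16::int) dvd D"
        proof (cases "4 \<le> n")
          case True
          then have "(16::int) dvd 2 ^ n" using le_imp_power_dvd[of 4 n "2::int"] by simp
          moreover have "(16::int) dvd int j - int i"
          proof -
            have "int j mod 16 = int i mod 16" using col by (simp add: colour_def) (metis of_nat_mod of_nat_numeral)
            then show ?thesis by (simp add: mod_eq_dvd_iff)
          qed
          ultimately show ?thesis unfolding D_def by (intro dvd_diff[of _ "int j - int i"] dvd_mult)
        next
          case False
          have "(2::nat) ^ n \<le> 2 ^ 4" using False by (intro power_increasing) auto
          then have "i < 16" "j < 16" using ij equal by auto
          then show ?thesis using col \<open>i \<noteq> j\<close> by (simp add: colour_def)
        qed
        ultimately show ?thesis using dvd_imp_le_int by fastforce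
      qed
      then have "16 \<le> \<bar>real_of_int D\<bar>" by linarith
      moreover have "(angle w - angle z - of_int k) * 2 ^ n
          = real_of_int D + (angle w * 2 ^ n - real j) - (angle z * 2 ^ n - real i)"
        by (simp add: D_def algebra_simps)
      ultimately show ?thesis using a by linarith
    qed
    then have "15 * h \<le> \<bar>(angle w - angle z - of_int k) * 2 ^ n\<bar> * h" using h(1) by (intro mult_right_mono) auto
    also have "\<dots> = \<bar>angle w - angle z - of_int k\<bar>" using h by (simp add: abs_mult mult_ac)
    also have "\<dots> \<le> 2 * norm (1 - cnj z * w)"
      using k norm_one_minus_cnj_mult_ge_turn[of z w "angle z" "angle w"] zw angle(3) by fastforce
    finally have big: "4 * h \<le> norm (1 - cnj z * w)" using h(1) by linarith
    have "disc_kernel z w \<le> (2 * h) * (2 * h) / (4 * h)\<^sup>2"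
      unfolding disc_kernel_def
    proof (intro frac_le mult_mono power_mono big)
      show "defect z \<le> 2 * h" by (rule order_trans[OF defect_bounds(2)[OF zw(1)]]) (use zw(3) in simp)
      show "defect w \<le> 2 * h" by (rule order_trans[OF defect_bounds(2)[OF zw(2)]]) (use zw(4) in simp)
    qed (use h(1) zw defect_nonneg in auto)
    also have "\<dots> = 1/4" using h(1) by (simp add: power2_eq_square)
    finally have "(1/2)\<^sup>2 \<le> (pseudohyperbolic z w)\<^sup>2"
      using pseudohyperbolic_sq[OF zw(1,2)] by (simp add: power2_eq_square)
    then show ?thesis by (rule power2_le_imp_le[OF _ pseudohyperbolic_nonneg])
  qed
qed

section \<open>Boundedness of the weighted pushforward\<close>

text \<open>
  Points of the family in a disc of radius y centred at the circle have arcs of length at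
  most 2y at distance at most 2y from the centre. The private parts of these arcs are
  disjoint and fill at least half of the arcs, so the length of the enlarged window bounds
  the total.
\<close>

lemma sparse_cell_points_carleson_family:
  assumes F: "\<F> \<subseteq> dyadic_family N"
    and E: "\<And>Q. Q \<in> \<F> \<Longrightarrow> E Q \<subseteq> Q" "\<And>Q. Q \<in> \<F> \<Longrightarrow> E Q \<in> fmeasurable lborel"
      "\<And>Q. Q \<in> \<F> \<Longrightarrow> measure lborel Q \<le> 2 * measure lborel (E Q)" "disjoint_family_on E \<F>"
    and z: "\<And>Q. Q \<in> \<F> \<Longrightarrow> z Q \<in> cell Q"
    and sep: "\<And>P Q. P \<in> \<F> \<Longrightarrow> Q \<in> \<F> \<Longrightarrow> P \<noteq> Q \<Longrightarrow> 1/2 \<le> pseudohyperbolic (z P) (z Q)"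
  shows "carleson_family (1/2) 96 (z ` \<F>)"
  unfolding carleson_family_def
proof (intro conjI ballI impI allI)
  have fin: "finite \<F>" using F finite_dyadic_family finite_subset by blast
  then show "finite (z ` \<F>)" by simp
  have disc: "norm (z Q) < 1" if "Q \<in> \<F>" for Q using z[OF that] by (simp add: cell_def)
  then show "z ` \<F> \<subseteq> unit_disc" by auto
  show "1/2 \<le> pseudohyperbolic u v" if "u \<in> z ` \<F>" "v \<in> z ` \<F>" "u \<noteq> v" for u v
    using that sep by auto
  have inj: "inj_on z \<F>"
  proof (rule inj_onI, rule ccontr)
    fix P Q assume "P \<in> \<F>" "Q \<in> \<F>" "z P = z Q" "P \<noteq> Q"
    then show False using sep[of P Q] by simp
  qed
  fix \<zeta> :: complex and y :: real assume y: "norm \<zeta> = 1" "0 < y"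
  define H where "H = {Q\<in>\<F>. norm (z Q - \<zeta>) \<le> y}"
  have H: "H \<subseteq> \<F>" "finite H" using fin by (auto simp: H_def)
  obtain c where c: "0 \<le> c" "c < 1" "\<zeta> = turn c" using sphere_turn[OF y(1)] by blast
  have "ball_mass (\<lambda>z. z) \<zeta> y (z ` \<F>) = (\<Sum>u\<in>z ` H. defect u)"
    by (rule sum.cong) (auto simp: H_def)
  also have "\<dots> = (\<Sum>Q\<in>H. defect (z Q))"
    by (rule sum.reindex[unfolded o_def]) (rule inj_on_subset[OF inj H(1)])
  also have "\<dots> \<le> (\<Sum>Q\<in>H. 4 * measure lborel (E Q))"
  proof (rule sum_mono)
    fix Q assume "Q \<in> H"
    then have Q: "Q \<in> \<F>" using H by blast
    have "1 - norm (z Q) \<le> 2 * measure lborel (E Q)" using z[OF Q] E(3)[OF Q] by (simp add: cell_def)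
    then have "2 * (1 - norm (z Q)) \<le> 4 * measure lborel (E Q)" by simp
    then show "defect (z Q) \<le> 4 * measure lborel (E Q)"
      by (rule order_trans[OF defect_bounds(2)[OF disc[OF Q]]])
  qed
  also have "\<dots> = 4 * (\<Sum>Q\<in>H. measure lborel (E Q))" by (simp add: sum_distrib_left)
  also have "(\<Sum>Q\<in>H. measure lborel (E Q)) = measure lborel (\<Union>Q\<in>H. E Q)"
  proof (rule measure_UNION'[symmetric, OF H(2)])
    show "E Q \<in> fmeasurable lborel" if "Q \<in> H" for Q using E(2) H(1) that by blast
    show "pairwise (\<lambda>P Q. disjnt (E P) (E Q)) H"
      using E(4) H(1) unfolding pairwise_def disjnt_def disjoint_family_on_def by blast
  qed
  also have "measure lborel (\<Union>Q\<in>H. E Q) \<le> 24 * y"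
  proof -
    let ?I = "\<lambda>k. {c + k - 4 * y .. c + k + 4 * y}"
    have UEm: "(\<Union>Q\<in>H. E Q) \<in> sets lborel"
      by (rule sets.finite_UN[OF H(2)], rule fmeasurableD, rule E(2)) (use H(1) in blast)
    show ?thesis
    proof (cases "1 \<le> 2 * y")
      case True
      have "(\<Union>Q\<in>H. E Q) \<subseteq> {0..1}"
      proof
        fix x assume "x \<in> (\<Union>Q\<in>H. E Q)"
        then obtain Q where "Q \<in> \<F>" "x \<in> Q" using E(1) H(1) by blast
        then obtain n i where "i < 2 ^ n" "x \<in> dyadic n i" using F by (auto simp: dyadic_family_def)
        then show "x \<in> {0..1}" using dyadic_subset_unit[of i n] by auto
      qed
      then have "measure lborel (\<Union>Q\<in>H. E Q) \<le> measure lborel {0..1::real}"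
        by (intro measure_mono_fmeasurable UEm fmeasurable_compact) auto
      then show ?thesis using True by simp
    next
      case False
      \<comment> \<open>The window around c may wrap around the end points of the unit interval.\<close>
      have "(\<Union>Q\<in>H. E Q) \<subseteq> (?I (- 1) \<union> ?I 0) \<union> ?I 1"
      proof
        fix x assume "x \<in> (\<Union>Q\<in>H. E Q)"
        then obtain Q where Q: "Q \<in> H" "Q \<in> \<F>" "x \<in> Q" using E(1) H(1) by blast
        let ?a = "angle (z Q)"
        have cellQ: "?a \<in> Q" "1 - norm (z Q) \<le> measure lborel Q" "measure lborel Q < 2 * (1 - norm (z Q))"
          using z[OF Q(2)] by (auto simp: cell_def)
        have near: "norm (z Q - \<zeta>) \<le> y" using Q(1) by (simp add: H_def)
        then have h: "1 - norm (z Q) \<le> y"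
          using norm_triangle_ineq2[of \<zeta> "z Q"] y(1) by (simp add: norm_minus_commute)
        have "norm (turn ?a - turn c) \<le> 2 * y"
          using norm_triangle_ineq[of "turn ?a - z Q" "z Q - \<zeta>"] norm_turn_diff_polar[OF angle(3) disc[OF Q(2)]] h near c(3) by simp
        then obtain k :: int where k: "\<bar>?a - c - of_int k\<bar> \<le> 2 * y" using turn_diff_ge[of ?a c] by (meson order_trans)
        have "\<bar>x - ?a\<bar> \<le> measure lborel Q"
        proof -
          obtain n i where "Q = dyadic n i" using F Q(2) by (auto simp: dyadic_family_def)
          moreover have "(real i + 1) / 2 ^ n - real i / 2 ^ n = (1/2) ^ n" by (simp add: diff_divide_distrib[symmetric] power_one_over)
          ultimately show ?thesis using Q(3) cellQ(1) by (auto simp: dyadic_def[of n i] abs_le_iff)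
        qed
        moreover have "2 * (1 - norm (z Q)) \<le> 2 * y" using h by simp
        ultimately have x: "\<bar>x - ?a\<bar> \<le> 2 * y" using cellQ(3) by linarith
        have "\<bar>real_of_int k\<bar> < 2" using k False c(1,2) angle(1,2)[of "z Q"] by linarith
        then have "k = - 1 \<or> k = 0 \<or> k = 1" by linarith
        moreover have "x \<in> ?I (of_int k)" using x k by (simp add: abs_le_iff)
        ultimately show "x \<in> (?I (- 1) \<union> ?I 0) \<union> ?I 1" by auto
      qed
      then have "measure lborel (\<Union>Q\<in>H. E Q) \<le> measure lborel ((?I (- 1) \<union> ?I 0) \<union> ?I 1)"
        by (intro measure_mono_fmeasurable UEm fmeasurable_compact compact_Un compact_Icc)
      also have "\<dots> \<le> measure lborel (?I (- 1) \<union> ?I 0) + measure lborel (?I 1)"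
        by (rule measure_Un_le) auto
      also have "measure lborel (?I (- 1) \<union> ?I 0) \<le> measure lborel (?I (- 1)) + measure lborel (?I 0)"
        by (rule measure_Un_le) auto
      finally show ?thesis using y(2) by simp
    qed
  qed
  finally show "ball_mass (\<lambda>z. z) \<zeta> y (z ` \<F>) \<le> 96 * y" by simp
qed

text \<open>
  The supremum over a cell need not be attained, and a factor 2 is harmless.
\<close>

lemma exists_almost_maximal:
  fixes q :: "'a \<Rightarrow> real"
  assumes "S \<noteq> {}" "\<And>w. w \<in> S \<Longrightarrow> 0 < q w" "\<And>w. w \<in> S \<Longrightarrow> q w \<le> B"
  shows "\<exists>z\<in>S. \<forall>w\<in>S. q w \<le> 2 * q z"
proof -
  have bdd: "bdd_above (q ` S)" using assms(3) by (auto simp: bdd_above_def)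
  have le: "q w \<le> Sup (q ` S)" if "w \<in> S" for w using bdd that by (intro cSup_upper) auto
  obtain w0 where "w0 \<in> S" using assms(1) by blast
  then have "0 < Sup (q ` S)" using assms(2)[of w0] le[of w0] by linarith
  then have "Sup (q ` S) / 2 < Sup (q ` S)" by simp
  then have "\<exists>x\<in>q ` S. Sup (q ` S) / 2 < x"
    using less_cSup_iff[OF _ bdd, of "Sup (q ` S) / 2"] assms(1) by blast
  then obtain z where "z \<in> S" "Sup (q ` S) / 2 < q z" by blast
  then show ?thesis using le by (intro bexI[of _ z]) force+
qed

text \<open>
  There are 80 colours, and each colour class is separated.
\<close>

lemma box_mass_cell_points_le:
  assumes C0: "\<And>F. carleson_family (1/2) 96 F \<Longrightarrow> box_mass \<Phi> I F \<le> C"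
    and F: "\<F> \<subseteq> dyadic_family N"
    and E: "\<And>Q. Q \<in> \<F> \<Longrightarrow> E Q \<subseteq> Q" "\<And>Q. Q \<in> \<F> \<Longrightarrow> E Q \<in> fmeasurable lborel"
      "\<And>Q. Q \<in> \<F> \<Longrightarrow> measure lborel Q \<le> 2 * measure lborel (E Q)" "disjoint_family_on E \<F>"
    and z: "\<And>Q. Q \<in> \<F> \<Longrightarrow> z Q \<in> cell Q" "\<And>Q. Q \<in> \<F> \<Longrightarrow> \<Phi> (z Q) \<in> carleson_box I"
  shows "(\<Sum>Q\<in>\<F>. defect (\<Phi> (z Q))) \<le> 80 * C"
proof -
  have fin: "finite \<F>" using F finite_dyadic_family finite_subset by blast
  have "\<forall>Q\<in>\<F>. \<exists>p. Q = dyadic (fst p) (snd p) \<and> snd p < 2 ^ fst p"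
  proof
    fix Q assume "Q \<in> \<F>"
    then obtain n i where "Q = dyadic n i" "i < 2 ^ n" using F by (auto simp: dyadic_family_def)
    then show "\<exists>p. Q = dyadic (fst p) (snd p) \<and> snd p < 2 ^ fst p" by (intro exI[of _ "(n, i)"]) simp
  qed
  then obtain p where p: "\<And>Q. Q \<in> \<F> \<Longrightarrow> Q = dyadic (fst (p Q)) (snd (p Q))" "\<And>Q. Q \<in> \<F> \<Longrightarrow> snd (p Q) < 2 ^ fst (p Q)"
    by metis
  define col where "col Q = colour (fst (p Q)) (snd (p Q))" for Q
  let ?C = "{..<5::nat} \<times> {..<16::nat}"
  have "(\<Sum>Q\<in>\<F>. defect (\<Phi> (z Q))) = (\<Sum>c\<in>?C. \<Sum>Q\<in>{Q\<in>\<F>. col Q = c}. defect (\<Phi> (z Q)))"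
    by (rule sum.group[symmetric, OF fin]) (auto simp: col_def colour_def)
  also have "\<dots> \<le> (\<Sum>c\<in>?C. C)"
  proof (rule sum_mono)
    fix c
    let ?G = "{Q\<in>\<F>. col Q = c}"
    have sep: "1/2 \<le> pseudohyperbolic (z P) (z Q)" if "P \<in> ?G" "Q \<in> ?G" "P \<noteq> Q" for P Q
    proof (rule same_colour_separated)
      have PQ: "P \<in> \<F>" "Q \<in> \<F>" using that by auto
      show "z P \<in> cell (dyadic (fst (p P)) (snd (p P)))" using z(1)[OF PQ(1)] p(1)[OF PQ(1)] by simp
      show "z Q \<in> cell (dyadic (fst (p Q)) (snd (p Q)))" using z(1)[OF PQ(2)] p(1)[OF PQ(2)] by simp
      show "snd (p P) < 2 ^ fst (p P)" "snd (p Q) < 2 ^ fst (p Q)" using p(2) PQ by auto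
      show "colour (fst (p P)) (snd (p P)) = colour (fst (p Q)) (snd (p Q))" using that by (simp add: col_def)
      show "(fst (p P), snd (p P)) \<noteq> (fst (p Q), snd (p Q))" using p(1)[OF PQ(1)] p(1)[OF PQ(2)] that(3) by auto
    qed
    have "carleson_family (1/2) 96 (z ` ?G)"
    proof (rule sparse_cell_points_carleson_family[where E = E and N = N])
      show "disjoint_family_on E ?G" using E(4) by (rule disjoint_family_on_mono[rotated]) auto
    qed (use F E z sep in auto)
    then have "box_mass \<Phi> I (z ` ?G) \<le> C" by (rule C0)
    moreover have "{u\<in>z ` ?G. \<Phi> u \<in> carleson_box I} = z ` ?G" using z(2) by auto
    moreover have "inj_on z ?G"
    proof (rule inj_onI, rule ccontr)
      fix P Q assume "P \<in> ?G" "Q \<in> ?G" "z P = z Q" "P \<noteq> Q"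
      then show False using sep[of P Q] by simp
    qed
    then have "(\<Sum>u\<in>z ` ?G. defect (\<Phi> u)) = (\<Sum>Q\<in>?G. defect (\<Phi> (z Q)))"
      by (rule sum.reindex[unfolded o_def])
    ultimately show "(\<Sum>Q\<in>?G. defect (\<Phi> (z Q))) \<le> C" by simp
  qed
  also have "\<dots> = 80 * C" by simp
  finally show ?thesis .
qed

text \<open>
  The truncation to finitely many levels of cells makes the weight bounded and the family of
  arcs finite, but does not enter the constant. The part of the weight below the height |I|
  is integrated trivially, which is why the heights start at \<epsilon>=|I|.
\<close>

lemma truncated_pushforward_bound:
  fixes N :: nat
  assumes map: "\<Phi> ` unit_disc \<subseteq> unit_disc" and \<mu>: "sets \<mu> = sets disc_borel" "carleson_norm \<mu> = ennreal m" "0 \<le> m"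
    and I: "I \<in> carleson_arcs"
    and C0: "\<And>F. carleson_family (1/2) 96 F \<Longrightarrow> box_mass \<Phi> I F \<le> C0 * arc_measure I" and "0 \<le> C0"
  defines "U \<equiv> {w\<in>unit_disc. (1/2) ^ N \<le> 1 - norm w \<and> \<Phi> w \<in> carleson_box I}"
  shows "(\<integral>\<^sup>+w. ennreal (conformal_weight \<Phi> w) * indicator U w \<partial>\<mu>) \<le> ennreal (m * arc_measure I * (1 + 2560 * C0))"
proof -
  define \<epsilon> where "\<epsilon> = arc_measure I"
  define q where "q = conformal_weight \<Phi>"
  have \<epsilon>: "0 < \<epsilon>" using carleson_arc_measure_pos[OF I] by (simp add: \<epsilon>_def)
  have disc: "norm w < 1" "norm (\<Phi> w) < 1" if "w \<in> U" for w
    using that map by (auto simp: U_def image_subset_iff)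
  have qpos: "0 < q w" if "w \<in> U" for w
    unfolding q_def conformal_weight_def using disc[OF that] by (intro divide_pos_pos defect_pos)
  have qle: "q w \<le> 2 ^ N" if "w \<in> U" for w
  proof -
    have "(1/2) ^ N \<le> defect w"
      using defect_bounds(1)[OF disc(1)[OF that]] that by (simp add: U_def)
    then have "q w \<le> 1 / (1/2) ^ N"
      unfolding q_def conformal_weight_def using disc[OF that] by (intro frac_le) auto
    then show ?thesis by (simp add: power_one_over)
  qed
  obtain K :: nat where K: "2 * 2 ^ N / \<epsilon> < 4 ^ K" using real_arch_pow[of 4] by auto
  then have K: "2 * 2 ^ N \<le> \<epsilon> * 4 ^ K" using \<epsilon> by (simp add: divide_less_eq mult.commute)
  have "\<exists>z. \<forall>Q. cell Q \<inter> U \<noteq> {} \<longrightarrow> z Q \<in> cell Q \<inter> U \<and> (\<forall>w\<in>cell Q \<inter> U. q w \<le> 2 * q (z Q))"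
  proof (intro choice allI)
    fix Q
    show "\<exists>z. cell Q \<inter> U \<noteq> {} \<longrightarrow> z \<in> cell Q \<inter> U \<and> (\<forall>w\<in>cell Q \<inter> U. q w \<le> 2 * q z)"
      using exists_almost_maximal[of "cell Q \<inter> U" q "2 ^ N"] qpos qle by (cases "cell Q \<inter> U = {}") auto
  qed
  then obtain z where z: "\<And>Q. cell Q \<inter> U \<noteq> {} \<Longrightarrow> z Q \<in> cell Q \<inter> U"
    "\<And>Q w. w \<in> cell Q \<Longrightarrow> w \<in> U \<Longrightarrow> q w \<le> 2 * q (z Q)" by blast
  \<comment> \<open>This dominates the weight on the part of the cell in U.\<close>
  define g where "g Q = (if cell Q \<inter> U = {} then 0 else 2 * q (z Q))" for Q
  let ?Q = "dyadic_family N"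
  let ?T = "\<lambda>k. top_sets ?Q g (\<epsilon> * 4 ^ k)"
  have gK: "g Q \<le> \<epsilon> * 4 ^ K" for Q
  proof (cases "cell Q \<inter> U = {}")
    case False
    then have "q (z Q) \<le> 2 ^ N" using z(1) qle by blast
    then show ?thesis using K False by (simp add: g_def)
  qed (use \<epsilon> in \<open>simp add: g_def\<close>)
  have fmQ: "Q \<in> fmeasurable lborel" "0 < measure lborel Q" if "Q \<in> ?Q" for Q
    using that dyadic_fmeasurable by (auto simp: dyadic_family_def)
  obtain \<F> E where \<F>: "\<F> \<subseteq> ?Q" "\<And>Q. Q \<in> \<F> \<Longrightarrow> 0 < g Q"
    and E: "\<And>Q. Q \<in> \<F> \<Longrightarrow> E Q \<subseteq> Q" "\<And>Q. Q \<in> \<F> \<Longrightarrow> E Q \<in> fmeasurable lborel"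
      "\<And>Q. Q \<in> \<F> \<Longrightarrow> measure lborel Q \<le> 2 * measure lborel (E Q)" "disjoint_family_on E \<F>"
    and S: "(\<Sum>k<K. \<epsilon> * 4 ^ k * (\<Sum>Q\<in>?T k. measure lborel Q)) \<le> 2 * (\<Sum>Q\<in>\<F>. g Q * measure lborel Q)"
  proof (rule laminar_sparse_subfamily[of ?Q lborel \<epsilon> g K], goal_cases)
    case (7 \<F> E)
    show ?case by (rule that[of \<F> E]) (fact 7)+
  qed (use finite_dyadic_family dyadic_family_laminar fmQ \<epsilon> gK in auto)
  have z\<F>: "z Q \<in> cell Q" "z Q \<in> U" if "Q \<in> \<F>" for Q
    using z(1)[of Q] \<F>(2)[OF that] by (auto simp: g_def split: if_splits)
  have score: "(\<Sum>Q\<in>\<F>. g Q * measure lborel Q) \<le> 320 * C0 * \<epsilon>"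
  proof -
    have "(\<Sum>Q\<in>\<F>. g Q * measure lborel Q) \<le> (\<Sum>Q\<in>\<F>. 4 * (defect (\<Phi> (z Q))))"
    proof (rule sum_mono)
      fix Q assume Q: "Q \<in> \<F>"
      have g: "g Q = 2 * q (z Q)" using \<F>(2)[OF Q] by (auto simp: g_def split: if_splits)
      have "measure lborel Q \<le> 2 * defect (z Q)"
        using z\<F>(1)[OF Q] defect_bounds(1)[OF disc(1)[OF z\<F>(2)[OF Q]]] by (simp add: cell_def)
      then have "g Q * measure lborel Q \<le> 2 * q (z Q) * (2 * defect (z Q))"
        unfolding g using qpos[OF z\<F>(2)[OF Q]] by (intro mult_left_mono) auto
      also have "\<dots> = 4 * (defect (\<Phi> (z Q)))"
      proof -
        have "2 * (a / x) * (2 * x) = 4 * a" if "0 < x" for a x :: real using that by simp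
        from this[OF defect_pos[OF disc(1)[OF z\<F>(2)[OF Q]]]] show ?thesis
          unfolding q_def conformal_weight_def .
      qed
      finally show "g Q * measure lborel Q \<le> 4 * (defect (\<Phi> (z Q)))" .
    qed
    also have "\<dots> = 4 * (\<Sum>Q\<in>\<F>. defect (\<Phi> (z Q)))" by (simp only: sum_distrib_left)
    also have "(\<Sum>Q\<in>\<F>. defect (\<Phi> (z Q))) \<le> 80 * (C0 * arc_measure I)"
      by (rule box_mass_cell_points_le[OF C0 \<F>(1) E z\<F>(1)]) (use z\<F>(2) in \<open>auto simp: U_def\<close>)
    finally show ?thesis by (simp add: \<epsilon>_def)
  qed
  have "\<forall>Q\<in>?Q. \<exists>A. A \<in> carleson_arcs \<and> arc_measure A = measure lborel Q \<and>
    (\<forall>w. norm w < 1 \<longrightarrow> angle w \<in> Q \<longrightarrow> 1 - norm w \<le> measure lborel Q \<longrightarrow> w \<in> carleson_box A)"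
    by (meson dyadic_box)
  then obtain A where A: "\<And>Q. Q \<in> ?Q \<Longrightarrow> A Q \<in> carleson_arcs" "\<And>Q. Q \<in> ?Q \<Longrightarrow> arc_measure (A Q) = measure lborel Q"
    "\<And>Q w. Q \<in> ?Q \<Longrightarrow> norm w < 1 \<Longrightarrow> angle w \<in> Q \<Longrightarrow> 1 - norm w \<le> measure lborel Q \<Longrightarrow> w \<in> carleson_box (A Q)"
    by metis
  have TQ: "?T k \<subseteq> ?Q" "finite (?T k)" for k
    using finite_dyadic_family[of N] by (auto simp: top_sets_def)
  let ?t = "\<lambda>k Q w. ennreal (4 * (\<epsilon> * 4 ^ k)) * indicator (carleson_box (A Q)) w"
  have boxm: "carleson_box (A Q) \<in> sets \<mu>" if "Q \<in> ?T k" for Q k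
    using carleson_box_measurable A(1) TQ that \<mu>(1) by blast
  \<comment> \<open>Layer by layer, the weight is dominated by multiples of indicators of Carleson boxes.\<close>
  have point: "ennreal (q w) * indicator U w \<le> ennreal \<epsilon> + (\<Sum>k<K. \<Sum>Q\<in>?T k. ?t k Q w)" for w
  proof (cases "w \<in> U \<and> \<epsilon> < q w")
    case False
    then have "ennreal (q w) * indicator U w \<le> ennreal \<epsilon>" by (auto simp: indicator_def intro: ennreal_leI)
    then show ?thesis by (rule order_trans) simp
  next
    case True
    then have w: "w \<in> U" "\<epsilon> < q w" by auto
    have "\<exists>k<K. \<epsilon> * 4 ^ k < q w \<and> q w \<le> 4 * (\<epsilon> * 4 ^ k)"
    proof -
      have "q w \<le> \<epsilon> * 4 ^ K" using qle[OF w(1)] K by (smt (verit) zero_less_power)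
      then have ex: "q w \<le> \<epsilon> * 4 ^ K" .
      define n where "n = (LEAST n. q w \<le> \<epsilon> * 4 ^ n)"
      have n1: "q w \<le> \<epsilon> * 4 ^ n" unfolding n_def by (rule LeastI[where P = "\<lambda>n. q w \<le> \<epsilon> * 4 ^ n", OF ex])
      have n2: "n \<le> K" unfolding n_def by (rule Least_le[where P = "\<lambda>n. q w \<le> \<epsilon> * 4 ^ n", OF ex])
      obtain k where k: "n = Suc k" using n1 w(2) by (cases n) auto
      have "\<not> q w \<le> \<epsilon> * 4 ^ k" by (rule not_less_Least) (simp only: n_def[symmetric] k lessI)
      then show ?thesis using n1 n2 k by (intro exI[of _ k]) auto
    qed
    then obtain k where k: "k < K" "\<epsilon> * 4 ^ k < q w" "q w \<le> 4 * (\<epsilon> * 4 ^ k)" by blast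
    have "(1/2) ^ N \<le> 1 - norm w" using w(1) by (simp add: U_def)
    then obtain Q0 where Q0: "Q0 \<in> ?Q" "w \<in> cell Q0" using exists_cell[OF disc(1)[OF w(1)]] by blast
    have "q w \<le> g Q0" using z(2)[OF Q0(2) w(1)] Q0(2) w(1) by (auto simp: g_def)
    then have "\<epsilon> * 4 ^ k < g Q0" using k(2) by linarith
    then obtain P where P: "P \<in> ?T k" "Q0 \<subseteq> P" using exists_top_set[OF finite_dyadic_family Q0(1)] by blast
    have PQ: "P \<in> ?Q" using P(1) TQ by blast
    have "measure lborel Q0 \<le> measure lborel P"
      using fmQ(1)[OF PQ] fmQ(1)[OF Q0(1)] P(2) by (intro measure_mono_fmeasurable) (auto dest: fmeasurableD)
    then have "w \<in> carleson_box (A P)"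
      using Q0(2) P(2) by (intro A(3)[OF PQ]) (auto simp: cell_def)
    then have "ennreal (q w) * indicator U w \<le> ?t k P w" using k(3) w(1) by (simp add: ennreal_leI)
    also have "\<dots> \<le> (\<Sum>Q\<in>?T k. ?t k Q w)" by (rule member_le_sum[OF P(1)]) (use TQ in auto)
    also have "\<dots> \<le> (\<Sum>k<K. \<Sum>Q\<in>?T k. ?t k Q w)"
      by (rule member_le_sum[of k "{..<K}" "\<lambda>k. \<Sum>Q\<in>?T k. ?t k Q w"]) (use k(1) in auto)
    finally show ?thesis by (simp add: add_increasing)
  qed
  have total: "emeasure \<mu> (space \<mu>) \<le> ennreal m"
  proof -
    have "space \<mu> = carleson_box unit_circle" using sets_eq_imp_space_eq[OF \<mu>(1)] by (simp add: carleson_box_circle)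
    then show ?thesis using emeasure_carleson_box_le[OF circle_in_carleson_arcs, of \<mu>] \<mu>(2) by (simp add: arc_measure_circle)
  qed
  have "(\<integral>\<^sup>+w. ennreal (conformal_weight \<Phi> w) * indicator U w \<partial>\<mu>)
      \<le> (\<integral>\<^sup>+w. ennreal \<epsilon> + (\<Sum>k<K. \<Sum>Q\<in>?T k. ?t k Q w) \<partial>\<mu>)"
    using point by (intro nn_integral_mono) (simp add: q_def)
  also have "\<dots> = ennreal \<epsilon> * emeasure \<mu> (space \<mu>) + (\<Sum>k<K. \<Sum>Q\<in>?T k. ennreal (4 * (\<epsilon> * 4 ^ k)) * emeasure \<mu> (carleson_box (A Q)))"
  proof -
    have t: "?t k Q \<in> borel_measurable \<mu>" if "Q \<in> ?T k" for k Q
      by (rule borel_measurable_times_ennreal[OF _ borel_measurable_indicator[OF boxm[OF that]]]) simp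
    have sum_t: "(\<lambda>w. \<Sum>Q\<in>?T k. ?t k Q w) \<in> borel_measurable \<mu>" for k
      by (rule borel_measurable_sum) (rule t)
    have "(\<integral>\<^sup>+w. ennreal \<epsilon> + (\<Sum>k<K. \<Sum>Q\<in>?T k. ?t k Q w) \<partial>\<mu>)
        = (\<integral>\<^sup>+w. ennreal \<epsilon> \<partial>\<mu>) + (\<integral>\<^sup>+w. (\<Sum>k<K. \<Sum>Q\<in>?T k. ?t k Q w) \<partial>\<mu>)"
      by (rule nn_integral_add) (simp, rule borel_measurable_sum, rule sum_t)
    also have "(\<integral>\<^sup>+w. (\<Sum>k<K. \<Sum>Q\<in>?T k. ?t k Q w) \<partial>\<mu>) = (\<Sum>k<K. \<integral>\<^sup>+w. (\<Sum>Q\<in>?T k. ?t k Q w) \<partial>\<mu>)"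
      by (rule nn_integral_sum) (rule sum_t)
    also have "\<dots> = (\<Sum>k<K. \<Sum>Q\<in>?T k. \<integral>\<^sup>+w. ?t k Q w \<partial>\<mu>)"
      by (intro sum.cong refl nn_integral_sum t)
    also have "\<dots> = (\<Sum>k<K. \<Sum>Q\<in>?T k. ennreal (4 * (\<epsilon> * 4 ^ k)) * emeasure \<mu> (carleson_box (A Q)))"
      by (intro sum.cong refl nn_integral_cmult_indicator boxm)
    finally show ?thesis by simp
  qed
  also have "\<dots> \<le> ennreal \<epsilon> * ennreal m + (\<Sum>k<K. \<Sum>Q\<in>?T k. ennreal (4 * (\<epsilon> * 4 ^ k)) * ennreal (m * measure lborel Q))"
  proof (intro add_mono mult_left_mono sum_mono total)
    fix k Q assume "Q \<in> ?T k"
    then have Q: "Q \<in> ?Q" using TQ by blast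
    show "emeasure \<mu> (carleson_box (A Q)) \<le> ennreal (m * measure lborel Q)"
      using emeasure_carleson_box_le[OF A(1)[OF Q], of \<mu>] \<mu>(2,3) A(2)[OF Q] by (simp add: ennreal_mult)
  qed auto
  also have "\<dots> = ennreal (m * \<epsilon> + (\<Sum>k<K. \<Sum>Q\<in>?T k. 4 * (\<epsilon> * 4 ^ k) * (m * measure lborel Q)))"
    using \<epsilon> \<mu>(3) by (simp add: ennreal_mult[symmetric] sum_nonneg mult.commute)
  also have "\<dots> \<le> ennreal (m * arc_measure I * (1 + 2560 * C0))"
  proof (rule ennreal_leI)
    have "(\<Sum>k<K. \<Sum>Q\<in>?T k. 4 * (\<epsilon> * 4 ^ k) * (m * measure lborel Q))
        = 4 * m * (\<Sum>k<K. \<epsilon> * 4 ^ k * (\<Sum>Q\<in>?T k. measure lborel Q))"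
      by (simp add: sum_distrib_left mult_ac)
    also have "\<dots> \<le> 4 * m * (640 * C0 * \<epsilon>)" using S score \<mu>(3) by (intro mult_left_mono) auto
    finally show "m * \<epsilon> + (\<Sum>k<K. \<Sum>Q\<in>?T k. 4 * (\<epsilon> * 4 ^ k) * (m * measure lborel Q)) \<le> m * arc_measure I * (1 + 2560 * C0)"
      by (simp add: \<epsilon>_def algebra_simps)
  qed
  finally show ?thesis .
qed

text \<open>
  Monotone convergence removes the truncation, as the constant does not depend on it.
\<close>

lemma carleson_preserving_pushforward_bounded:
  assumes cp: "carleson_preserving \<Phi>" and \<Phi>: "continuous_on unit_disc \<Phi>" "\<Phi> ` unit_disc \<subseteq> unit_disc"
  obtains C where "0 \<le> C" "\<And>\<mu>. positive_carleson_measure \<mu> \<Longrightarrow>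
    carleson_norm (weighted_pushforward \<Phi> \<mu>) \<le> ennreal C * carleson_norm \<mu>"
proof -
  obtain C0 where C0: "0 \<le> C0" "\<And>F I. carleson_family (1/2) 96 F \<Longrightarrow> I \<in> carleson_arcs \<Longrightarrow> box_mass \<Phi> I F \<le> C0 * arc_measure I"
    using carleson_family_box_mass_bounded[OF cp \<Phi>(2), of "1/2" 96] by auto
  show ?thesis
  proof (rule that[of "1 + 2560 * C0"])
    show "0 \<le> 1 + 2560 * C0" using C0(1) by simp
    fix \<mu> assume "positive_carleson_measure \<mu>"
    then have \<mu>: "sets \<mu> = sets disc_borel" "carleson_norm \<mu> < \<infinity>" by (auto simp: positive_carleson_measure_def)
    have sp: "space \<mu> = unit_disc" using sets_eq_imp_space_eq[OF \<mu>(1)] by simp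
    obtain m where m: "carleson_norm \<mu> = ennreal m" "0 \<le> m"
      using \<mu>(2) by (cases "carleson_norm \<mu>") auto
    show "carleson_norm (weighted_pushforward \<Phi> \<mu>) \<le> ennreal (1 + 2560 * C0) * carleson_norm \<mu>"
      unfolding carleson_norm_le_iff
    proof
      fix I assume I: "I \<in> carleson_arcs"
      define U where "U N = {w\<in>unit_disc. (1/2) ^ N \<le> 1 - norm w \<and> \<Phi> w \<in> carleson_box I}" for N
      have box: "carleson_box I \<in> sets disc_borel" by (rule carleson_box_measurable[OF I])
      have Um: "U N \<in> sets \<mu>" for N
      proof -
        have "\<Phi> -` carleson_box I \<inter> unit_disc \<in> sets disc_borel"
          using measurable_sets[OF disc_map_measurable[OF \<Phi>] box] by simp
        moreover have "closed {w::complex. (1/2) ^ N \<le> 1 - norm w}" by (intro closed_Collect_le continuous_intros)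
        then have "{w. (1/2) ^ N \<le> 1 - norm w} \<inter> unit_disc \<in> sets disc_borel"
          by (auto simp: sets_restrict_space_iff)
        ultimately have "(\<Phi> -` carleson_box I \<inter> unit_disc) \<inter> ({w. (1/2) ^ N \<le> 1 - norm w} \<inter> unit_disc) \<in> sets disc_borel"
          by (rule sets.Int)
        also have "(\<Phi> -` carleson_box I \<inter> unit_disc) \<inter> ({w. (1/2) ^ N \<le> 1 - norm w} \<inter> unit_disc) = U N"
          by (auto simp: U_def)
        finally show ?thesis using \<mu>(1) by simp
      qed
      have Umono: "U N \<subseteq> U M" if "N \<le> M" for N M
      proof -
        have "(1/2::real) ^ M \<le> (1/2) ^ N" using that by (intro power_decreasing) auto
        then have "(1/2) ^ M \<le> 1 - norm w" if "(1/2) ^ N \<le> 1 - norm w" for w :: complex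
          using that by (rule order_trans)
        then show ?thesis unfolding U_def by blast
      qed
      have qm: "(\<lambda>w. ennreal (conformal_weight \<Phi> w)) \<in> borel_measurable \<mu>"
        using conformal_weight_measurable[OF \<Phi>(1)] by (simp only: measurable_cong_sets[OF \<mu>(1) refl])
      have "emeasure (weighted_pushforward \<Phi> \<mu>) (carleson_box I)
          = (\<integral>\<^sup>+w. ennreal (conformal_weight \<Phi> w) * indicator (carleson_box I) (\<Phi> w) \<partial>\<mu>)"
        by (rule emeasure_weighted_pushforward[OF \<Phi> \<mu>(1) box])
      also have "\<dots> = (\<integral>\<^sup>+w. (SUP N. ennreal (conformal_weight \<Phi> w) * indicator (U N) w) \<partial>\<mu>)"
      proof (rule nn_integral_cong)
        fix w assume "w \<in> space \<mu>"
        then have w: "norm w < 1" using sp by simp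
        show "ennreal (conformal_weight \<Phi> w) * indicator (carleson_box I) (\<Phi> w) = (SUP N. ennreal (conformal_weight \<Phi> w) * indicator (U N) w)"
        proof (cases "\<Phi> w \<in> carleson_box I")
          case True
          obtain N where "(1/2) ^ N < 1 - norm w" using real_arch_pow_inv[of "1 - norm w" "1/2"] w by auto
          then have "w \<in> U N" using True w by (simp add: U_def)
          show ?thesis
          proof (rule antisym)
            show "ennreal (conformal_weight \<Phi> w) * indicator (carleson_box I) (\<Phi> w) \<le> (SUP N. ennreal (conformal_weight \<Phi> w) * indicator (U N) w)"
              using True \<open>w \<in> U N\<close> by (intro SUP_upper2[of N]) auto
            show "(SUP N. ennreal (conformal_weight \<Phi> w) * indicator (U N) w) \<le> ennreal (conformal_weight \<Phi> w) * indicator (carleson_box I) (\<Phi> w)"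
              using True by (intro SUP_least) (auto simp: indicator_def)
          qed
        next
          case False
          then have "w \<notin> U N" for N by (simp add: U_def)
          then show ?thesis using False by simp
        qed
      qed
      also have "\<dots> = (SUP N. \<integral>\<^sup>+w. ennreal (conformal_weight \<Phi> w) * indicator (U N) w \<partial>\<mu>)"
      proof (rule nn_integral_monotone_convergence_SUP)
        show "incseq (\<lambda>N w. ennreal (conformal_weight \<Phi> w) * indicator (U N) w)"
          using Umono by (auto simp: incseq_def le_fun_def indicator_def)
        show "(\<lambda>w. ennreal (conformal_weight \<Phi> w) * indicator (U N) w) \<in> borel_measurable \<mu>" for N
          by (rule borel_measurable_times_ennreal[OF qm borel_measurable_indicator[OF Um]])
      qed
      also have "\<dots> \<le> ennreal (m * arc_measure I * (1 + 2560 * C0))"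
      proof (rule SUP_least)
        fix N
        show "(\<integral>\<^sup>+w. ennreal (conformal_weight \<Phi> w) * indicator (U N) w \<partial>\<mu>) \<le> ennreal (m * arc_measure I * (1 + 2560 * C0))"
          unfolding U_def by (rule truncated_pushforward_bound[OF \<Phi>(2) \<mu>(1) m I C0(2)[OF _ I] C0(1)])
      qed
      also have "\<dots> = (ennreal (1 + 2560 * C0) * carleson_norm \<mu>) * ennreal (arc_measure I)"
        using m C0(1) carleson_arc_measure_pos[OF I] by (simp only: m(1)) (simp add: ennreal_mult[symmetric] mult_ac del: ennreal_plus)
      finally show "emeasure (weighted_pushforward \<Phi> \<mu>) (carleson_box I) \<le> ennreal (1 + 2560 * C0) * carleson_norm \<mu> * ennreal (arc_measure I)" .
    qed
  qed
qed

lemma carleson_preserving_inverse: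
  assumes cp: "carleson_preserving \<Phi>" and hom: "homeomorphism unit_disc unit_disc \<Phi> \<Psi>"
  shows "carleson_preserving \<Psi>"
  unfolding carleson_preserving_def
proof (intro allI impI)
  fix J and l :: "nat \<Rightarrow> complex" assume l: "l ` J \<subseteq> unit_disc"
  have inv: "\<Phi> (\<Psi> z) = z" "\<Psi> z \<in> unit_disc" if "z \<in> unit_disc" for z
    using hom that by (auto simp: homeomorphism_def)
  have "(\<Psi> \<circ> l) ` J \<subseteq> unit_disc" using l inv(2) by auto
  then have "carleson_sequence J (\<Psi> \<circ> l) \<longleftrightarrow> carleson_sequence J (\<Phi> \<circ> (\<Psi> \<circ> l))"
    by (rule carleson_preservingD[OF cp])
  moreover have "(\<Phi> \<circ> (\<Psi> \<circ> l)) j = l j" if "j \<in> J" for j using inv(1)[of "l j"] l that by auto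
  then have "carleson_sequence J (\<Phi> \<circ> (\<Psi> \<circ> l)) \<longleftrightarrow> carleson_sequence J l"
    using carleson_sequence_cong[of J] by metis
  ultimately show "carleson_sequence J l \<longleftrightarrow> carleson_sequence J (\<Psi> \<circ> l)" by simp
qed

section \<open>The equivalence\<close>

theorem theorem2p10:
  fixes \<Phi> :: "complex \<Rightarrow> complex"
  assumes "continuous_on unit_disc \<Phi>" and "\<Phi> ` unit_disc \<subseteq> unit_disc"
  shows
    "(\<forall>(J :: nat set) (l :: nat \<Rightarrow> complex). l ` J \<subseteq> unit_disc \<longrightarrow>
        (carleson_sequence J l \<longleftrightarrow> carleson_sequence J (\<Phi> \<circ> l)))
     \<longleftrightarrow>
     (\<exists>\<Psi>. homeomorphism unit_disc unit_disc \<Phi> \<Psi> \<and>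
        pseudohyperbolic_uniformly_continuous \<Phi> \<and>
        pseudohyperbolic_uniformly_continuous \<Psi> \<and>
        (\<exists>C::real. \<forall>\<mu>. positive_carleson_measure \<mu> \<longrightarrow>
           carleson_norm (weighted_pushforward \<Phi> \<mu>) \<le> ennreal C * carleson_norm \<mu> \<and>
           carleson_norm (weighted_pushforward \<Psi> \<mu>) \<le> ennreal C * carleson_norm \<mu>))"
  unfolding carleson_preserving_def[symmetric]
proof
  assume cp: "carleson_preserving \<Phi>"
  obtain \<Psi> where hom: "homeomorphism unit_disc unit_disc \<Phi> \<Psi>"
    by (rule carleson_preserving_homeomorphism[OF cp assms])
  have cp': "carleson_preserving \<Psi>" by (rule carleson_preserving_inverse[OF cp hom])
  have \<Psi>: "continuous_on unit_disc \<Psi>" "\<Psi> ` unit_disc \<subseteq> unit_disc" using hom by (auto simp: homeomorphism_def)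
  obtain C where C: "0 \<le> C" "\<And>\<mu>. positive_carleson_measure \<mu> \<Longrightarrow>
    carleson_norm (weighted_pushforward \<Phi> \<mu>) \<le> ennreal C * carleson_norm \<mu>"
    using carleson_preserving_pushforward_bounded[OF cp assms] by blast
  obtain D where D: "0 \<le> D" "\<And>\<mu>. positive_carleson_measure \<mu> \<Longrightarrow>
    carleson_norm (weighted_pushforward \<Psi> \<mu>) \<le> ennreal D * carleson_norm \<mu>"
    using carleson_preserving_pushforward_bounded[OF cp' \<Psi>] by blast
  have "ennreal C * c \<le> ennreal (max C D) * c" "ennreal D * c \<le> ennreal (max C D) * c" for c
    by (intro mult_right_mono ennreal_leI; simp)+
  then have "\<forall>\<mu>. positive_carleson_measure \<mu> \<longrightarrow>
      carleson_norm (weighted_pushforward \<Phi> \<mu>) \<le> ennreal (max C D) * carleson_norm \<mu> \<and>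
      carleson_norm (weighted_pushforward \<Psi> \<mu>) \<le> ennreal (max C D) * carleson_norm \<mu>"
    using C(2) D(2) by (meson order_trans)
  then show "\<exists>\<Psi>. homeomorphism unit_disc unit_disc \<Phi> \<Psi> \<and>
        pseudohyperbolic_uniformly_continuous \<Phi> \<and>
        pseudohyperbolic_uniformly_continuous \<Psi> \<and>
        (\<exists>C::real. \<forall>\<mu>. positive_carleson_measure \<mu> \<longrightarrow>
           carleson_norm (weighted_pushforward \<Phi> \<mu>) \<le> ennreal C * carleson_norm \<mu> \<and>
           carleson_norm (weighted_pushforward \<Psi> \<mu>) \<le> ennreal C * carleson_norm \<mu>)"
    using hom carleson_preserving_uniformly_continuous[OF cp assms]
      carleson_preserving_uniformly_continuous[OF cp' \<Psi>] by blast
next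
  assume "\<exists>\<Psi>. homeomorphism unit_disc unit_disc \<Phi> \<Psi> \<and>
        pseudohyperbolic_uniformly_continuous \<Phi> \<and>
        pseudohyperbolic_uniformly_continuous \<Psi> \<and>
        (\<exists>C::real. \<forall>\<mu>. positive_carleson_measure \<mu> \<longrightarrow>
           carleson_norm (weighted_pushforward \<Phi> \<mu>) \<le> ennreal C * carleson_norm \<mu> \<and>
           carleson_norm (weighted_pushforward \<Psi> \<mu>) \<le> ennreal C * carleson_norm \<mu>)"
  then obtain \<Psi> C where "homeomorphism unit_disc unit_disc \<Phi> \<Psi>"
    "pseudohyperbolic_uniformly_continuous \<Phi>" "pseudohyperbolic_uniformly_continuous \<Psi>"
    "\<And>\<mu>. positive_carleson_measure \<mu> \<Longrightarrow> carleson_norm (weighted_pushforward \<Phi> \<mu>) \<le> ennreal C * carleson_norm \<mu>"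
    "\<And>\<mu>. positive_carleson_measure \<mu> \<Longrightarrow> carleson_norm (weighted_pushforward \<Psi> \<mu>) \<le> ennreal C * carleson_norm \<mu>"
    by blast
  then show "carleson_preserving \<Phi>" by (rule carleson_preserving_of_bounded[OF assms])
qed

end
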